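(* Let $n\ge1$, $\kappa\in\mathbb{N}_+^n$, and let $\mathcal{A},\mathcal{B}\subset\mathbb{N}_0^n$ be finite index sets with $(\alpha+\beta)\cdot\kappa=m$ for all $\alpha\in\mathcal{A},\beta\in\mathcal{B}$, $\mathcal{A}$ being $\mathcal{B}$-complete. Let $a_{\alpha\beta}\in\mathbb{C}$ ($\alpha\in\mathcal{A},\beta\in\mathcal{B}$) be constants such that $p(\xi)=\sum_{\alpha\in\mathcal{A},\beta\in\mathcal{B}}a_{\alpha\beta}(i\xi)^{\alpha+\beta}$ satisfies $\lambda|\xi|_\kappa^m\le|p(\xi)|\le\Lambda|\xi|_\kappa^m$ for all $\xi\in\mathbb{R}^n$, for some $0<\lambda<\Lambda$. Let $f_\beta$ ($\beta\in\mathcal{B}$) be continuous functions of polynomial growth on $\mathbb{R}^n$ and let $u\in\mathcal{S}'(\mathbb{R}^n)$ solve, in the sense of distributions, $$\sum_{\alpha\in\mathcal{A},\beta\in\mathcal{B}}a_{\alpha\beta}D^{\alpha+\beta}u=\sum_{\beta\in\mathcal{B}}D^\beta f_\beta.$$ Set $\omega_f(\rho):=\sup_{|x-y|_\kappa\le\rho}\sum_{\beta\in\mathcal{B}}|f_\beta(x)-f_\beta(y)|$. If $\omega_f(\rho)/\rho\in L^1(0,1)$ and $\omega_f(\rho)/\rho^2\in L^1(1,\infty)$, then for each $\alpha\in\mathbb{N}_0^n$ with $(\alpha+\beta)\cdot\kappa=m$ for all $\beta\in\mathcal{B}$, $D^\alpha u$ is represented by a continuous function, and there exist a polynomial $Q_\alpha$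 and a constant $C$ depending only on $\lambda,\Lambda$ such that for all $x,y\in\mathbb{R}^n$, $$|[D^\alpha u(x)-Q_\alpha(x)]-[D^\alpha u(y)-Q_\alpha(y)]|\le C\left(\int_0^{|x-y|_\kappa}\frac{\omega_f(\rho)}{\rho}d\rho+|x-y|_\kappa\int_{|x-y|_\kappa}^\infty\frac{\omega_f(\rho)}{\rho^2}d\rho\right).$$
   Context: For $\kappa\in\mathbb{N}_+^n$, $|x-y|_\kappa=\big(\sum_{l}|x^l-y^l|^{2/\kappa_l}\big)^{1/2}$. $\mathcal{A}$ is $\mathcal{B}$-complete if $\mathcal{A}$ equals the set of all $\alpha\in\mathbb{N}_0^n$ with $(\alpha+\beta)\cdot\kappa=m$ for every $\beta\in\mathcal{B}$. $D^\alpha$ is the distributional partial derivative of multi-order $\alpha$; $\mathcal{S}'$ denotes tempered distributions.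
   Formalization: The constant C may depend on n, κ, 𝒜, ℬ and m as well as on λ, Λ (it is uniform in the coefficients, f, u, α, x, y); a constant depending on λ, Λ alone does not exist, since C must grow with m. *)

theory Defs
  imports "HOL-Analysis.Analysis"
begin

text \<open>Points of R^n are vectors real^'n (index type 'n finite, n = CARD('n) \<ge> 1).
  Multi-indices are functions 'n \<Rightarrow> nat.\<close>

type_synonym 'n mindex = "'n \<Rightarrow> nat"

definition madd :: "'n mindex \<Rightarrow> 'n mindex \<Rightarrow> 'n mindex" where
  "madd \<alpha> \<beta> = (\<lambda>i. \<alpha> i + \<beta> i)"

definition mlen :: "('n::finite) mindex \<Rightarrow> nat" where
  "mlen \<alpha> = (\<Sum>i\<in>UNIV. \<alpha> i)"

definition mdot :: "('n::finite) mindex \<Rightarrow> ('n \<Rightarrow> nat) \<Rightarrow> nat" where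
  "mdot \<alpha> \<kappa> = (\<Sum>i\<in>UNIV. \<alpha> i * \<kappa> i)"

definition kdist :: "('n::finite \<Rightarrow> nat) \<Rightarrow> real^'n \<Rightarrow> real^'n \<Rightarrow> real" where
  "kdist \<kappa> x y = sqrt (\<Sum>l\<in>UNIV. \<bar>x$l - y$l\<bar> powr (2 / real (\<kappa> l)))"

definition knorm :: "('n::finite \<Rightarrow> nat) \<Rightarrow> real^'n \<Rightarrow> real" where
  "knorm \<kappa> x = kdist \<kappa> x 0"

definition B_complete :: "('n::finite) mindex set \<Rightarrow> 'n mindex set \<Rightarrow> ('n \<Rightarrow> nat) \<Rightarrow> nat \<Rightarrow> bool" where
  "B_complete A B \<kappa> m \<longleftrightarrow> A = {\<alpha>. \<forall>\<beta>\<in>B. mdot (madd \<alpha> \<beta>) \<kappa> = m}"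

definition partial :: "'n::finite \<Rightarrow> (real^'n \<Rightarrow> complex) \<Rightarrow> real^'n \<Rightarrow> complex" where
  "partial i f x = vector_derivative (\<lambda>t. f (x + t *\<^sub>R axis i 1)) (at 0)"

fun Dlist :: "('n::finite) list \<Rightarrow> (real^'n \<Rightarrow> complex) \<Rightarrow> real^'n \<Rightarrow> complex" where
  "Dlist [] f = f"
| "Dlist (i # ds) f = partial i (Dlist ds f)"

definition idx_list :: "('n::finite) list" where
  "idx_list = (SOME xs. distinct xs \<and> set xs = UNIV)"

definition Dm :: "('n::finite) mindex \<Rightarrow> (real^'n \<Rightarrow> complex) \<Rightarrow> real^'n \<Rightarrow> complex" where
  "Dm \<alpha> f = Dlist (concat (map (\<lambda>i. replicate (\<alpha> i) i) idx_list)) f"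

definition smooth_fn :: "(real^'n::finite \<Rightarrow> complex) \<Rightarrow> bool" where
  "smooth_fn f \<longleftrightarrow> (\<forall>ds. continuous_on UNIV (Dlist ds f) \<and>
      (\<forall>x i. (\<lambda>t. Dlist ds f (x + t *\<^sub>R axis i 1)) differentiable (at 0)))"

definition schwartz :: "(real^'n::finite \<Rightarrow> complex) set" where
  "schwartz = {\<phi>. smooth_fn \<phi> \<and>
      (\<forall>ds (k::nat). \<exists>M. \<forall>x. (1 + norm x) ^ k * norm (Dlist ds \<phi> x) \<le> M)}"

definition schwartz_seminorm :: "nat \<Rightarrow> (real^'n::finite \<Rightarrow> complex) \<Rightarrow> real" where
  "schwartz_seminorm N \<phi> =
     (\<Sum>ds\<in>{ds::'n list. length ds \<le> N}. \<Sum>k\<le>N.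
        (SUP x. (1 + norm x) ^ k * norm (Dlist ds \<phi> x)))"

text \<open>Tempered distributions: continuous linear functionals on the Schwartz space
  (values outside the Schwartz space are irrelevant).\<close>
definition tempered :: "((real^'n::finite \<Rightarrow> complex) \<Rightarrow> complex) \<Rightarrow> bool" where
  "tempered u \<longleftrightarrow>
     (\<forall>\<phi>\<in>schwartz. \<forall>\<psi>\<in>schwartz. u (\<lambda>x. \<phi> x + \<psi> x) = u \<phi> + u \<psi>) \<and>
     (\<forall>\<phi>\<in>schwartz. \<forall>c. u (\<lambda>x. c * \<phi> x) = c * u \<phi>) \<and>
     (\<exists>C N. \<forall>\<phi>\<in>schwartz. norm (u \<phi>) \<le> C * schwartz_seminorm N \<phi>)"

definition distD :: "('n::finite) mindex \<Rightarrow> ((real^'n \<Rightarrow> complex) \<Rightarrow> complex)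
    \<Rightarrow> (real^'n \<Rightarrow> complex) \<Rightarrow> complex" where
  "distD \<alpha> u \<phi> = (-1) ^ mlen \<alpha> * u (Dm \<alpha> \<phi>)"

definition fun_dist :: "(real^'n::finite \<Rightarrow> complex) \<Rightarrow> (real^'n \<Rightarrow> complex) \<Rightarrow> complex" where
  "fun_dist g \<phi> = (\<integral>x. g x * \<phi> x \<partial>lborel)"

definition poly_growth :: "(real^'n::finite \<Rightarrow> complex) \<Rightarrow> bool" where
  "poly_growth f \<longleftrightarrow> (\<exists>C (N::nat). \<forall>x. norm (f x) \<le> C * (1 + norm x) ^ N)"

definition poly_fn :: "(real^'n::finite \<Rightarrow> complex) \<Rightarrow> bool" where
  "poly_fn Q \<longleftrightarrow> (\<exists>P c. finite P \<and>
     (\<forall>x. Q x = (\<Sum>\<gamma>\<in>P. c \<gamma> * (\<Prod>i\<in>UNIV. complex_of_real (x$i) ^ \<gamma> i))))"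

definition symb :: "('n::finite) mindex set \<Rightarrow> 'n mindex set \<Rightarrow> ('n mindex \<Rightarrow> 'n mindex \<Rightarrow> complex)
    \<Rightarrow> real^'n \<Rightarrow> complex" where
  "symb A B a \<xi> = (\<Sum>\<alpha>\<in>A. \<Sum>\<beta>\<in>B. a \<alpha> \<beta> *
      (\<Prod>i\<in>UNIV. (\<i> * complex_of_real (\<xi>$i)) ^ madd \<alpha> \<beta> i))"

definition omega_f :: "('n::finite \<Rightarrow> nat) \<Rightarrow> 'n mindex set \<Rightarrow> ('n mindex \<Rightarrow> real^'n \<Rightarrow> complex)
    \<Rightarrow> real \<Rightarrow> ennreal" where
  "omega_f \<kappa> B f \<rho> = (SUP p\<in>{(x,y). kdist \<kappa> x y \<le> \<rho>}.
      ennreal (\<Sum>\<beta>\<in>B. norm (f \<beta> (fst p) - f \<beta> (snd p))))"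

end

theory Submission
  imports Defs "HOL-Probability.Probability"
begin

text \<open>
  The proof is a Littlewood--Paley decomposition adapted to the dilations
  $\delta_s x = (s^{\kappa_l} x_l)_l$ (the constant \<open>dil\<close>). Let $\eta$ be a smooth cut-off equal to 1
  near the origin and $\chi = \eta\circ\delta_{1/2} - \eta$. Since $p(-\xi)$ does not vanish on the
  support of $\chi$, the functions $(i\xi)^{\alpha+\beta}\chi(\xi)/p(-\xi)$ are smooth and compactly
  supported, hence inverse Fourier transforms of them are Schwartz kernels with vanishing integral;
  their rescalings give the frequency pieces $G_j$ of $D^\alpha u$ as correlations with the $f_\beta$,
  and $|G_j(x)-G_j(y)| \le C \min(1, 2^j|x-y|_\kappa)\,\omega_f(2^{-j})$. Summed over $j$ this is
  the claimed bound, so $g_0 = \sum_j (G_j - G_j(0))$ converges.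
  The kernels are bounded uniformly in the coefficients because the restriction of $p$ to a coordinate
  line is a polynomial of degree at most $m$, so its derivatives are fixed linear combinations of
  translates of $p$.

  Tested against a Schwartz function with sufficiently many vanishing moments, the low frequencies of
  $D^\alpha u$ tend to 0 (Taylor expansion), so $D^\alpha u - g_0$ annihilates all such functions.
  A functional whose kernel contains the common kernel of finitely many moments is a linear combination of
  them, that is, a polynomial. No Fourier transform of a distribution is needed.
\<close>

section \<open>Integration and partial derivatives on Euclidean space\<close>

text \<open>The condition (\<alpha> + \<beta>) . \<kappa> = m makes (i \<xi>)^(\<alpha>+\<beta>) /
  p(-\<xi>) homogeneous of degree 0 under the dilations, so for each \<beta> one kernel, rescaled,
  serves all scales and no power of 2^j survives. The sign in p(-\<xi>) comes from moving
  derivatives to the test function. The factor min (1, 2^j d), with d the distance of the two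
  points, is what produces the two integrals: scales 2^(-j) below d contribute omega(\<rho>)/\<rho>
  on (0, d), larger ones the factor d and omega(\<rho>)/\<rho>^2. The obstacle is at low
  frequencies, where only the increments of the pieces are summable. Subtracting G_j(0) repairs this
  and is invisible to test functions of mean zero; further moments, their number dictated by the
  order of u, are spent on the low-frequency limit. The polynomial Q is the price. Fourier inversion
  enters only in the form that the integral of the transform of h is c h(0), with one nonzero c. It
  gives both the zero mean of the kernels and the mass of the approximate identity.\<close>

text \<open>Here \<open>lc x c y\<close> stands for \<open>x + c y\<close>, so that the lemma applies to function spaces without a vector space type.\<close>

lemma finite_functional_span:
  fixes w :: "'v \<Rightarrow> complex" and ml :: "'i \<Rightarrow> 'v \<Rightarrow> complex" and V :: "'v set"
    and lc :: "'v \<Rightarrow> complex \<Rightarrow> 'v \<Rightarrow> 'v"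
  assumes "finite I"
    and closed: "\<And>x c y. x \<in> V \<Longrightarrow> y \<in> V \<Longrightarrow> lc x c y \<in> V"
    and lin: "\<And>i x c y. i \<in> I \<Longrightarrow> x \<in> V \<Longrightarrow> y \<in> V \<Longrightarrow> ml i (lc x c y) = ml i x + c * ml i y"
    and wlin: "\<And>x c y. x \<in> V \<Longrightarrow> y \<in> V \<Longrightarrow> w (lc x c y) = w x + c * w y"
    and ker: "\<And>x. x \<in> V \<Longrightarrow> (\<forall>i\<in>I. ml i x = 0) \<Longrightarrow> w x = 0"
  shows "\<exists>c. \<forall>x\<in>V. w x = (\<Sum>i\<in>I. c i * ml i x)"
  using assms(1) lin wlin ker
proof (induction I arbitrary: w rule: finite_induct)
  case empty
  then show ?case by auto
next
  case (insert j I)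
  note IH = insert.IH and lin' = insert.prems(1) and wlin' = insert.prems(2) and ker' = insert.prems(3)
  show ?case
  \<comment> \<open>If \<open>ml j\<close> vanishes on the common kernel of the others, it adds
    nothing to the kernel condition and receives the coefficient 0.\<close>
  proof (cases "\<forall>x\<in>V. (\<forall>i\<in>I. ml i x = 0) \<longrightarrow> ml j x = 0")
    case True
    have "\<exists>c. \<forall>x\<in>V. w x = (\<Sum>i\<in>I. c i * ml i x)"
    proof (rule IH)
      fix i x c y assume "i \<in> I" "x \<in> V" "y \<in> V"
      then show "ml i (lc x c y) = ml i x + c * ml i y" using lin' by simp
    next
      fix x c y assume "x \<in> V" "y \<in> V"
      then show "w (lc x c y) = w x + c * w y" by (rule wlin')
    next
      fix x assume "x \<in> V" "\<forall>i\<in>I. ml i x = 0"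
      then show "w x = 0" using True ker' by simp
    qed
    then obtain c where c: "\<forall>x\<in>V. w x = (\<Sum>i\<in>I. c i * ml i x)" by auto
    show ?thesis
      by (rule exI[of _ "c(j := 0)"])
         (use c insert.hyps in \<open>auto intro!: sum.cong\<close>)
  next
    case False
    then obtain v where v: "v \<in> V" "\<forall>i\<in>I. ml i v = 0" "ml j v \<noteq> 0" by auto
    \<comment> \<open>\<open>v\<close> is invisible to the functionals in \<open>I\<close> but not
      to \<open>ml j\<close>. Any x in the kernel of \<open>I\<close> can therefore be corrected by
      a multiple of \<open>v\<close> into the kernel of all of them, so \<open>w - d * ml j\<close>
      meets the induction hypothesis.\<close>
    define d where "d = w v / ml j v"
    have "\<exists>c. \<forall>x\<in>V. w x - d * ml j x = (\<Sum>i\<in>I. c i * ml i x)"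
    proof (rule IH)
      fix i x c y assume "i \<in> I" "x \<in> V" "y \<in> V"
      then show "ml i (lc x c y) = ml i x + c * ml i y" using lin' by simp
    next
      fix x c y assume "x \<in> V" "y \<in> V"
      then show "w (lc x c y) - d * ml j (lc x c y) = (w x - d * ml j x) + c * (w y - d * ml j y)"
        using lin'[of j x y c] wlin'[of x y c] by (simp add: algebra_simps)
    next
      fix x assume x: "x \<in> V" "\<forall>i\<in>I. ml i x = 0"
      define y where "y = lc x (- (ml j x / ml j v)) v"
      have yV: "y \<in> V" unfolding y_def using closed x v by simp
      have "\<forall>i\<in>insert j I. ml i y = 0"
        unfolding y_def using x v lin' by (auto simp: field_simps)
      then have "w y = 0" using ker' yV by simp
      then show "w x - d * ml j x = 0"
        using wlin'[OF x(1) v(1)] v(3) by (simp add: y_def d_def field_simps)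
    qed
    then obtain c where c: "\<forall>x\<in>V. w x - d * ml j x = (\<Sum>i\<in>I. c i * ml i x)" by auto
    show ?thesis
    proof (rule exI[of _ "c(j := d)"], intro ballI)
      fix x assume "x \<in> V"
      with c have "w x = d * ml j x + (\<Sum>i\<in>I. c i * ml i x)" by (simp add: algebra_simps)
      also have "(\<Sum>i\<in>I. c i * ml i x) = (\<Sum>i\<in>I. (c(j := d)) i * ml i x)"
        using insert.hyps by (intro sum.cong) auto
      finally show "w x = (\<Sum>i\<in>insert j I. (c(j := d)) i * ml i x)"
        using insert.hyps by simp
    qed
  qed
qed

section \<open>Differentiation and continuity of parameter integrals\<close>

lemma vector_mean_value_bound:
  fixes q :: "real \<Rightarrow> 'b::real_normed_vector"
  assumes "\<And>t. t \<in> closed_segment a b \<Longrightarrow> (q has_vector_derivative q' t) (at t)"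
    and "\<And>t. t \<in> closed_segment a b \<Longrightarrow> norm (q' t) \<le> B"
  shows "norm (q b - q a) \<le> B * \<bar>b - a\<bar>"
proof -
  have "norm (q b - q a) \<le> B * norm (b - a)"
  proof (rule differentiable_bound[where S="closed_segment a b" and f'="\<lambda>t h. h *\<^sub>R q' t"])
    fix t assume t: "t \<in> closed_segment a b"
    show "(q has_derivative (\<lambda>h. h *\<^sub>R q' t)) (at t within closed_segment a b)"
      using assms(1)[OF t] by (simp add: has_vector_derivative_def has_derivative_at_withinI)
    show "onorm (\<lambda>h. h *\<^sub>R q' t) \<le> B"
      using assms(2)[OF t] by (intro onorm_le) (simp add: mult.commute[of B] mult_left_mono)
  qed auto
  then show ?thesis by simp
qed

lemma has_vector_derivative_at_0_iff:
  fixes f :: "real \<Rightarrow> 'b::real_normed_vector"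
  shows "(f has_vector_derivative D) (at 0) \<longleftrightarrow> ((\<lambda>t. (f t - f 0) /\<^sub>R t) \<longlongrightarrow> D) (at 0)"
proof -
  have "(f has_vector_derivative D) (at 0) \<longleftrightarrow> ((\<lambda>h. norm (f h - f 0 - h *\<^sub>R D) / norm h) \<longlongrightarrow> 0) (at 0)"
    unfolding has_vector_derivative_def has_derivative_at
    by (simp add: bounded_linear_scaleR_left)
  also have "\<dots> \<longleftrightarrow> ((\<lambda>h. norm ((f h - f 0) /\<^sub>R h - D)) \<longlongrightarrow> 0) (at 0)"
  proof (rule tendsto_cong, rule eventually_at_filter[THEN iffD2], intro always_eventually allI impI)
    fix h :: real assume "h \<noteq> 0"
    then have "(f h - f 0) /\<^sub>R h - D = (f h - f 0 - h *\<^sub>R D) /\<^sub>R h"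
      by (simp add: algebra_simps)
    then show "norm (f h - f 0 - h *\<^sub>R D) / norm h = norm ((f h - f 0) /\<^sub>R h - D)"
      by (simp add: divide_inverse mult.commute)
  qed
  also have "\<dots> \<longleftrightarrow> ((\<lambda>t. (f t - f 0) /\<^sub>R t) \<longlongrightarrow> D) (at 0)"
    by (simp add: tendsto_norm_zero_iff LIM_zero_iff)
  finally show ?thesis .
qed

text \<open>Dominated convergence for the difference quotients, which the mean value inequality
  bounds by \<open>w\<close>. The bound is asked for |t| \<le> 1 only, so that a compactly supported
  integrand translated by t still has one integrable majorant.\<close>

lemma has_vector_derivative_integral:
  fixes f :: "real \<Rightarrow> 'a \<Rightarrow> 'b::{banach, second_countable_topology}"
  assumes int: "\<And>t. integrable M (f t)"
    and d: "\<And>t y. ((\<lambda>t. f t y) has_vector_derivative f' t y) (at t)"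
    and bd: "\<And>t y. \<bar>t\<bar> \<le> 1 \<Longrightarrow> norm (f' t y) \<le> w y"
    and w: "integrable M w"
  shows "((\<lambda>t. \<integral>y. f t y \<partial>M) has_vector_derivative (\<integral>y. f' 0 y \<partial>M)) (at 0)"
    and "integrable M (f' 0)"
proof -
  define s where "s t y = (f t y - f 0 y) /\<^sub>R t" for t y
  have sint: "integrable M (s t)" for t
    unfolding s_def[abs_def] using int by simp
  have smeas [measurable]: "s t \<in> borel_measurable M" for t using sint by auto
  have lim: "((\<lambda>t. s t y) \<longlongrightarrow> f' 0 y) (at 0)" for y
    using d[of y 0] unfolding has_vector_derivative_at_0_iff s_def .
  have sb: "norm (s t y) \<le> w y" if "\<bar>t\<bar> \<le> 1" for t y
  proof (cases "t = 0")
    case True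
    then show ?thesis using bd[of 0 y] norm_ge_zero[of "f' 0 y"] by (auto simp: s_def simp del: norm_ge_zero intro: order_trans[OF norm_ge_zero])
  next
    case False
    have "norm (f t y - f 0 y) \<le> w y * \<bar>t - 0\<bar>"
    proof (rule vector_mean_value_bound)
      fix r assume "r \<in> closed_segment 0 t"
      then have "\<bar>r\<bar> \<le> 1" using that by (auto simp: closed_segment_eq_real_ivl split: if_splits)
      then show "norm (f' r y) \<le> w y" by (rule bd)
    qed (rule d)
    with False show ?thesis by (simp add: s_def divide_simps mult.commute)
  qed
  have seq: "(\<lambda>i. s (X i) y) \<longlonglongrightarrow> f' 0 y" if "\<And>i. X i \<noteq> 0" "X \<longlonglongrightarrow> 0" for X :: "nat \<Rightarrow> real" and y
    using lim[of y] that unfolding tendsto_at_iff_sequentially comp_def by auto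
  \<comment> \<open>Measurability of the derivative is a conclusion: it is the pointwise limit of
    the difference quotients along 1 / (i + 1).\<close>
  have f'meas [measurable]: "f' 0 \<in> borel_measurable M"
  proof (rule borel_measurable_LIMSEQ_metric)
    show "s (1 / real (Suc i)) \<in> borel_measurable M" for i by measurable
    show "(\<lambda>i. s (1 / real (Suc i)) y) \<longlonglongrightarrow> f' 0 y" for y
      by (rule seq) (auto intro: LIMSEQ_inverse_real_of_nat simp: divide_inverse[of 1] simp del: of_nat_Suc)
  qed
  show "integrable M (f' 0)"
    by (rule Bochner_Integration.integrable_bound[OF w])
       (use bd[of 0] in \<open>auto intro!: AE_I2 order_trans[OF _ abs_ge_self]\<close>)
  have "((\<lambda>t. \<integral>y. s t y \<partial>M) \<longlongrightarrow> (\<integral>y. f' 0 y \<partial>M)) (at 0)"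
    unfolding tendsto_at_iff_sequentially comp_def
  proof (intro allI impI)
    fix X :: "nat \<Rightarrow> real" assume X: "\<forall>i. X i \<in> UNIV - {0}" "X \<longlonglongrightarrow> 0"
    have "eventually (\<lambda>i. \<bar>X i\<bar> < 1) sequentially"
      using X(2) order_tendstoD(2)[OF tendsto_rabs[OF X(2)], of 1] by simp
    then obtain N where N: "\<And>i. i \<ge> N \<Longrightarrow> \<bar>X i\<bar> < 1" by (auto simp: eventually_sequentially)
    have "(\<lambda>i. \<integral>y. s (X (i + N)) y \<partial>M) \<longlonglongrightarrow> (\<integral>y. f' 0 y \<partial>M)"
    proof (rule integral_dominated_convergence[where w=w])
      show "AE y in M. (\<lambda>i. s (X (i + N)) y) \<longlonglongrightarrow> f' 0 y"
        using X by (intro AE_I2 seq LIMSEQ_ignore_initial_segment) auto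
      show "AE y in M. norm (s (X (i + N)) y) \<le> w y" for i
        using N[of "i + N"] by (intro AE_I2 sb) auto
    qed (auto intro: w)
    then show "(\<lambda>i. \<integral>y. s (X i) y \<partial>M) \<longlonglongrightarrow> (\<integral>y. f' 0 y \<partial>M)"
      by (rule LIMSEQ_offset)
  qed
  moreover have "(\<integral>y. s t y \<partial>M) = ((\<integral>y. f t y \<partial>M) - (\<integral>y. f 0 y \<partial>M)) /\<^sub>R t" for t
    unfolding s_def using int by simp
  ultimately show "((\<lambda>t. \<integral>y. f t y \<partial>M) has_vector_derivative (\<integral>y. f' 0 y \<partial>M)) (at 0)"
    unfolding has_vector_derivative_at_0_iff by simp
qed

lemma continuous_on_integral_dominated:
  fixes f :: "'c::metric_space \<Rightarrow> 'a \<Rightarrow> 'b::{banach, second_countable_topology}"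
  assumes "\<And>x. f x \<in> borel_measurable M"
    and "\<And>y. continuous_on UNIV (\<lambda>x. f x y)"
    and "\<And>x y. norm (f x y) \<le> w y" and "integrable M w"
  shows "continuous_on UNIV (\<lambda>x. \<integral>y. f x y \<partial>M)"
  unfolding continuous_on_sequentially
proof (intro allI ballI impI, elim conjE)
  fix X :: "nat \<Rightarrow> 'c" and x assume X: "X \<longlonglongrightarrow> x"
  show "((\<lambda>x. \<integral>y. f x y \<partial>M) \<circ> X) \<longlonglongrightarrow> (\<integral>y. f x y \<partial>M)"
    unfolding comp_def
  proof (rule integral_dominated_convergence[where w=w])
    show "AE y in M. (\<lambda>i. f (X i) y) \<longlonglongrightarrow> f x y"
      using assms(2) X by (auto intro!: AE_I2 simp: continuous_on_sequentially comp_def)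
  qed (use assms in auto)
qed

text \<open>A relation rather than an equation for \<open>partial\<close>:
  \<open>vector_derivative\<close> has an unspecified value where no derivative exists, so existence
  and value are carried together.\<close>

definition has_pd :: "(real^'n::finite \<Rightarrow> complex) \<Rightarrow> 'n \<Rightarrow> (real^'n \<Rightarrow> complex) \<Rightarrow> bool" where
  "has_pd f i g \<longleftrightarrow> (\<forall>x. ((\<lambda>t. f (x + t *\<^sub>R axis i 1)) has_vector_derivative g x) (at 0))"

lemma has_pd_at:
  assumes "has_pd f i g"
  shows "((\<lambda>t. f (x + t *\<^sub>R axis i 1)) has_vector_derivative g (x + s *\<^sub>R axis i 1)) (at s)"
proof -
  have "((\<lambda>t. t - s) has_vector_derivative 1) (at s)"
    by (auto intro!: derivative_eq_intros)
  moreover have "((\<lambda>t. f ((x + s *\<^sub>R axis i 1) + t *\<^sub>R axis i 1)) has_vector_derivative g (x + s *\<^sub>R axis i 1)) (at (s - s))"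
    using assms by (simp add: has_pd_def)
  ultimately have "(((\<lambda>t. f ((x + s *\<^sub>R axis i 1) + t *\<^sub>R axis i 1)) \<circ> (\<lambda>t. t - s)) has_vector_derivative 1 *\<^sub>R g (x + s *\<^sub>R axis i 1)) (at s)"
    by (rule vector_diff_chain_at)
  then show ?thesis by (simp add: comp_def algebra_simps)
qed

lemma partial_eq: "has_pd f i g \<Longrightarrow> partial i f = g"
  by (intro ext) (auto simp: partial_def has_pd_def intro: vector_derivative_at)

lemma has_pd_partial:
  assumes "\<And>x. (\<lambda>t. f (x + t *\<^sub>R axis i 1)) differentiable (at 0)"
  shows "has_pd f i (partial i f)"
  using assms by (auto simp: has_pd_def partial_def vector_derivative_works)

lemma smooth_fn_has_pd: "smooth_fn f \<Longrightarrow> has_pd (Dlist ds f) i (Dlist (i # ds) f)"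
  unfolding Dlist.simps by (rule has_pd_partial) (auto simp: smooth_fn_def)

lemma smooth_fn_continuous: "smooth_fn f \<Longrightarrow> continuous_on UNIV (Dlist ds f)"
  by (auto simp: smooth_fn_def)

lemma smooth_fnI:
  assumes "\<And>ds. continuous_on UNIV (Dlist ds f)" "\<And>ds i. \<exists>g. has_pd (Dlist ds f) i g"
  shows "smooth_fn f"
proof -
  have "(\<lambda>t. Dlist ds f (x + t *\<^sub>R axis i 1)) differentiable (at 0)" for ds x i
    using assms(2)[of ds i] by (auto simp: has_pd_def intro: differentiableI_vector)
  then show ?thesis using assms(1) by (simp add: smooth_fn_def)
qed

lemma Dlist_append: "Dlist (ds @ es) f = Dlist ds (Dlist es f)"
  by (induction ds) auto

lemma smooth_fn_Dlist: "smooth_fn f \<Longrightarrow> smooth_fn (Dlist es f)"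
  by (simp add: smooth_fn_def flip: Dlist_append)

lemma sum_axis_eq: "(\<Sum>i\<in>UNIV. z$i *\<^sub>R axis i 1) = (z::real^'n::finite)"
  by (simp add: vec_eq_iff axis_def if_distrib[of "\<lambda>x. _ * x"] cong: if_cong)

text \<open>The point moves from x to x + z one coordinate at a time. Every intermediate point
  differs from x by at most the l1 norm of z, so bounds on the first partials there suffice and no
  total derivative enters.\<close>

lemma coordinate_mean_value:
  fixes \<phi> :: "real^'n::finite \<Rightarrow> complex"
  assumes pd: "\<And>i. has_pd \<phi> i (D i)"
    and bd: "\<And>i y. norm (y - x) \<le> (\<Sum>l\<in>UNIV. \<bar>z$l\<bar>) \<Longrightarrow> norm (D i y) \<le> B"
  shows "norm (\<phi> (x + z) - \<phi> x) \<le> (\<Sum>l\<in>UNIV. \<bar>z$l\<bar>) * B"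
proof -
  have "norm (\<phi> (x + (\<Sum>i\<in>S. z$i *\<^sub>R axis i 1)) - \<phi> x) \<le> (\<Sum>l\<in>S. \<bar>z$l\<bar>) * B" for S
    using finite[of S]
  proof (induction S rule: finite_induct)
    case (insert i S)
    define y where "y = x + (\<Sum>i\<in>S. z$i *\<^sub>R axis i 1)"
    have "norm (\<phi> (y + (z$i) *\<^sub>R axis i 1) - \<phi> (y + 0 *\<^sub>R axis i 1)) \<le> B * \<bar>z$i - 0\<bar>"
    proof (rule vector_mean_value_bound)
      fix t assume t: "t \<in> closed_segment 0 (z$i)"
      show "((\<lambda>t. \<phi> (y + t *\<^sub>R axis i 1)) has_vector_derivative D i (y + t *\<^sub>R axis i 1)) (at t)"
        by (rule has_pd_at[OF pd])
      have t': "\<bar>t\<bar> \<le> \<bar>z$i\<bar>" using t by (auto simp: closed_segment_eq_real_ivl split: if_splits)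
      have "norm (y + t *\<^sub>R axis i 1 - x) \<le> (\<Sum>l\<in>S. \<bar>z$l\<bar>) + \<bar>t\<bar>"
      proof -
        have n1: "norm (\<Sum>i\<in>S. z$i *\<^sub>R axis i 1 :: real^'n) \<le> (\<Sum>l\<in>S. \<bar>z$l\<bar>)"
          by (rule order_trans[OF norm_sum]) (simp add: norm_axis_1)
        have e: "y + t *\<^sub>R axis i 1 - x = (\<Sum>i\<in>S. z$i *\<^sub>R axis i 1) + t *\<^sub>R axis i 1"
          by (simp add: y_def)
        have n2: "norm (t *\<^sub>R axis i 1 :: real^'n) = \<bar>t\<bar>" by simp
        show ?thesis
          unfolding e using n1 n2 norm_triangle_ineq[of "\<Sum>i\<in>S. z$i *\<^sub>R axis i 1 :: real^'n" "t *\<^sub>R axis i 1"]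
          by linarith
      qed
      also have "\<dots> \<le> (\<Sum>l\<in>insert i S. \<bar>z$l\<bar>)" using insert t' by simp
      also have "\<dots> \<le> (\<Sum>l\<in>UNIV. \<bar>z$l\<bar>)" by (rule sum_mono2) auto
      finally show "norm (D i (y + t *\<^sub>R axis i 1)) \<le> B" by (rule bd)
    qed
    then have "norm (\<phi> (y + (z$i) *\<^sub>R axis i 1) - \<phi> y) \<le> B * \<bar>z$i\<bar>" by simp
    moreover have "norm (\<phi> (y + (z$i) *\<^sub>R axis i 1) - \<phi> x) \<le> norm (\<phi> (y + (z$i) *\<^sub>R axis i 1) - \<phi> y) + norm (\<phi> y - \<phi> x)"
      using norm_triangle_ineq[of "\<phi> (y + (z$i) *\<^sub>R axis i 1) - \<phi> y" "\<phi> y - \<phi> x"] by simp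
    ultimately have "norm (\<phi> (y + (z$i) *\<^sub>R axis i 1) - \<phi> x) \<le> B * \<bar>z$i\<bar> + (\<Sum>l\<in>S. \<bar>z$l\<bar>) * B"
      using insert.IH unfolding y_def by linarith
    then show ?case using insert.hyps by (simp add: y_def algebra_simps)
  qed simp
  from this[of UNIV] show ?thesis by (simp add: sum_axis_eq)
qed

text \<open>Peetre's inequality: it trades a polynomial weight at x + y for weights of the same
  order at x and at y.\<close>

lemma peetre: "1 + norm (x + y) \<le> (1 + norm x) * (1 + norm (y::'a::real_normed_vector))"
proof -
  have "1 + norm (x + y) \<le> 1 + norm x + norm y" using norm_triangle_ineq[of x y] by simp
  also have "\<dots> \<le> (1 + norm x) * (1 + norm y)" by (simp add: algebra_simps)
  finally show ?thesis .
qed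

lemma peetre_power: "(1 + norm (x + y)) ^ k \<le> (1 + norm x) ^ k * (1 + norm (y::'a::real_normed_vector)) ^ k"
  using power_mono[OF peetre[of x y], of k] by (simp add: power_mult_distrib)

text \<open>Lebesgue measure on the vector space is the image of a product measure indexed by
  \<open>Basis\<close>; the injection sending i to \<open>axis i 1\<close> turns that index set into
  the coordinate type.\<close>

lemma integral_vec_prod:
  fixes f :: "'n::finite \<Rightarrow> real \<Rightarrow> complex"
  assumes int: "\<And>i. integrable lborel (f i)"
  shows "integrable lborel (\<lambda>x::real^'n. \<Prod>i\<in>UNIV. f i (x$i))"
    and "integral\<^sup>L lborel (\<lambda>x::real^'n. \<Prod>i\<in>UNIV. f i (x$i)) = (\<Prod>i\<in>UNIV. \<integral>t. f i t \<partial>lborel)"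
proof -
  interpret product_sigma_finite "\<lambda>_::real^'n. lborel :: real measure" ..
  have inj: "inj (\<lambda>i. axis i (1::real) :: real^'n)" by (auto simp: inj_on_def axis_eq_axis)
  define idx where "idx = inv (\<lambda>i. axis i (1::real) :: real^'n)"
  have idx [simp]: "idx (axis i 1) = i" for i unfolding idx_def using inj by (rule inv_f_f)
  have B: "Basis = range (\<lambda>i. axis i (1::real) :: real^'n)" by (auto simp: Basis_vec_def)
  have re: "(\<Prod>b\<in>Basis. g b) = (\<Prod>i\<in>UNIV. g (axis i 1))" for g :: "real^'n \<Rightarrow> complex"
    unfolding B using inj by (subst prod.reindex) auto
  have fm [measurable]: "f i \<in> borel_measurable borel" for i
    using borel_measurable_integrable[OF int[of i]] by simp
  have comp: "(\<Sum>b\<in>Basis. g b *\<^sub>R b :: real^'n) $ i = g (axis i 1)" for g i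
  proof -
    have "(\<Sum>b\<in>Basis. g b *\<^sub>R b :: real^'n) $ i = (\<Sum>b\<in>Basis. g b *\<^sub>R b) \<bullet> axis i 1"
      by (simp add: inner_axis)
    also have "\<dots> = g (axis i 1)" by (subst inner_sum_left_Basis) (auto simp: B)
    finally show ?thesis .
  qed
  have P: "integrable (Pi\<^sub>M Basis (\<lambda>_. lborel)) (\<lambda>x. \<Prod>b\<in>(Basis::(real^'n) set). f (idx b) (x b))"
    by (rule product_integrable_prod) (auto intro: int)
  have e: "(\<lambda>x. \<Prod>b\<in>(Basis::(real^'n) set). f (idx b) (x b)) = (\<lambda>g. \<Prod>i\<in>UNIV. f i ((\<Sum>b\<in>Basis. g b *\<^sub>R b :: real^'n) $ i))"
    by (intro ext) (simp only: re comp idx)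
  have pm: "(\<lambda>x::real^'n. \<Prod>i\<in>UNIV. f i (x$i)) \<in> borel_measurable borel" by measurable
  show "integrable lborel (\<lambda>x::real^'n. \<Prod>i\<in>UNIV. f i (x$i))"
    by (subst lborel_eq, subst integrable_distr_eq) (use P pm in \<open>auto simp: e\<close>)
  have "integral\<^sup>L lborel (\<lambda>x::real^'n. \<Prod>i\<in>UNIV. f i (x$i)) = (\<integral>x. (\<Prod>b\<in>(Basis::(real^'n) set). f (idx b) (x b)) \<partial>Pi\<^sub>M Basis (\<lambda>_. lborel))"
    by (subst lborel_eq, subst integral_distr) (use pm in \<open>auto simp: e\<close>)
  also have "\<dots> = (\<Prod>b\<in>(Basis::(real^'n) set). \<integral>t. f (idx b) t \<partial>lborel)"
    by (rule product_integral_prod) (auto intro: int)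
  finally show "integral\<^sup>L lborel (\<lambda>x::real^'n. \<Prod>i\<in>UNIV. f i (x$i)) = (\<Prod>i\<in>UNIV. \<integral>t. f i t \<partial>lborel)"
    by (simp add: re)
qed

text \<open>The exponent gives each coordinate a factor \<open>(1 + norm x)^2\<close>, which
  dominates \<open>1 + (x$i)^2\<close>. This reduces the claim to the one-dimensional integrand 1 /
  (1 + t^2).\<close>

lemma integrable_weight: "integrable lborel (\<lambda>x::real^'n::finite. 1 / (1 + norm x) ^ (2 * CARD('n)))"
proof -
  have 1: "integrable lborel (\<lambda>t::real. inverse (1 + t^2))"
    using integrable_inverse_1_plus_square by (simp add: set_integrable_def einterval_def)
  then have "integrable lborel (\<lambda>t::real. complex_of_real (inverse (1 + t^2)))"
    by (rule integrable_of_real)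
  then have "integrable lborel (\<lambda>x::real^'n. \<Prod>i\<in>UNIV. complex_of_real (inverse (1 + (x$i)^2)))"
    by (intro integral_vec_prod)
  then show ?thesis
  proof (rule Bochner_Integration.integrable_bound)
    show "AE x::real^'n in lborel. norm (1 / (1 + norm x) ^ (2 * CARD('n))) \<le> norm (\<Prod>i\<in>UNIV. complex_of_real (inverse (1 + (x$i)^2)))"
    proof (rule AE_I2)
      fix x :: "real^'n"
      have "(\<Prod>i\<in>(UNIV::'n set). inverse ((1 + norm x) ^ 2)) \<le> (\<Prod>i\<in>UNIV. inverse (1 + (x$i)^2))"
      proof (rule prod_mono, intro conjI)
        fix i
        have "(x$i)^2 \<le> (norm x)^2" using component_le_norm_cart[of x i] by (metis abs_ge_zero power2_abs power_mono)
        then have "1 + (x$i)^2 \<le> (1 + norm x)^2" by (simp add: power2_sum add_increasing2)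
        then show "inverse ((1 + norm x)^2) \<le> inverse (1 + (x$i)^2)"
          by (intro le_imp_inverse_le) (auto simp: add_pos_nonneg)
      qed auto
      then show "norm (1 / (1 + norm x) ^ (2 * CARD('n))) \<le> norm (\<Prod>i\<in>UNIV. complex_of_real (inverse (1 + (x$i)^2)))"
        by (simp add: prod_norm[symmetric] norm_inverse power_mult power_inverse divide_inverse abs_prod del: of_real_inverse of_real_add of_real_power)
    qed
  qed measurable
qed

definition wint :: "'n::finite itself \<Rightarrow> real" where
  "wint _ = integral\<^sup>L lborel (\<lambda>x::real^'n. 1 / (1 + norm x) ^ (2 * CARD('n)))"

lemma wint_nonneg: "0 \<le> wint TYPE('n::finite)"
  unfolding wint_def by (rule integral_nonneg_AE) auto

text \<open>The device by which weighted sup bounds become integral bounds: surplus decay of order 2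
  n costs the constant \<open>wint\<close>.\<close>

lemma weight_dominated:
  fixes g :: "real^'n::finite \<Rightarrow> complex"
  assumes "g \<in> borel_measurable borel" "\<And>x. (1 + norm x) ^ (2 * CARD('n)) * norm (g x) \<le> M"
  shows "integrable lborel g" "norm (\<integral>x. g x \<partial>lborel) \<le> M * wint TYPE('n)"
    "integral\<^sup>L lborel (\<lambda>x. norm (g x)) \<le> M * wint TYPE('n)"
proof -
  have i: "integrable lborel (\<lambda>x::real^'n. M * (1 / (1 + norm x) ^ (2 * CARD('n))))"
    using integrable_weight by (rule integrable_mult_right)
  have b: "norm (g x) \<le> M * (1 / (1 + norm x) ^ (2 * CARD('n)))" for x
    using assms(2)[of x] by (simp add: field_simps add_pos_nonneg)
  have "0 \<le> M" using order_trans[OF _ assms(2)[of 0]] by simp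
  show g: "integrable lborel g"
    by (rule Bochner_Integration.integrable_bound[OF i])
       (use assms b \<open>0 \<le> M\<close> in \<open>auto intro!: AE_I2 order_trans[OF b]\<close>)
  show *: "integral\<^sup>L lborel (\<lambda>x. norm (g x)) \<le> M * wint TYPE('n)"
    unfolding wint_def integral_mult_right_zero[symmetric]
    by (rule integral_mono) (use g i b in auto)
  show "norm (\<integral>x. g x \<partial>lborel) \<le> M * wint TYPE('n)"
    using integral_norm_bound[of lborel g] * by linarith
qed

section \<open>Translations, reflections and dilations of the Lebesgue integral\<close>

lemma lborel_translate:
  fixes f :: "real^'n::finite \<Rightarrow> complex"
  assumes [measurable]: "f \<in> borel_measurable borel"
  shows "(\<integral>x. f (c + x) \<partial>lborel) = (\<integral>x. f x \<partial>lborel)" "integrable lborel (\<lambda>x. f (c + x)) \<longleftrightarrow> integrable lborel f"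
proof -
  have "integral\<^sup>L (distr lborel borel ((+) c)) f = (\<integral>x. f (c + x) \<partial>lborel)"
    by (rule integral_distr) auto
  then show "(\<integral>x. f (c + x) \<partial>lborel) = (\<integral>x. f x \<partial>lborel)" by (simp add: lborel_distr_plus)
  have "integrable (distr lborel borel ((+) c)) f = integrable lborel (\<lambda>x. f (c + x))"
    by (rule integrable_distr_eq) auto
  then show "integrable lborel (\<lambda>x. f (c + x)) \<longleftrightarrow> integrable lborel f" by (simp add: lborel_distr_plus)
qed

definition dil :: "('n::finite \<Rightarrow> nat) \<Rightarrow> real \<Rightarrow> real^'n \<Rightarrow> real^'n" where
  "dil \<kappa> s x = (\<chi> l. s ^ \<kappa> l * x$l)"

lemma dil_nth [simp]: "dil \<kappa> s x $ l = s ^ \<kappa> l * x $ l"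
  by (simp add: dil_def)

lemma continuous_on_dil [continuous_intros]: "continuous_on S f \<Longrightarrow> continuous_on S (\<lambda>x. dil \<kappa> s (f x))"
  unfolding dil_def by (intro continuous_intros)

lemma measurable_dil [measurable]: "dil \<kappa> s \<in> borel_measurable borel"
  by (intro borel_measurable_continuous_onI continuous_on_dil continuous_on_id)

lemma lborel_affine_dil:
  fixes f :: "real^'n::finite \<Rightarrow> complex" and d :: "'n \<Rightarrow> real"
  assumes [measurable]: "f \<in> borel_measurable borel" and d: "\<And>l. d l \<noteq> 0"
  shows "(\<integral>x. f x \<partial>lborel) = (\<Prod>l\<in>UNIV. \<bar>d l\<bar>) *\<^sub>R (\<integral>x. f (c + (\<chi> l. d l * x$l)) \<partial>lborel)"
proof -
  \<comment> \<open>The change of variables takes factors indexed by \<open>Basis\<close>. The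
    linear functional with value \<open>d i\<close> at \<open>axis i 1\<close> provides
    them.\<close>
  define D where "D b = (\<Sum>l\<in>UNIV. d l * (b $ l))" for b :: "real^'n"
  have inj: "inj (\<lambda>i. axis i (1::real) :: real^'n)" by (auto simp: inj_on_def axis_eq_axis)
  have B: "Basis = range (\<lambda>i. axis i (1::real) :: real^'n)" by (auto simp: Basis_vec_def)
  have Dax: "D (axis i 1) = d i" for i by (simp add: D_def axis_def if_distrib[of "\<lambda>x. _ * x"] cong: if_cong)
  have T: "(\<Sum>j\<in>Basis. (D j * (x \<bullet> j)) *\<^sub>R j) = (\<chi> l. d l * x$l)" for x :: "real^'n"
  proof -
    have "(\<Sum>j\<in>Basis. (D j * (x \<bullet> j)) *\<^sub>R j) = (\<Sum>i\<in>UNIV. ((\<chi> l. d l * x$l)$i) *\<^sub>R axis i 1)"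
      unfolding B using inj by (subst sum.reindex) (auto simp: Dax inner_axis)
    then show ?thesis by (simp only: sum_axis_eq)
  qed
  have Pr: "(\<Prod>j\<in>(Basis::(real^'n) set). \<bar>D j\<bar>) = (\<Prod>l\<in>UNIV. \<bar>d l\<bar>)"
    unfolding B using inj by (subst prod.reindex) (auto simp: Dax)
  have le: "lborel = density (distr lborel borel (\<lambda>x. c + (\<chi> l. d l * x$l))) (\<lambda>_. (\<Prod>l\<in>UNIV. \<bar>d l\<bar>))"
  proof -
    have nz: "D j \<noteq> 0" if "j \<in> Basis" for j using that d by (auto simp: B Dax)
    show ?thesis using lborel_affine_euclidean[of D c, OF nz] unfolding T Pr by simp
  qed
  have m: "(\<lambda>x. c + (\<chi> l. d l * x$l)) \<in> borel_measurable borel"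
    by (intro borel_measurable_continuous_onI continuous_intros)
  show ?thesis
    by (subst le, subst integral_density)
       (use m in \<open>auto simp: prod_nonneg integral_distr\<close>)
qed

lemma lborel_reflect:
  fixes f :: "real^'n::finite \<Rightarrow> complex"
  assumes "f \<in> borel_measurable borel"
  shows "(\<integral>x. f (c - x) \<partial>lborel) = (\<integral>x. f x \<partial>lborel)"
proof -
  have "c + (\<chi> l. - (x $ l)) = c - x" for x :: "real^'n" by (simp add: vec_eq_iff)
  then show ?thesis using lborel_affine_dil[OF assms, of "\<lambda>_. -1" c] by simp
qed

lemma lborel_dil:
  fixes f :: "real^'n::finite \<Rightarrow> complex"
  assumes "f \<in> borel_measurable borel" "s > 0"
  shows "(\<integral>x. f x \<partial>lborel) = complex_of_real (s ^ (\<Sum>l\<in>UNIV. \<kappa> l)) * (\<integral>x. f (dil \<kappa> s x) \<partial>lborel)"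
  using lborel_affine_dil[OF assms(1), of "\<lambda>l. s ^ \<kappa> l" 0] assms(2)
  by (simp add: dil_def power_sum scaleR_conv_of_real abs_prod[symmetric] prod_nonneg)

section \<open>Uniformly smooth families of functions\<close>

text \<open>If every generator is continuous and bounded on \<open>K\<close> uniformly in the parameter, and has partial
  derivatives in the generated algebra, then so does every element, hence all iterated derivatives are bounded
  uniformly in the parameter. This replaces explicit Leibniz and quotient rules of higher order.\<close>

inductive_set gen :: "('a \<Rightarrow> real^'n::finite \<Rightarrow> complex) set \<Rightarrow> ('a \<Rightarrow> real^'n \<Rightarrow> complex) set"
  for S where
  base: "F \<in> S \<Longrightarrow> F \<in> gen S"
| const: "(\<lambda>a x. c) \<in> gen S"
| add: "F \<in> gen S \<Longrightarrow> G \<in> gen S \<Longrightarrow> (\<lambda>a x. F a x + G a x) \<in> gen S"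
| mult: "F \<in> gen S \<Longrightarrow> G \<in> gen S \<Longrightarrow> (\<lambda>a x. F a x * G a x) \<in> gen S"

lemma gen_sum: "finite J \<Longrightarrow> (\<And>j. j \<in> J \<Longrightarrow> F j \<in> gen S) \<Longrightarrow> (\<lambda>a x. \<Sum>j\<in>J. F j a x) \<in> gen S"
  by (induction J rule: finite_induct) (auto intro: gen.const gen.add)

text \<open>Smoothness is global while bounds are asked on \<open>K\<close> only. \<open>K\<close>
  is later a ball containing all supports; the empty \<open>K\<close> with a one-point index set
  gives back plain smoothness, so closure properties of families transfer to single
  functions.\<close>

definition usmooth :: "'a set \<Rightarrow> (real^'n::finite) set \<Rightarrow> ('a \<Rightarrow> real^'n \<Rightarrow> complex) \<Rightarrow> bool" where
  "usmooth I K F \<longleftrightarrow> (\<forall>a\<in>I. smooth_fn (F a)) \<and>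
     (\<forall>ds. \<exists>M. \<forall>a\<in>I. \<forall>x\<in>K. norm (Dlist ds (F a) x) \<le> M)"

definition ubounded :: "'a set \<Rightarrow> (real^'n::finite) set \<Rightarrow> ('a \<Rightarrow> real^'n \<Rightarrow> complex) \<Rightarrow> bool" where
  "ubounded I K F \<longleftrightarrow> (\<forall>a\<in>I. continuous_on UNIV (F a)) \<and> (\<exists>M. \<forall>a\<in>I. \<forall>x\<in>K. norm (F a x) \<le> M)"

lemma has_pd_add: "has_pd f i f' \<Longrightarrow> has_pd g i g' \<Longrightarrow> has_pd (\<lambda>x. f x + g x) i (\<lambda>x. f' x + g' x)"
  by (auto simp: has_pd_def intro: has_vector_derivative_add)

lemma has_pd_mult:
  assumes "has_pd f i f'" "has_pd g i g'"
  shows "has_pd (\<lambda>x. f x * g x) i (\<lambda>x. f x * g' x + f' x * g x)"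
  unfolding has_pd_def
proof
  fix x
  show "((\<lambda>t. f (x + t *\<^sub>R axis i 1) * g (x + t *\<^sub>R axis i 1)) has_vector_derivative f x * g' x + f' x * g x) (at 0)"
    using has_vector_derivative_mult[of "\<lambda>t. f (x + t *\<^sub>R axis i 1)" "f' x" 0 UNIV "\<lambda>t. g (x + t *\<^sub>R axis i 1)" "g' x"] assms
    by (auto simp: has_pd_def)
qed

lemma has_pd_const: "has_pd (\<lambda>x. c) i (\<lambda>x. 0)"
  by (simp add: has_pd_def)

lemma gen_ubounded:
  assumes S: "\<And>F. F \<in> S \<Longrightarrow> ubounded I K F" and F: "F \<in> gen S"
  shows "ubounded I K F"
  using F
proof (induction rule: gen.induct)
  case (add F G)
  then obtain M N where "\<forall>a\<in>I. \<forall>x\<in>K. norm (F a x) \<le> M" "\<forall>a\<in>I. \<forall>x\<in>K. norm (G a x) \<le> N"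
    by (auto simp: ubounded_def)
  then have "\<forall>a\<in>I. \<forall>x\<in>K. norm (F a x + G a x) \<le> M + N"
    by (auto intro!: norm_triangle_le add_mono)
  with add show ?case by (auto simp: ubounded_def intro!: continuous_intros)
next
  case (mult F G)
  then obtain M N where MN: "\<forall>a\<in>I. \<forall>x\<in>K. norm (F a x) \<le> M" "\<forall>a\<in>I. \<forall>x\<in>K. norm (G a x) \<le> N"
    by (auto simp: ubounded_def)
  have "\<forall>a\<in>I. \<forall>x\<in>K. norm (F a x * G a x) \<le> M * N"
    unfolding norm_mult using MN by (auto intro!: mult_mono intro: order_trans[OF norm_ge_zero])
  with mult show ?case by (auto simp: ubounded_def intro!: continuous_intros)
next
  case (const c)
  have "\<forall>a\<in>I. \<forall>x\<in>K. norm c \<le> norm c" by simp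
  then show ?case unfolding ubounded_def by (auto intro!: continuous_intros)
qed (rule S)

lemma gen_has_pd:
  assumes D: "\<And>F i. F \<in> S \<Longrightarrow> \<exists>G\<in>gen S. \<forall>a\<in>I. has_pd (F a) i (G a)" and F: "F \<in> gen S"
  shows "\<exists>G\<in>gen S. \<forall>a\<in>I. has_pd (F a) i (G a)"
  using F
proof (induction rule: gen.induct)
  case (const c)
  show ?case by (rule bexI[OF _ gen.const[of 0]]) (simp add: has_pd_const)
next
  case (add F G)
  then obtain F' G' where *: "F' \<in> gen S" "G' \<in> gen S" "\<forall>a\<in>I. has_pd (F a) i (F' a)" "\<forall>a\<in>I. has_pd (G a) i (G' a)"
    by blast
  show ?case
    by (rule bexI[OF _ gen.add[OF *(1,2)]]) (use * in \<open>auto intro: has_pd_add\<close>)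
next
  case (mult F G)
  then obtain F' G' where *: "F' \<in> gen S" "G' \<in> gen S" "\<forall>a\<in>I. has_pd (F a) i (F' a)" "\<forall>a\<in>I. has_pd (G a) i (G' a)"
    by blast
  show ?case
    by (rule bexI[OF _ gen.add[OF gen.mult[OF mult.hyps(1) *(2)] gen.mult[OF *(1) mult.hyps(2)]]])
       (use * in \<open>auto intro: has_pd_mult\<close>)
qed (rule D)

lemma gen_usmooth:
  assumes S: "\<And>F. F \<in> S \<Longrightarrow> ubounded I K F"
    and D: "\<And>F i. F \<in> S \<Longrightarrow> \<exists>G\<in>gen S. \<forall>a\<in>I. has_pd (F a) i (G a)" and F: "F \<in> gen S"
  shows "usmooth I K F"
proof -
  have *: "\<exists>G\<in>gen S. \<forall>a\<in>I. Dlist ds (F a) = G a" for ds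
  proof (induction ds)
    case Nil
    then show ?case using F by auto
  next
    case (Cons i ds)
    then obtain G where G: "G \<in> gen S" "\<forall>a\<in>I. Dlist ds (F a) = G a" by auto
    obtain H where "H \<in> gen S" "\<forall>a\<in>I. has_pd (G a) i (H a)"
      using gen_has_pd[OF D G(1), of i] by auto
    then show ?case using G by (auto dest!: partial_eq intro!: bexI[of _ H])
  qed
  have "continuous_on UNIV (Dlist ds (F a))" if "a \<in> I" for a ds
    using *[of ds] gen_ubounded[OF S] that by (auto simp: ubounded_def)
  moreover have "\<exists>g. has_pd (Dlist ds (F a)) i g" if "a \<in> I" for a ds i
    using *[of ds] gen_has_pd[OF D, of _ i] that by metis
  ultimately have "smooth_fn (F a)" if "a \<in> I" for a
    using that by (intro smooth_fnI) auto
  moreover have "\<exists>M. \<forall>a\<in>I. \<forall>x\<in>K. norm (Dlist ds (F a) x) \<le> M" for ds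
  proof -
    obtain G where G: "G \<in> gen S" "\<forall>a\<in>I. Dlist ds (F a) = G a" using *[of ds] by auto
    then obtain M where "\<forall>a\<in>I. \<forall>x\<in>K. norm (G a x) \<le> M" using gen_ubounded[OF S G(1)] by (auto simp: ubounded_def)
    with G show ?thesis by auto
  qed
  ultimately show ?thesis by (auto simp: usmooth_def)
qed

lemma usmooth_ubounded: "usmooth I K F \<Longrightarrow> ubounded I K F"
  using smooth_fn_continuous[of _ "[]"] unfolding usmooth_def ubounded_def
  by (metis Dlist.simps(1))

lemma usmooth_Dlist: "usmooth I K F \<Longrightarrow> usmooth I K (\<lambda>a. Dlist ds (F a))"
  by (auto simp: usmooth_def smooth_fn_Dlist simp flip: Dlist_append)

lemma usmooth_has_pd: "usmooth I K F \<Longrightarrow> a \<in> I \<Longrightarrow> has_pd (F a) i (Dlist [i] (F a))"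
  using smooth_fn_has_pd[of "F a" "[]" i] by (auto simp: usmooth_def)

text \<open>New generators \<open>T\<close> may have derivatives that involve \<open>T\<close>
  itself and functions already known to be uniformly smooth. A new function is thus handled by one
  first-order derivative formula, and the iteration is left to \<open>gen_usmooth\<close>.\<close>

lemma usmooth_extend:
  assumes T: "\<And>F. F \<in> T \<Longrightarrow> ubounded I K F"
    and D: "\<And>F i. F \<in> T \<Longrightarrow> \<exists>G\<in>gen (T \<union> Collect (usmooth I K)). \<forall>a\<in>I. has_pd (F a) i (G a)"
    and F: "F \<in> gen (T \<union> Collect (usmooth I K))"
  shows "usmooth I K F"
proof (rule gen_usmooth[OF _ _ F])
  fix F assume "F \<in> T \<union> Collect (usmooth I K)"
  then show "ubounded I K F" using T usmooth_ubounded by auto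
next
  fix F i assume F: "F \<in> T \<union> Collect (usmooth I K)"
  show "\<exists>G\<in>gen (T \<union> Collect (usmooth I K)). \<forall>a\<in>I. has_pd (F a) i (G a)"
  proof (cases "F \<in> T")
    case False
    then have "usmooth I K F" using F by simp
    then show ?thesis
      by (intro bexI[of _ "\<lambda>a. Dlist [i] (F a)"] ballI usmooth_has_pd gen.base UnI2 CollectI usmooth_Dlist)
  qed (rule D)
qed

lemma usmooth_gen: "F \<in> gen (Collect (usmooth I K)) \<Longrightarrow> usmooth I K F"
  using usmooth_extend[of "{}" I K F] by auto

lemma usmooth_const: "usmooth I K (\<lambda>a x. c)"
  by (rule usmooth_gen, rule gen.const)

lemma usmooth_add: "usmooth I K F \<Longrightarrow> usmooth I K G \<Longrightarrow> usmooth I K (\<lambda>a x. F a x + G a x)"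
  by (rule usmooth_gen, rule gen.add) (auto intro: gen.base)

lemma usmooth_mult: "usmooth I K F \<Longrightarrow> usmooth I K G \<Longrightarrow> usmooth I K (\<lambda>a x. F a x * G a x)"
  by (rule usmooth_gen, rule gen.mult) (auto intro: gen.base)

lemma usmooth_minus: "usmooth I K F \<Longrightarrow> usmooth I K G \<Longrightarrow> usmooth I K (\<lambda>a x. F a x - G a x)"
  using usmooth_add[OF _ usmooth_mult[OF usmooth_const[of I K "-1"]], of F G] by simp

lemma usmooth_prod: "finite J \<Longrightarrow> (\<And>j. j \<in> J \<Longrightarrow> usmooth I K (F j)) \<Longrightarrow> usmooth I K (\<lambda>a x. \<Prod>j\<in>J. F j a x)"
  by (induction J rule: finite_induct) (auto intro: usmooth_const usmooth_mult)

lemma usmooth_power: "usmooth I K F \<Longrightarrow> usmooth I K (\<lambda>a x. F a x ^ k)"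
  by (induction k) (auto intro: usmooth_const usmooth_mult)

lemma smooth_fn_usmooth: "smooth_fn f \<longleftrightarrow> usmooth {()} {} (\<lambda>_. f)"
  by (simp add: usmooth_def)

lemma usmooth_const_family:
  assumes "smooth_fn f" "compact K"
  shows "usmooth I K (\<lambda>a. f)"
proof -
  have "\<exists>M. \<forall>x\<in>K. norm (Dlist ds f x) \<le> M" for ds
  proof -
    have "compact (Dlist ds f ` K)"
      using assms by (intro compact_continuous_image continuous_on_subset[OF smooth_fn_continuous]) auto
    then show ?thesis by (auto dest!: compact_imp_bounded simp: bounded_iff)
  qed
  then show ?thesis using assms by (auto simp: usmooth_def)
qed

text \<open>The derivative of 1/F is -(1/F) F' (1/F), which lies in the algebra generated by 1/F and
  uniformly smooth functions. The constant \<open>c\<close> bounds 1/F on \<open>K\<close>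
  uniformly; nonvanishing off \<open>K\<close> keeps 1/F continuous on the whole space.\<close>

lemma usmooth_inverse:
  assumes F: "usmooth I K F" and nz: "\<And>a x. a \<in> I \<Longrightarrow> F a x \<noteq> 0"
    and c: "c > 0" "\<And>a x. a \<in> I \<Longrightarrow> x \<in> K \<Longrightarrow> c \<le> norm (F a x)"
  shows "usmooth I K (\<lambda>a x. inverse (F a x))"
proof (rule usmooth_extend[of "{\<lambda>a x. inverse (F a x)}"])
  fix G assume G: "G \<in> {\<lambda>a x. inverse (F a x)}"
  have "\<forall>a\<in>I. \<forall>x\<in>K. norm (inverse (F a x)) \<le> inverse c"
    using c by (auto simp: norm_inverse intro!: le_imp_inverse_le)
  moreover have "\<forall>a\<in>I. continuous_on UNIV (F a)" using usmooth_ubounded[OF F] by (auto simp: ubounded_def)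
  ultimately show "ubounded I K G" using nz G
    by (auto simp: ubounded_def intro!: continuous_intros)
next
  fix G i assume G: "G \<in> {\<lambda>a x. inverse (F a x)}"
  let ?S = "{\<lambda>a x. inverse (F a x)} \<union> Collect (usmooth I K)"
  have 1: "(\<lambda>a x. inverse (F a x)) \<in> gen ?S" by (intro gen.base) auto
  have 2: "(\<lambda>a. Dlist [i] (F a)) \<in> gen ?S" using usmooth_Dlist[OF F, of "[i]"] by (intro gen.base UnI2 CollectI)
  have "has_pd (\<lambda>x. inverse (F a x)) i (\<lambda>x. -1 * (inverse (F a x) * (Dlist [i] (F a) x * inverse (F a x))))" if "a \<in> I" for a
    unfolding has_pd_def
  proof
    fix x
    have "((\<lambda>t. F a (x + t *\<^sub>R axis i 1)) has_derivative (\<lambda>h. h *\<^sub>R Dlist [i] (F a) x)) (at 0)"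
      using usmooth_has_pd[OF F that, of i] by (simp add: has_pd_def has_vector_derivative_def)
    from Deriv.has_derivative_inverse[OF _ this]
    show "((\<lambda>t. inverse (F a (x + t *\<^sub>R axis i 1))) has_vector_derivative - 1 * (inverse (F a x) * (Dlist [i] (F a) x * inverse (F a x)))) (at 0)"
      using nz[OF that] by (simp add: has_vector_derivative_def mult.assoc)
  qed
  then show "\<exists>H\<in>gen ?S. \<forall>a\<in>I. has_pd (G a) i (H a)"
    using G by (intro bexI[OF _ gen.mult[OF gen.const[of "-1"] gen.mult[OF 1 gen.mult[OF 2 1]]]]) auto
qed (auto intro: gen.base)

lemma usmooth_cnj:
  assumes F: "usmooth I K F"
  shows "usmooth I K (\<lambda>a x. cnj (F a x))"
proof (rule usmooth_extend[of "{\<lambda>a x. cnj (F a x) | F. usmooth I K F}"])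
  fix G assume "G \<in> {\<lambda>a x. cnj (F a x) | F. usmooth I K F}"
  then show "ubounded I K G"
    using usmooth_ubounded by (auto simp: ubounded_def intro!: continuous_intros) blast+
next
  fix G i assume "G \<in> {\<lambda>a x. cnj (F a x) | F. usmooth I K F}"
  then obtain F where F: "usmooth I K F" "G = (\<lambda>a x. cnj (F a x))" by auto
  have "has_pd (G a) i (\<lambda>x. cnj (Dlist [i] (F a) x))" if "a \<in> I" for a
    using usmooth_has_pd[OF F(1) that, of i] unfolding F(2) has_pd_def
    by (auto intro!: bounded_linear.has_vector_derivative[OF bounded_linear_cnj])
  then show "\<exists>H\<in>gen ({\<lambda>a x. cnj (F a x) | F. usmooth I K F} \<union> Collect (usmooth I K)). \<forall>a\<in>I. has_pd (G a) i (H a)"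
    using usmooth_Dlist[OF F(1), of "[i]"] by (intro bexI[of _ "\<lambda>a x. cnj (Dlist [i] (F a) x)"] gen.base UnI1 CollectI exI[of _ "\<lambda>a. Dlist [i] (F a)"]) auto
qed (use F in \<open>auto intro!: gen.base\<close>)

lemma has_pd_coord: "has_pd (\<lambda>x. complex_of_real (x$j)) i (\<lambda>x. if i = j then 1 else 0)"
proof -
  have "((\<lambda>t. complex_of_real (x$j + t * axis i 1 $ j)) has_vector_derivative of_real (axis i 1 $ j)) (at 0)" for x
    by (intro has_vector_derivative_of_real) (auto intro!: derivative_eq_intros)
  then show ?thesis by (auto simp: has_pd_def axis_def)
qed

lemma smooth_fn_coord: "smooth_fn (\<lambda>x. complex_of_real (x$j))"
  unfolding smooth_fn_usmooth
proof (rule usmooth_extend[of "{\<lambda>_ x. complex_of_real (x$j)}"])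
  fix G i assume "G \<in> {\<lambda>(_::unit) (x::real^'a). complex_of_real (x$j)}"
  then show "\<exists>H\<in>gen ({\<lambda>_ x. complex_of_real (x$j)} \<union> Collect (usmooth {()} {})). \<forall>a\<in>{()}. has_pd (G a) i (H a)"
    using has_pd_coord[of j i] by (intro bexI[OF _ gen.const[of "if i = j then 1 else 0"]]) auto
qed (auto simp: ubounded_def intro!: gen.base continuous_intros)

text \<open>A polynomial of degree at most d that vanishes at the d + 1 nodes 0, ..., d is zero. So
  the functional \<open>c 1\<close> vanishes on the common kernel of the node evaluations and is a
  linear combination of them.\<close>

lemma polynomial_derivative_from_values:
  assumes "1 \<le> d"
  shows "\<exists>w::nat \<Rightarrow> complex. \<forall>c. c 1 = (\<Sum>j\<in>{..d}. w j * (\<Sum>k\<le>d. c k * of_nat j ^ k))"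
proof -
  have "\<exists>w. \<forall>c\<in>UNIV. c 1 = (\<Sum>j\<in>{..d}. w j * (\<Sum>k\<le>d. c k * (of_nat j :: complex) ^ k))"
  proof (rule finite_functional_span[where lc="\<lambda>x c y k. x k + c * y k"])
    fix c :: "nat \<Rightarrow> complex" assume z: "\<forall>j\<in>{..d}. (\<Sum>k\<le>d. c k * of_nat j ^ k) = 0"
    show "c 1 = 0"
    proof (rule ccontr)
      assume "c 1 \<noteq> 0"
      then have fin: "finite {z. (\<Sum>k\<le>d. c k * z ^ k) = 0}" and cd: "card {z. (\<Sum>k\<le>d. c k * z ^ k) = 0} \<le> d"
        using Transcendental.polyfun_rootbound[of c 1 d] assms by auto
      have "of_nat ` {..d} \<subseteq> {z. (\<Sum>k\<le>d. c k * z ^ k) = 0}" using z by auto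
      then have "card ((of_nat :: nat \<Rightarrow> complex) ` {..d}) \<le> d" using card_mono[OF fin] cd by (meson order_trans)
      moreover have "card ((of_nat :: nat \<Rightarrow> complex) ` {..d}) = Suc d"
        by (subst card_image) (auto simp: inj_on_def)
      ultimately show False by simp
    qed
  qed (auto simp: sum.distrib sum_distrib_left algebra_simps)
  then show ?thesis by auto
qed

text \<open>The weights \<open>w\<close> above depend only on the degree, so derivatives of a function that is polynomial along
  coordinate lines are bounded in terms of its values alone; no bound on coefficients enters.\<close>

definition linepoly :: "nat \<Rightarrow> (real^'n::finite \<Rightarrow> complex) \<Rightarrow> bool" where
  "linepoly d p \<longleftrightarrow> (\<forall>x i. \<exists>c. \<forall>t. p (x + t *\<^sub>R axis i 1) = (\<Sum>k\<le>d. c k * complex_of_real t ^ k))"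

text \<open>A derivative at x along a coordinate line is the linear coefficient of the restriction,
  and this is recovered from the values at x, x + e_i, ..., x + d e_i. As \<open>w\<close> is
  quantified before \<open>p\<close>, one choice serves a whole family.\<close>

lemma linepoly_has_pd:
  assumes "1 \<le> d"
  shows "\<exists>w::nat \<Rightarrow> complex. \<forall>p::real^'n::finite \<Rightarrow> complex. \<forall>i. linepoly d p \<longrightarrow>
     has_pd p i (\<lambda>x. \<Sum>j\<le>d. w j * p (x + real j *\<^sub>R axis i 1))"
proof -
  obtain w :: "nat \<Rightarrow> complex" where w: "\<And>c. c 1 = (\<Sum>j\<in>{..d}. w j * (\<Sum>k\<le>d. c k * of_nat j ^ k))"
    using polynomial_derivative_from_values[OF assms] by auto
  have "((\<lambda>t. p (x + t *\<^sub>R axis i 1)) has_vector_derivative (\<Sum>j\<le>d. w j * p (x + real j *\<^sub>R axis i 1))) (at 0)"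
    if lp: "linepoly d p" for p :: "real^'n \<Rightarrow> complex" and i x
  proof -
    obtain c where c: "\<And>t. p (x + t *\<^sub>R axis i 1) = (\<Sum>k\<le>d. c k * complex_of_real t ^ k)"
      using lp by (auto simp: linepoly_def) metis
    have "((\<lambda>t. \<Sum>k\<le>d. c k * complex_of_real t ^ k) has_vector_derivative (\<Sum>k\<le>d. c k * of_real (if k = 1 then 1 else 0))) (at 0)"
    proof (intro has_vector_derivative_sum has_vector_derivative_mult_right)
      fix k
      have "((\<lambda>t::real. t ^ k) has_real_derivative (if k = 1 then 1 else 0)) (at 0)"
        by (cases k) (auto intro!: derivative_eq_intros simp: power_0_left)
      then show "((\<lambda>t. complex_of_real t ^ k) has_vector_derivative of_real (if k = 1 then 1 else 0)) (at 0)"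
        unfolding of_real_power[symmetric] by (intro has_vector_derivative_of_real) (simp add: has_real_derivative_iff_has_vector_derivative)
    qed
    moreover have "(\<Sum>k\<le>d. c k * of_real (if k = 1 then 1 else 0)) = c 1"
      using assms by (simp add: if_distrib[of of_real] if_distrib[of "\<lambda>x. _ * x"] cong: if_cong)
    ultimately show ?thesis unfolding c w[of c] by simp
  qed
  then show ?thesis by (auto simp: has_pd_def)
qed

text \<open>The translates of \<open>P\<close> are the generators: a partial derivative of a
  translate is a combination of further translates. Since translation leads out of \<open>K\<close>,
  the values of \<open>P\<close> are assumed bounded on balls of every radius.\<close>

lemma usmooth_linepoly:
  fixes P :: "'a \<Rightarrow> real^'n::finite \<Rightarrow> complex"
  assumes d: "1 \<le> d" and P: "\<And>a. a \<in> I \<Longrightarrow> linepoly d (P a)" "\<And>a. a \<in> I \<Longrightarrow> continuous_on UNIV (P a)"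
    and bd: "\<And>R. \<exists>M. \<forall>a\<in>I. \<forall>x. norm x \<le> R \<longrightarrow> norm (P a x) \<le> M" and K: "bounded K"
  shows "usmooth I K P"
proof (rule usmooth_extend[of "{\<lambda>a x. P a (x + z) | z. True}"])
  obtain R where R: "\<And>x. x \<in> K \<Longrightarrow> norm x \<le> R" using K by (auto simp: bounded_iff)
  fix F assume "F \<in> {\<lambda>a x. P a (x + z) | z. True}"
  then obtain z where F: "F = (\<lambda>a x. P a (x + z))" by auto
  obtain M where M: "\<forall>a\<in>I. \<forall>x. norm x \<le> R + norm z \<longrightarrow> norm (P a x) \<le> M" using bd by blast
  have "norm (P a (x + z)) \<le> M" if "a \<in> I" "x \<in> K" for a x
    using M that norm_triangle_ineq[of x z] R[OF that(2)] by auto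
  moreover have "continuous_on UNIV (\<lambda>x. P a (x + z))" if "a \<in> I" for a
    by (rule continuous_on_compose2[OF P(2)[OF that]]) (auto intro!: continuous_intros)
  ultimately show "ubounded I K F" by (auto simp: ubounded_def F)
next
  fix F i assume "F \<in> {\<lambda>a x. P a (x + z) | z. True}"
  then obtain z where F: "F = (\<lambda>a x. P a (x + z))" by auto
  obtain w :: "nat \<Rightarrow> complex" where w: "\<forall>p::real^'n \<Rightarrow> complex. \<forall>i. linepoly d p \<longrightarrow>
      has_pd p i (\<lambda>x. \<Sum>j\<le>d. w j * p (x + real j *\<^sub>R axis i 1))"
    using linepoly_has_pd[OF d] by (rule exE)
  have "linepoly d (F a)" if aI: "a \<in> I" for a
    unfolding linepoly_def
  proof (intro allI)
    fix x i
    obtain c where "\<forall>t. P a ((x + z) + t *\<^sub>R axis i 1) = (\<Sum>k\<le>d. c k * complex_of_real t ^ k)"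
      using P(1)[OF aI] unfolding linepoly_def by blast
    then show "\<exists>c. \<forall>t. F a (x + t *\<^sub>R axis i 1) = (\<Sum>k\<le>d. c k * complex_of_real t ^ k)"
      by (auto simp: F algebra_simps)
  qed
  then have *: "\<forall>a\<in>I. has_pd (F a) i (\<lambda>x. \<Sum>j\<le>d. w j * F a (x + real j *\<^sub>R axis i 1))" using w by auto
  show "\<exists>H\<in>gen ({\<lambda>a x. P a (x + z) | z. True} \<union> Collect (usmooth I K)). \<forall>a\<in>I. has_pd (F a) i (H a)"
  proof (rule bexI[of _ "\<lambda>a x. \<Sum>j\<le>d. w j * F a (x + real j *\<^sub>R axis i 1)"])
    show "(\<lambda>a x. \<Sum>j\<le>d. w j * F a (x + real j *\<^sub>R axis i 1)) \<in> gen ({\<lambda>a x. P a (x + z) | z. True} \<union> Collect (usmooth I K))"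
      by (intro gen_sum gen.mult gen.const gen.base UnI1) (auto simp: F add.assoc)
  qed (use * in auto)
next
  show "P \<in> gen ({\<lambda>a x. P a (x + z) | z. True} \<union> Collect (usmooth I K))"
    by (intro gen.base UnI1 CollectI exI[of _ 0]) auto
qed

text \<open>The classical flat function is the case k = 0. The denominator t^k makes the family, up
  to linear combinations, closed under differentiation, as the generator method requires.\<close>

definition flatexp :: "nat \<Rightarrow> real \<Rightarrow> real" where
  "flatexp k t = (if t > 0 then exp (- 1 / t) / t ^ k else 0)"

lemma flatexp_nonneg: "0 \<le> flatexp k t" by (simp add: flatexp_def)

lemma flatexp_le: "flatexp k t \<le> fact (Suc k) * \<bar>t\<bar>"
proof (cases "t > 0")
  case True
  \<comment> \<open>Keeping the single term of degree k + 1 in the series of exp (1/t) yields exp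
    (-1/t) \<le> (k+1)! t^(k+1).\<close>
  have "(\<Sum>n\<in>{Suc k}. (1/t) ^ n /\<^sub>R fact n) \<le> exp (1/t)"
    unfolding sums_unique[OF exp_converges[of "1/t"]]
    by (rule sum_le_suminf[OF sums_summable[OF exp_converges]]) (use True in auto)
  then have "(1/t) ^ Suc k / fact (Suc k) \<le> exp (1/t)"
    by (simp add: divide_inverse mult.commute del: fact_Suc power_Suc)
  then have "exp (- 1 / t) \<le> fact (Suc k) * t ^ Suc k"
    using True by (simp add: exp_minus field_simps power_divide del: fact_Suc)
  then show ?thesis using True by (simp add: flatexp_def field_simps del: fact_Suc)
next
  case False
  then have "flatexp k t = 0" by (simp add: flatexp_def)
  moreover have "0 \<le> fact (Suc k) * \<bar>t\<bar>" by (intro mult_nonneg_nonneg) (auto simp del: fact_Suc)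
  ultimately show ?thesis by linarith
qed

lemma flatexp_DERIV: "(flatexp k has_real_derivative (flatexp (k + 2) t - real k * flatexp (k + 1) t)) (at t)"
proof -
  consider "t > 0" | "t < 0" | "t = 0" by linarith
  then show ?thesis
  proof cases
    case 1
    have "((\<lambda>t. exp (- 1 / t) / t ^ k) has_real_derivative (flatexp (k + 2) t - real k * flatexp (k + 1) t)) (at t)"
    proof -
      have "k * t ^ (k - 1) * t = k * t ^ k" by (cases k) auto
      then show ?thesis using 1
        by (auto intro!: derivative_eq_intros simp: flatexp_def field_simps power2_eq_square)
    qed
    moreover have "eventually (\<lambda>t. flatexp k t = exp (- 1 / t) / t ^ k) (nhds t)"
      using 1 eventually_nhds_in_open[of "{0<..}" t] by (auto simp: flatexp_def elim!: eventually_mono)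
    ultimately show ?thesis by (simp add: DERIV_cong_ev)
  next
    case 2
    have "eventually (\<lambda>t. flatexp k t = 0) (nhds t)"
      using 2 eventually_nhds_in_open[of "{..<0}" t] by (auto simp: flatexp_def elim!: eventually_mono)
    with 2 show ?thesis by (simp add: DERIV_cong_ev flatexp_def)
  next
    case 3
    \<comment> \<open>The difference quotient at 0 is \<open>flatexp (k + 1) h\<close>, and the
      linear bound sends it to 0.\<close>
    have "((\<lambda>h. flatexp k h / h) \<longlongrightarrow> 0) (at 0)"
    proof (rule Lim_null_comparison)
      show "eventually (\<lambda>h. norm (flatexp k h / h) \<le> fact (Suc (Suc k)) * \<bar>h\<bar>) (at 0)"
      proof (intro always_eventually allI)
        fix h show "norm (flatexp k h / h) \<le> fact (Suc (Suc k)) * \<bar>h\<bar>"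
          using flatexp_le[of "Suc k" h] by (auto simp: flatexp_def mult.commute simp del: fact_Suc)
      qed
      show "((\<lambda>h. fact (Suc (Suc k)) * \<bar>h\<bar>) \<longlongrightarrow> (0::real)) (at 0)"
        by (auto intro!: tendsto_eq_intros)
    qed
    then show ?thesis using 3 by (simp add: DERIV_def flatexp_def)
  qed
qed

text \<open>The inner function c + d |x|^2 has the partial derivative \<open>2 * d * x$i\<close>, so
  the functions of orders k + 1 and k + 2 with coordinate factors close the system of
  generators.\<close>

lemma smooth_fn_flatexp:
  "smooth_fn (\<lambda>x::real^'n::finite. complex_of_real (flatexp k (c + d * (norm x)\<^sup>2)))"
  unfolding smooth_fn_usmooth
proof (rule usmooth_extend[of "{\<lambda>_ x. complex_of_real (flatexp k (c + d * (norm x)\<^sup>2)) | k. True}"])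
  let ?T = "{\<lambda>(_::unit) (x::real^'n). complex_of_real (flatexp k (c + d * (norm x)\<^sup>2)) | k. True}"
  have fc: "continuous_on UNIV (flatexp k)" for k
    by (rule DERIV_continuous_on, rule has_field_derivative_at_within, rule flatexp_DERIV)
  fix F assume "F \<in> ?T"
  then show "ubounded {()} {} F"
    by (auto simp: ubounded_def intro!: continuous_intros continuous_on_compose2[OF fc])
next
  let ?T = "{\<lambda>(_::unit) (x::real^'n). complex_of_real (flatexp k (c + d * (norm x)\<^sup>2)) | k. True}"
  fix F i assume "F \<in> ?T"
  then obtain k where F: "F = (\<lambda>(_::unit) (x::real^'n). complex_of_real (flatexp k (c + d * (norm x)\<^sup>2)))" by auto
  define H where "H = (\<lambda>(_::unit) (x::real^'n). (complex_of_real (flatexp (k+2) (c + d * (norm x)\<^sup>2))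
      + of_real (- real k) * complex_of_real (flatexp (k+1) (c + d * (norm x)\<^sup>2))) * (of_real (2 * d) * of_real (x$i)))"
  have "H \<in> gen (?T \<union> Collect (usmooth {()} {}))"
    unfolding H_def using smooth_fn_coord
    by (intro gen.mult gen.add gen.const gen.base) (auto simp: smooth_fn_usmooth)
  moreover have "has_pd (F a) i (H a)" for a
    unfolding has_pd_def
  proof
    fix x :: "real^'n"
    have n: "(norm (x + t *\<^sub>R axis i 1))\<^sup>2 = (norm x)\<^sup>2 + 2 * t * x$i + t\<^sup>2" for t
      unfolding power2_norm_eq_inner using norm_axis_1[of i] by (simp add: inner_add_left inner_add_right inner_axis inner_axis' power2_eq_square norm_eq_1 distrib_left)
    have "((\<lambda>t. c + d * ((norm x)\<^sup>2 + 2 * t * x$i + t\<^sup>2)) has_real_derivative 2 * d * x$i) (at 0)"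
      by (auto intro!: derivative_eq_intros)
    from DERIV_chain2[OF flatexp_DERIV this, of k]
    have "((\<lambda>t. flatexp k (c + d * ((norm x)\<^sup>2 + 2 * t * x$i + t\<^sup>2))) has_real_derivative
        (flatexp (k+2) (c + d * (norm x)\<^sup>2) - real k * flatexp (k+1) (c + d * (norm x)\<^sup>2)) * (2 * d * x$i)) (at 0)"
      by simp
    then have "((\<lambda>t. complex_of_real (flatexp k (c + d * ((norm x)\<^sup>2 + 2 * t * x$i + t\<^sup>2)))) has_vector_derivative
        of_real ((flatexp (k+2) (c + d * (norm x)\<^sup>2) - real k * flatexp (k+1) (c + d * (norm x)\<^sup>2)) * (2 * d * x$i))) (at 0)"
      by (intro has_vector_derivative_of_real) (simp add: has_real_derivative_iff_has_vector_derivative)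
    then show "((\<lambda>t. F a (x + t *\<^sub>R axis i 1)) has_vector_derivative H a x) (at 0)"
      by (simp add: F H_def n)
  qed
  ultimately show "\<exists>H\<in>gen (?T \<union> Collect (usmooth {()} {})). \<forall>a\<in>{()}. has_pd (F a) i (H a)" by auto
qed (auto intro!: gen.base)

lemma has_pd_dil:
  assumes "has_pd f i g"
  shows "has_pd (\<lambda>x. f (dil \<kappa> s x)) i (\<lambda>x. of_real (s ^ \<kappa> i) * g (dil \<kappa> s x))"
  unfolding has_pd_def
proof
  fix x
  have e: "dil \<kappa> s (x + t *\<^sub>R axis i 1) = dil \<kappa> s x + (s ^ \<kappa> i * t) *\<^sub>R axis i 1" for t
    by (auto simp: vec_eq_iff axis_def algebra_simps)
  have "((\<lambda>t. s ^ \<kappa> i * t) has_vector_derivative s ^ \<kappa> i) (at 0)"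
    by (auto intro!: derivative_eq_intros)
  moreover have "((\<lambda>t. f (dil \<kappa> s x + t *\<^sub>R axis i 1)) has_vector_derivative g (dil \<kappa> s x)) (at (s ^ \<kappa> i * 0))"
    using assms by (simp add: has_pd_def)
  ultimately have "(((\<lambda>t. f (dil \<kappa> s x + t *\<^sub>R axis i 1)) \<circ> (\<lambda>t. s ^ \<kappa> i * t)) has_vector_derivative s ^ \<kappa> i *\<^sub>R g (dil \<kappa> s x)) (at 0)"
    by (rule vector_diff_chain_at)
  then show "((\<lambda>t. f (dil \<kappa> s (x + t *\<^sub>R axis i 1))) has_vector_derivative of_real (s ^ \<kappa> i) * g (dil \<kappa> s x)) (at 0)"
    by (simp add: e comp_def scaleR_conv_of_real[where 'a=complex])
qed

lemma smooth_fn_dil: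
  assumes "smooth_fn f"
  shows "smooth_fn (\<lambda>x. f (dil \<kappa> s x))"
  unfolding smooth_fn_usmooth
proof (rule usmooth_extend[of "{\<lambda>_ x. Dlist ds f (dil \<kappa> s x) | ds. True}"])
  let ?T = "{\<lambda>(_::unit) x. Dlist ds f (dil \<kappa> s x) | ds. True}"
  fix F assume "F \<in> ?T"
  then show "ubounded {()} {} F" using smooth_fn_continuous[OF assms]
    by (auto simp: ubounded_def intro!: continuous_on_compose2[of UNIV _ UNIV "dil \<kappa> s"] continuous_intros)
next
  let ?T = "{\<lambda>(_::unit) x. Dlist ds f (dil \<kappa> s x) | ds. True}"
  fix F i assume "F \<in> ?T"
  then obtain ds where F: "F = (\<lambda>(_::unit) x. Dlist ds f (dil \<kappa> s x))" by auto
  show "\<exists>H\<in>gen (?T \<union> Collect (usmooth {()} {})). \<forall>a\<in>{()}. has_pd (F a) i (H a)"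
  proof (rule bexI[of _ "\<lambda>_ x. of_real (s ^ \<kappa> i) * Dlist (i # ds) f (dil \<kappa> s x)"])
    show "\<forall>a\<in>{()}. has_pd (F a) i (\<lambda>x. of_real (s ^ \<kappa> i) * Dlist (i # ds) f (dil \<kappa> s x))"
      unfolding F using has_pd_dil[OF smooth_fn_has_pd[OF assms]] by blast
    show "(\<lambda>_ x. of_real (s ^ \<kappa> i) * Dlist (i # ds) f (dil \<kappa> s x)) \<in> gen (?T \<union> Collect (usmooth {()} {}))"
      by (rule gen.mult[OF gen.const gen.base]) blast
  qed
next
  show "(\<lambda>_ x. f (dil \<kappa> s x)) \<in> gen ({\<lambda>(_::unit) x. Dlist ds f (dil \<kappa> s x) | ds. True} \<union> Collect (usmooth {()} {}))"
    by (intro gen.base UnI1 CollectI exI[of _ "[]"]) auto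
qed

section \<open>Rapidly decreasing functions and convolution\<close>

text \<open>Schwartz decay of the function without its derivatives: sufficient for integrability and
  for the factor of a convolution that is not differentiated.\<close>

definition rapid :: "(real^'n::finite \<Rightarrow> complex) \<Rightarrow> bool" where
  "rapid \<phi> \<longleftrightarrow> continuous_on UNIV \<phi> \<and> (\<forall>k. \<exists>M. \<forall>x. (1 + norm x) ^ k * norm (\<phi> x) \<le> M)"

lemma rapidD: "rapid \<phi> \<Longrightarrow> \<exists>M. \<forall>x. (1 + norm x) ^ k * norm (\<phi> x) \<le> M"
  by (simp add: rapid_def)

lemma rapid_measurable: "rapid \<phi> \<Longrightarrow> \<phi> \<in> borel_measurable borel"
  by (auto simp: rapid_def intro: borel_measurable_continuous_onI)

lemma rapid_bounded: "rapid \<phi> \<Longrightarrow> \<exists>M. \<forall>x. norm (\<phi> x) \<le> M"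
  using rapidD[of \<phi> 0] by simp

lemma schwartz_smooth: "\<phi> \<in> schwartz \<Longrightarrow> smooth_fn \<phi>"
  by (simp add: schwartz_def)

lemma schwartz_rapid: "\<phi> \<in> schwartz \<Longrightarrow> rapid (Dlist ds \<phi>)"
  by (auto simp: schwartz_def rapid_def smooth_fn_def)

lemma schwartz_rapid0: "\<phi> \<in> schwartz \<Longrightarrow> rapid \<phi>"
  using schwartz_rapid[of \<phi> "[]"] by simp

lemma schwartzI: "smooth_fn \<phi> \<Longrightarrow> (\<And>ds. rapid (Dlist ds \<phi>)) \<Longrightarrow> \<phi> \<in> schwartz"
  by (auto simp: schwartz_def rapid_def)

lemma schwartz_Dlist: "\<phi> \<in> schwartz \<Longrightarrow> Dlist ds \<phi> \<in> schwartz"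
  using schwartz_rapid[of \<phi>] smooth_fn_Dlist[of \<phi>] schwartz_smooth[of \<phi>]
  by (intro schwartzI) (auto simp flip: Dlist_append)

lemma schwartz_Dm: "\<phi> \<in> schwartz \<Longrightarrow> Dm \<alpha> \<phi> \<in> schwartz"
  by (simp add: Dm_def schwartz_Dlist)

lemma one_plus_norm_power_pos [simp]: "0 < (1 + norm (x::'a::real_normed_vector)) ^ k"
  by (simp add: add_pos_nonneg)

lemma rapid_mult_growth:
  fixes \<phi> :: "real^'n::finite \<Rightarrow> complex"
  assumes "rapid \<phi>" and g: "g \<in> borel_measurable borel" "\<And>x. norm (g x) \<le> C * (1 + norm x) ^ N"
  shows "integrable lborel (\<lambda>x. g x * \<phi> x)"
proof -
  obtain M where M: "\<And>x. (1 + norm x) ^ (2 * CARD('n) + N) * norm (\<phi> x) \<le> M" using rapidD[OF assms(1)] by auto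
  have C: "0 \<le> C" using order_trans[OF norm_ge_zero g(2)[of 0]] by simp
  show ?thesis
  proof (rule weight_dominated(1))
    show "(\<lambda>x. g x * \<phi> x) \<in> borel_measurable borel" using g rapid_measurable[OF assms(1)] by measurable
    fix x
    have "(1 + norm x) ^ (2 * CARD('n)) * norm (g x * \<phi> x) \<le> (1 + norm x) ^ (2 * CARD('n)) * ((C * (1 + norm x) ^ N) * norm (\<phi> x))"
      unfolding norm_mult by (intro mult_left_mono mult_right_mono g) auto
    also have "\<dots> = C * ((1 + norm x) ^ (2 * CARD('n) + N) * norm (\<phi> x))" by (simp add: power_add)
    also have "\<dots> \<le> C * M" by (intro mult_left_mono M C)
    finally show "(1 + norm x) ^ (2 * CARD('n)) * norm (g x * \<phi> x) \<le> C * M" .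
  qed
qed

lemma rapid_integrable: "rapid \<phi> \<Longrightarrow> integrable lborel \<phi>"
  using rapid_mult_growth[of \<phi> "\<lambda>_. 1" 1 0] by simp

section \<open>Convolution with rapidly decreasing functions\<close>

definition conv :: "(real^'n::finite \<Rightarrow> complex) \<Rightarrow> (real^'n \<Rightarrow> complex) \<Rightarrow> real^'n \<Rightarrow> complex" where
  "conv \<phi> \<psi> x = (\<integral>y. \<phi> (x - y) * \<psi> y \<partial>lborel)"

lemma conv_measurable:
  assumes "rapid \<phi>" "rapid \<psi>"
  shows "(\<lambda>y. \<phi> (x - y) * \<psi> y) \<in> borel_measurable borel"
  using rapid_measurable[OF assms(1)] rapid_measurable[OF assms(2)] by measurable

lemma conv_integrable:
  assumes "rapid \<phi>" "rapid \<psi>"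
  shows "integrable lborel (\<lambda>y. \<phi> (x - y) * \<psi> y)"
proof -
  obtain M where "\<And>x. norm (\<phi> x) \<le> M" using rapid_bounded[OF assms(1)] by auto
  then show ?thesis using rapid_measurable[OF assms(1)]
    by (intro rapid_mult_growth[OF assms(2), where C=M and N=0]) auto
qed

lemma conv_commute:
  assumes "rapid \<phi>" "rapid \<psi>"
  shows "conv \<phi> \<psi> = conv \<psi> \<phi>"
proof
  fix x
  show "conv \<phi> \<psi> x = conv \<psi> \<phi> x"
    unfolding conv_def using lborel_reflect[OF conv_measurable[OF assms, of x], of x]
    by (simp add: mult.commute)
qed

text \<open>Peetre's inequality splits the weight at x between x - y and y; the second factor has 2
  n further powers to make the integral converge.\<close>

lemma conv_bound:
  fixes \<phi> :: "real^'n::finite \<Rightarrow> complex"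
  assumes "rapid \<phi>" "rapid \<psi>"
    and M: "\<And>x. (1 + norm x) ^ k * norm (\<phi> x) \<le> M" and N: "\<And>x. (1 + norm x) ^ (2 * CARD('n) + k) * norm (\<psi> x) \<le> N"
  shows "(1 + norm x) ^ k * norm (conv \<phi> \<psi> x) \<le> M * N * wint TYPE('n)"
proof -
  have M0: "0 \<le> M" using order_trans[OF _ M[of 0]] by simp
  have "(1 + norm x) ^ k * norm (conv \<phi> \<psi> x) = norm (\<integral>y. of_real ((1 + norm x) ^ k) * (\<phi> (x - y) * \<psi> y) \<partial>lborel)"
    unfolding conv_def integral_mult_right_zero norm_mult[of "of_real _"] norm_of_real by simp
  also have "\<dots> \<le> (M * N) * wint TYPE('n)"
  proof (rule weight_dominated(2))
    show "(\<lambda>y. of_real ((1 + norm x) ^ k) * (\<phi> (x - y) * \<psi> y)) \<in> borel_measurable borel"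
      using conv_measurable[OF assms(1,2)] by measurable
    fix y
    have "(1 + norm x) ^ k \<le> (1 + norm (x - y)) ^ k * (1 + norm y) ^ k"
      using peetre_power[of "x - y" y k] by simp
    then have "(1 + norm y) ^ (2 * CARD('n)) * norm (of_real ((1 + norm x) ^ k) * (\<phi> (x - y) * \<psi> y))
       \<le> (1 + norm y) ^ (2 * CARD('n)) * (((1 + norm (x - y)) ^ k * (1 + norm y) ^ k) * (norm (\<phi> (x - y)) * norm (\<psi> y)))"
      unfolding norm_mult norm_of_real by (intro mult_left_mono mult_right_mono) auto
    also have "\<dots> = ((1 + norm (x - y)) ^ k * norm (\<phi> (x - y))) * ((1 + norm y) ^ (2 * CARD('n) + k) * norm (\<psi> y))"
      by (simp add: power_add algebra_simps)
    also have "\<dots> \<le> M * N"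
      by (intro mult_mono M N M0 mult_nonneg_nonneg) auto
    finally show "(1 + norm y) ^ (2 * CARD('n)) * norm (of_real ((1 + norm x) ^ k) * (\<phi> (x - y) * \<psi> y)) \<le> M * N" .
  qed
  finally show ?thesis .
qed

lemma conv_continuous:
  assumes "rapid \<phi>" "rapid \<psi>"
  shows "continuous_on UNIV (conv \<phi> \<psi>)"
proof -
  obtain M where M: "\<And>x. norm (\<phi> x) \<le> M" using rapid_bounded[OF assms(1)] by auto
  have "continuous_on UNIV (\<lambda>x. \<integral>y. \<phi> (x - y) * \<psi> y \<partial>lborel)"
  proof (rule continuous_on_integral_dominated[where w="\<lambda>y. M * norm (\<psi> y)"])
    show "integrable lborel (\<lambda>y. M * norm (\<psi> y))"
      using rapid_integrable[OF assms(2)] by simp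
    show "norm (\<phi> (x - y) * \<psi> y) \<le> M * norm (\<psi> y)" for x y
      using M by (simp add: norm_mult mult_right_mono)
    show "continuous_on UNIV (\<lambda>x. \<phi> (x - y) * \<psi> y)" for y
      using assms(1) by (auto simp: rapid_def intro!: continuous_intros continuous_on_compose2[of UNIV \<phi>])
  qed (use conv_measurable[OF assms] in simp)
  then show ?thesis by (simp add: conv_def[abs_def])
qed

lemma conv_rapid:
  fixes \<phi> :: "real^'n::finite \<Rightarrow> complex"
  assumes "rapid \<phi>" "rapid \<psi>"
  shows "rapid (conv \<phi> \<psi>)"
  unfolding rapid_def
proof (intro conjI allI conv_continuous assms)
  fix k
  obtain M where M: "\<And>x. (1 + norm x) ^ k * norm (\<phi> x) \<le> M" using rapidD[OF assms(1)] by auto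
  obtain N where N: "\<And>x. (1 + norm x) ^ (2 * CARD('n) + k) * norm (\<psi> x) \<le> N" using rapidD[OF assms(2)] by auto
  show "\<exists>M. \<forall>x. (1 + norm x) ^ k * norm (conv \<phi> \<psi> x) \<le> M"
    using conv_bound[OF assms M N] by auto
qed

lemma conv_has_pd:
  assumes "rapid \<phi>" "rapid \<psi>" "rapid \<phi>'" "has_pd \<phi> i \<phi>'"
  shows "has_pd (conv \<phi> \<psi>) i (conv \<phi>' \<psi>)"
  unfolding has_pd_def
proof
  fix x
  obtain M where M: "\<And>x. norm (\<phi>' x) \<le> M" using rapid_bounded[OF assms(3)] by auto
  have "((\<lambda>t. \<integral>y. \<phi> ((x - y) + t *\<^sub>R axis i 1) * \<psi> y \<partial>lborel) has_vector_derivative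
      (\<integral>y. \<phi>' ((x - y) + 0 *\<^sub>R axis i 1) * \<psi> y \<partial>lborel)) (at 0)"
  proof (rule has_vector_derivative_integral(1)[where w="\<lambda>y. M * norm (\<psi> y)"])
    show "integrable lborel (\<lambda>y. \<phi> ((x - y) + t *\<^sub>R axis i 1) * \<psi> y)" for t
      using conv_integrable[OF assms(1,2), of "x + t *\<^sub>R axis i 1"] by (simp add: algebra_simps)
    show "((\<lambda>t. \<phi> ((x - y) + t *\<^sub>R axis i 1) * \<psi> y) has_vector_derivative \<phi>' ((x - y) + t *\<^sub>R axis i 1) * \<psi> y) (at t)" for t y
      by (intro has_vector_derivative_mult_left has_pd_at[OF assms(4)])
    show "norm (\<phi>' ((x - y) + t *\<^sub>R axis i 1) * \<psi> y) \<le> M * norm (\<psi> y)" for t y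
      using M by (simp add: norm_mult mult_right_mono)
    show "integrable lborel (\<lambda>y. M * norm (\<psi> y))"
      using rapid_integrable[OF assms(2)] by simp
  qed
  then show "((\<lambda>t. conv \<phi> \<psi> (x + t *\<^sub>R axis i 1)) has_vector_derivative conv \<phi>' \<psi> x) (at 0)"
    by (simp add: conv_def algebra_simps)
qed

lemma Dlist_conv:
  assumes "\<phi> \<in> schwartz" "rapid \<psi>"
  shows "Dlist ds (conv \<phi> \<psi>) = conv (Dlist ds \<phi>) \<psi>"
proof (induction ds)
  case (Cons i ds)
  have "has_pd (conv (Dlist ds \<phi>) \<psi>) i (conv (Dlist (i # ds) \<phi>) \<psi>)"
    using assms by (intro conv_has_pd schwartz_rapid smooth_fn_has_pd schwartz_smooth)
  then show ?case using Cons by (simp add: partial_eq)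
qed simp

lemma conv_schwartz:
  assumes "\<phi> \<in> schwartz" "rapid \<psi>"
  shows "conv \<phi> \<psi> \<in> schwartz"
proof (rule schwartzI)
  show "rapid (Dlist ds (conv \<phi> \<psi>))" for ds
    unfolding Dlist_conv[OF assms] using assms by (intro conv_rapid schwartz_rapid)
  then show "smooth_fn (conv \<phi> \<psi>)"
  proof (intro smooth_fnI)
    fix ds i
    show "\<exists>g. has_pd (Dlist ds (conv \<phi> \<psi>)) i g"
      unfolding Dlist_conv[OF assms] using assms
      by (intro exI[of _ "conv (Dlist (i # ds) \<phi>) \<psi>"] conv_has_pd schwartz_rapid smooth_fn_has_pd schwartz_smooth)
  qed (auto simp: rapid_def)
qed

lemma Dlist_conv_right:
  assumes "\<phi> \<in> schwartz" "\<psi> \<in> schwartz"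
  shows "Dlist ds (conv \<phi> \<psi>) = conv \<phi> (Dlist ds \<psi>)"
  using Dlist_conv[OF assms(2) schwartz_rapid0[OF assms(1)], of ds] assms
  by (simp add: conv_commute schwartz_rapid schwartz_rapid0)

text \<open>Convolving the test function with k is dual to correlating f with k, by Fubini. The
  growth of f (x + y) is distributed by Peetre's inequality and absorbed by the decay of \<phi> and
  k.\<close>

lemma integral_conv_correlation:
  fixes f :: "real^'n::finite \<Rightarrow> complex"
  assumes "rapid \<phi>" "rapid k" and f: "f \<in> borel_measurable borel" "\<And>x. norm (f x) \<le> C * (1 + norm x) ^ N"
  shows "(\<integral>x. f x * conv \<phi> k x \<partial>lborel) = (\<integral>x. \<phi> x * (\<integral>y. f (x + y) * k y \<partial>lborel) \<partial>lborel)"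
proof -
  note [measurable] = f(1) rapid_measurable[OF assms(1)] rapid_measurable[OF assms(2)]
  have C: "0 \<le> C" using order_trans[OF norm_ge_zero f(2)[of 0]] by simp
  define g where "g x y = f (x + y) * \<phi> x * k y" for x y
  have gm [measurable]: "(\<lambda>(x, y). g x y) \<in> borel_measurable (lborel \<Otimes>\<^sub>M lborel)"
    unfolding g_def by measurable
  have w: "integrable lborel (\<lambda>x. (1 + norm x) ^ N * norm (\<psi> x))" if "rapid \<psi>" for \<psi> :: "real^'n \<Rightarrow> complex"
  proof -
    have "integrable lborel (\<lambda>x. complex_of_real ((1 + norm x) ^ N) * \<psi> x)"
      by (rule rapid_mult_growth[OF that, where C=1 and N=N]) (auto simp del: of_real_power of_real_add)
    from integrable_norm[OF this] show ?thesis by (simp add: norm_mult del: of_real_power of_real_add)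
  qed
  have "integrable (lborel \<Otimes>\<^sub>M lborel) (\<lambda>(x, y). C * (((1 + norm x) ^ N * norm (\<phi> x)) * ((1 + norm y) ^ N * norm (k y))))"
  proof -
    have "integrable (lborel \<Otimes>\<^sub>M lborel) (\<lambda>(x, y). ((1 + norm x) ^ N * norm (\<phi> x)) * ((1 + norm y) ^ N * norm (k y)))"
    proof (rule lborel_pair.Fubini_integrable)
      show "(\<lambda>(x, y). ((1 + norm x) ^ N * norm (\<phi> x)) * ((1 + norm y) ^ N * norm (k y))) \<in> borel_measurable (lborel \<Otimes>\<^sub>M lborel)"
        by measurable
      show "integrable lborel (\<lambda>x. \<integral>y. norm (case (x, y) of (x, y) \<Rightarrow> ((1 + norm x) ^ N * norm (\<phi> x)) * ((1 + norm y) ^ N * norm (k y))) \<partial>lborel)"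
        using w[OF assms(1)] by (simp add: abs_mult)
      show "AE x in lborel. integrable lborel (\<lambda>y. case (x, y) of (x, y) \<Rightarrow> ((1 + norm x) ^ N * norm (\<phi> x)) * ((1 + norm y) ^ N * norm (k y)))"
        using w[OF assms(2)] by simp
    qed
    from integrable_mult_right[OF this, of C] show ?thesis by (simp only: case_prod_unfold)
  qed
  then have gi: "integrable (lborel \<Otimes>\<^sub>M lborel) (\<lambda>(x, y). g x y)"
  proof (rule Bochner_Integration.integrable_bound)
    show "AE p in lborel \<Otimes>\<^sub>M lborel. norm (case p of (x, y) \<Rightarrow> g x y) \<le> norm (case p of (x, y) \<Rightarrow> C * (((1 + norm x) ^ N * norm (\<phi> x)) * ((1 + norm y) ^ N * norm (k y))))"
    proof (rule AE_I2)
      fix p :: "(real^'n) \<times> (real^'n)"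
      obtain x y where p: "p = (x, y)" by force
      have "norm (f (x + y)) \<le> C * ((1 + norm x) ^ N * (1 + norm y) ^ N)"
        by (rule order_trans[OF f(2)]) (intro mult_left_mono peetre_power C)
      then have "norm (g x y) \<le> C * ((1 + norm x) ^ N * (1 + norm y) ^ N) * (norm (\<phi> x) * norm (k y))"
        unfolding g_def norm_mult mult.assoc[of "norm (f _)"] by (intro mult_right_mono) auto
      also have "\<dots> = C * (((1 + norm x) ^ N * norm (\<phi> x)) * ((1 + norm y) ^ N * norm (k y)))"
        by (simp add: algebra_simps)
      finally show "norm (case p of (x, y) \<Rightarrow> g x y) \<le> norm (case p of (x, y) \<Rightarrow> C * (((1 + norm x) ^ N * norm (\<phi> x)) * ((1 + norm y) ^ N * norm (k y))))"
        unfolding p by (simp only: prod.case real_norm_def abs_ge_self[THEN order_trans[rotated]])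
    qed
  qed measurable
  have "(\<integral>x. \<phi> x * (\<integral>y. f (x + y) * k y \<partial>lborel) \<partial>lborel) = (\<integral>x. (\<integral>y. g x y \<partial>lborel) \<partial>lborel)"
    unfolding g_def integral_mult_right_zero[symmetric] by (simp add: algebra_simps)
  also have "\<dots> = (\<integral>y. (\<integral>x. g x y \<partial>lborel) \<partial>lborel)"
    using lborel_pair.Fubini_integral[OF gi] by simp
  also have "\<dots> = (\<integral>y. (\<integral>x. g (- y + x) y \<partial>lborel) \<partial>lborel)"
    by (intro Bochner_Integration.integral_cong refl lborel_translate(1)[symmetric]) (simp add: g_def)
  also have "\<dots> = (\<integral>y. (\<integral>x. f x * (\<phi> (x - y) * k y) \<partial>lborel) \<partial>lborel)"
    by (simp add: g_def algebra_simps)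
  also have "\<dots> = (\<integral>x. (\<integral>y. f x * (\<phi> (x - y) * k y) \<partial>lborel) \<partial>lborel)"
  proof (rule lborel_pair.Fubini_integral)
    \<comment> \<open>For fixed y this integrand is g with x shifted by y. A shift does not change
      the inner integrals over x, so after swapping the variables integrability is inherited from
      g.\<close>
    show "integrable (lborel \<Otimes>\<^sub>M lborel) (\<lambda>(x, y). f x * (\<phi> (x - y) * k y))"
    proof (rule lborel_pair.integrable_product_swap_iff[THEN iffD1])
      show "integrable (lborel \<Otimes>\<^sub>M lborel) (\<lambda>(x, y). case (y, x) of (x, y) \<Rightarrow> f x * (\<phi> (x - y) * k y))"
      proof (rule lborel_pair.Fubini_integrable)
        show "(\<lambda>(x, y). case (y, x) of (x, y) \<Rightarrow> f x * (\<phi> (x - y) * k y)) \<in> borel_measurable (lborel \<Otimes>\<^sub>M lborel)"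
          by measurable
        have sw: "integrable (lborel \<Otimes>\<^sub>M lborel) (\<lambda>(y, x). g x y)"
          using lborel_pair.integrable_product_swap[OF gi] by simp
        have tr: "(\<integral>x. norm (f x * (\<phi> (x - y) * k y)) \<partial>lborel) = (\<integral>x. norm (g x y) \<partial>lborel)" for y
        proof -
          have "complex_of_real (\<integral>x. norm (f x * (\<phi> (x - y) * k y)) \<partial>lborel) = (\<integral>x. complex_of_real (norm (f x * (\<phi> (x - y) * k y))) \<partial>lborel)"
            by simp
          also have "\<dots> = (\<integral>x. complex_of_real (norm (f (y + x) * (\<phi> (y + x - y) * k y))) \<partial>lborel)"
            by (rule lborel_translate(1)[symmetric]) measurable
          also have "\<dots> = complex_of_real (\<integral>x. norm (g x y) \<partial>lborel)" by (simp add: g_def algebra_simps)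
          finally show ?thesis by (simp only: of_real_eq_iff)
        qed
        show "integrable lborel (\<lambda>y. \<integral>x. norm (case (y, x) of (x, y) \<Rightarrow> case (y, x) of (x, y) \<Rightarrow> f x * (\<phi> (x - y) * k y)) \<partial>lborel)"
          using lborel_pair.integrable_fst'[OF integrable_norm[OF sw]] by (simp add: tr split_beta)
        have "AE y in lborel. integrable lborel (\<lambda>x. g x y)"
          using lborel_pair.AE_integrable_fst'[OF sw] by simp
        then show "AE y in lborel. integrable lborel (\<lambda>x. case (y, x) of (x, y) \<Rightarrow> case (y, x) of (x, y) \<Rightarrow> f x * (\<phi> (x - y) * k y))"
        proof (rule AE_mp, intro AE_I2 impI)
          fix y assume "integrable lborel (\<lambda>x. g x y)"
          then show "integrable lborel (\<lambda>x. case (y, x) of (x, y) \<Rightarrow> case (y, x) of (x, y) \<Rightarrow> f x * (\<phi> (x - y) * k y))"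
            using lborel_translate(2)[of "\<lambda>x. f x * (\<phi> (x - y) * k y)" y] by (simp add: g_def algebra_simps)
        qed
      qed
    qed
  qed
  also have "\<dots> = (\<integral>x. f x * conv \<phi> k x \<partial>lborel)"
    by (simp add: conv_def)
  finally show ?thesis by simp
qed

text \<open>The one operation \<phi> + c \<psi> covers sums, differences and multiples, and it is
  the \<open>lc\<close> with which \<open>finite_functional_span\<close> is applied to test
  functions.\<close>

lemma schwartz_add: "\<phi> \<in> schwartz \<Longrightarrow> \<psi> \<in> schwartz \<Longrightarrow> (\<lambda>x. \<phi> x + c * \<psi> x) \<in> schwartz"
  and Dlist_add: "\<phi> \<in> schwartz \<Longrightarrow> \<psi> \<in> schwartz \<Longrightarrow> Dlist ds (\<lambda>x. \<phi> x + c * \<psi> x) = (\<lambda>x. Dlist ds \<phi> x + c * Dlist ds \<psi> x)"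
proof -
  assume *: "\<phi> \<in> schwartz" "\<psi> \<in> schwartz"
  have pd: "has_pd (\<lambda>x. Dlist ds \<phi> x + c * Dlist ds \<psi> x) i (\<lambda>x. Dlist (i # ds) \<phi> x + c * Dlist (i # ds) \<psi> x)" for ds i
    using smooth_fn_has_pd[OF schwartz_smooth[OF *(1)], of ds i] smooth_fn_has_pd[OF schwartz_smooth[OF *(2)], of ds i]
    unfolding has_pd_def by (auto intro!: has_vector_derivative_add has_vector_derivative_mult_right)
  have D: "Dlist ds (\<lambda>x. \<phi> x + c * \<psi> x) = (\<lambda>x. Dlist ds \<phi> x + c * Dlist ds \<psi> x)" for ds
  proof (induction ds)
    case (Cons i ds)
    then show ?case using partial_eq[OF pd] by simp
  qed simp
  then show "Dlist ds (\<lambda>x. \<phi> x + c * \<psi> x) = (\<lambda>x. Dlist ds \<phi> x + c * Dlist ds \<psi> x)" .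
  have r: "rapid (Dlist ds (\<lambda>x. \<phi> x + c * \<psi> x))" for ds
    unfolding D rapid_def
  proof (intro conjI allI)
    show "continuous_on UNIV (\<lambda>x. Dlist ds \<phi> x + c * Dlist ds \<psi> x)"
      using * by (intro continuous_intros smooth_fn_continuous schwartz_smooth)
    fix k
    obtain M where M: "\<And>x. (1 + norm x) ^ k * norm (Dlist ds \<phi> x) \<le> M" using rapidD[OF schwartz_rapid[OF *(1)]] by blast
    obtain N where N: "\<And>x. (1 + norm x) ^ k * norm (Dlist ds \<psi> x) \<le> N" using rapidD[OF schwartz_rapid[OF *(2)]] by blast
    have "(1 + norm x) ^ k * norm (Dlist ds \<phi> x + c * Dlist ds \<psi> x) \<le> M + norm c * N" for x
    proof -
      have "(1 + norm x) ^ k * norm (Dlist ds \<phi> x + c * Dlist ds \<psi> x) \<le> (1 + norm x) ^ k * (norm (Dlist ds \<phi> x) + norm c * norm (Dlist ds \<psi> x))"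
        by (intro mult_left_mono order_trans[OF norm_triangle_ineq]) (auto simp: norm_mult)
      also have "\<dots> = (1 + norm x) ^ k * norm (Dlist ds \<phi> x) + norm c * ((1 + norm x) ^ k * norm (Dlist ds \<psi> x))"
        by (simp add: algebra_simps)
      also have "\<dots> \<le> M + norm c * N" by (intro add_mono mult_left_mono M N) auto
      finally show ?thesis .
    qed
    then show "\<exists>M. \<forall>x. (1 + norm x) ^ k * norm (Dlist ds \<phi> x + c * Dlist ds \<psi> x) \<le> M" by blast
  qed
  show "(\<lambda>x. \<phi> x + c * \<psi> x) \<in> schwartz"
  proof (rule schwartzI[OF smooth_fnI r])
    show "continuous_on UNIV (Dlist ds (\<lambda>x. \<phi> x + c * \<psi> x))" for ds using r by (auto simp: rapid_def)
    show "\<exists>g. has_pd (Dlist ds (\<lambda>x. \<phi> x + c * \<psi> x)) i g" for ds i unfolding D using pd by blast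
  qed
qed

section \<open>Inverse Fourier integrals of compactly supported functions\<close>

definition csupp :: "real \<Rightarrow> (real^'n::finite \<Rightarrow> complex) \<Rightarrow> bool" where
  "csupp R h \<longleftrightarrow> continuous_on UNIV h \<and> (\<forall>\<xi>. norm \<xi> > R \<longrightarrow> h \<xi> = 0)"

text \<open>The inverse Fourier integral without normalising factor; h lives on the frequency side,
  and a derivative of the result multiplies h by i times a coordinate.\<close>

definition FT :: "(real^'n::finite \<Rightarrow> complex) \<Rightarrow> real^'n \<Rightarrow> complex" where
  "FT h x = (\<integral>\<xi>. h \<xi> * cis (x \<bullet> \<xi>) \<partial>lborel)"

lemma csupp_measurable: "csupp R h \<Longrightarrow> h \<in> borel_measurable borel"
  by (auto simp: csupp_def intro: borel_measurable_continuous_onI)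

lemma csupp_bounded:
  assumes "csupp R h" shows "\<exists>M\<ge>0. \<forall>\<xi>. norm (h \<xi>) \<le> M"
proof -
  have "compact (h ` cball 0 R)"
    using assms by (intro compact_continuous_image) (auto simp: csupp_def intro: continuous_on_subset)
  then have "bounded (h ` cball 0 R)" by (rule compact_imp_bounded)
  then obtain M where "\<forall>y\<in>h ` cball 0 R. norm y \<le> M" unfolding bounded_iff by blast
  then have M: "norm (h \<xi>) \<le> M" if "norm \<xi> \<le> R" for \<xi> using that by simp
  have "norm (h \<xi>) \<le> max M 0" for \<xi>
    using M[of \<xi>] assms by (cases "norm \<xi> \<le> R") (auto simp: csupp_def)
  then show ?thesis by (intro exI[of _ "max M 0"]) auto
qed

lemma integrable_indicator_cball: "integrable lborel (\<lambda>\<xi>::real^'n::finite. M * indicator (cball 0 R) \<xi> :: real)"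
  by (intro integrable_mult_right integrable_real_indicator) (use emeasure_bounded_finite[OF bounded_cball] in auto)

lemma csupp_integrable:
  fixes h :: "real^'n::finite \<Rightarrow> complex"
  assumes "csupp R h" "g \<in> borel_measurable borel" "\<And>\<xi>. norm (g \<xi>) \<le> 1"
  shows "integrable lborel (\<lambda>\<xi>. h \<xi> * g \<xi>)"
    and "(\<And>\<xi>. norm (h \<xi>) \<le> M) \<Longrightarrow> norm (\<integral>\<xi>. h \<xi> * g \<xi> \<partial>lborel) \<le> M * measure lborel (cball 0 R :: (real^'n) set)"
proof -
  have b: "norm (h \<xi> * g \<xi>) \<le> M * indicator (cball 0 R) \<xi>" if "\<And>\<xi>. norm (h \<xi>) \<le> M" for M \<xi>
  proof -
    have "norm (h \<xi>) * norm (g \<xi>) \<le> norm (h \<xi>) * 1" by (intro mult_left_mono assms) auto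
    then show ?thesis using that[of \<xi>] assms(1) by (auto simp: norm_mult csupp_def indicator_def)
  qed
  obtain M' where M': "M' \<ge> 0" "\<And>\<xi>. norm (h \<xi>) \<le> M'" using csupp_bounded[OF assms(1)] by auto
  have "integrable lborel (\<lambda>\<xi>::real^'n. M' * indicator (cball 0 R) \<xi> :: real)" by (rule integrable_indicator_cball)
  then show i: "integrable lborel (\<lambda>\<xi>. h \<xi> * g \<xi>)"
    by (rule Bochner_Integration.integrable_bound)
       (use b[OF M'(2)] csupp_measurable[OF assms(1)] assms(2) in \<open>auto intro!: AE_I2 order_trans[OF _ abs_ge_self]\<close>)
  assume M: "\<And>\<xi>. norm (h \<xi>) \<le> M"
  have "norm (\<integral>\<xi>. h \<xi> * g \<xi> \<partial>lborel) \<le> (\<integral>\<xi>. norm (h \<xi> * g \<xi>) \<partial>lborel)" by (rule integral_norm_bound)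
  also have "\<dots> \<le> (\<integral>\<xi>. M * indicator (cball 0 R) (\<xi>::real^'n) \<partial>lborel)"
    by (rule integral_mono[OF integrable_norm[OF i] integrable_indicator_cball b[OF M]])
  also have "\<dots> = M * measure lborel (cball 0 R :: (real^'n) set)" by simp
  finally show "norm (\<integral>\<xi>. h \<xi> * g \<xi> \<partial>lborel) \<le> M * measure lborel (cball 0 R :: (real^'n) set)" .
qed

lemma cis_inner_measurable [measurable]: "(\<lambda>\<xi>. cis (x \<bullet> \<xi>)) \<in> borel_measurable borel"
  by (intro borel_measurable_continuous_onI continuous_intros)

lemma FT_integrable: "csupp R h \<Longrightarrow> integrable lborel (\<lambda>\<xi>. h \<xi> * cis (x \<bullet> \<xi>))"
  by (rule csupp_integrable(1)) auto

lemma FT_bound: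
  fixes h :: "real^'n::finite \<Rightarrow> complex"
  shows "csupp R h \<Longrightarrow> (\<And>\<xi>. norm (h \<xi>) \<le> M) \<Longrightarrow> norm (FT h x) \<le> M * measure lborel (cball 0 R :: (real^'n) set)"
  unfolding FT_def by (rule csupp_integrable(2)) auto

lemma csupp_mult: "csupp R h \<Longrightarrow> continuous_on UNIV g \<Longrightarrow> csupp R (\<lambda>\<xi>. g \<xi> * h \<xi>)"
  by (auto simp: csupp_def intro!: continuous_intros)

lemma FT_sum: "finite J \<Longrightarrow> (\<And>j. j \<in> J \<Longrightarrow> csupp R (h j)) \<Longrightarrow> FT (\<lambda>\<xi>. \<Sum>j\<in>J. c j * h j \<xi>) x = (\<Sum>j\<in>J. c j * FT (h j) x)"
proof -
  assume J: "finite J" "\<And>j. j \<in> J \<Longrightarrow> csupp R (h j)"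
  have "(\<integral>\<xi>. (\<Sum>j\<in>J. c j * h j \<xi>) * cis (x \<bullet> \<xi>) \<partial>lborel) = (\<integral>\<xi>. (\<Sum>j\<in>J. c j * (h j \<xi> * cis (x \<bullet> \<xi>))) \<partial>lborel)"
    by (simp add: sum_distrib_right mult.assoc)
  also have "\<dots> = (\<Sum>j\<in>J. (\<integral>\<xi>. c j * (h j \<xi> * cis (x \<bullet> \<xi>)) \<partial>lborel))"
    by (intro Bochner_Integration.integral_sum integrable_mult_right FT_integrable[OF J(2)])
  finally show ?thesis by (simp add: FT_def)
qed

lemma FT_cmult: "FT (\<lambda>\<xi>. c * h \<xi>) x = c * FT h x"
  by (simp add: FT_def mult.assoc)

lemma cis_line_derivative: "((\<lambda>t. cis (a + t * b)) has_vector_derivative \<i> * of_real b * cis (a + t * b)) (at t)"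
proof -
  have "((\<lambda>z. exp (\<i> * (of_real a + z * of_real b))) has_field_derivative \<i> * of_real b * exp (\<i> * (of_real a + of_real t * of_real b))) (at (of_real t))"
    by (auto intro!: derivative_eq_intros)
  from has_vector_derivative_real_field[OF this]
  show ?thesis by (simp add: cis_conv_exp)
qed

text \<open>The derivative is taken in an arbitrary direction and at an arbitrary time, as Taylor's
  formula along a segment requires.\<close>

lemma FT_line:
  assumes "csupp R h"
  shows "((\<lambda>t. FT h (x + t *\<^sub>R y)) has_vector_derivative FT (\<lambda>\<xi>. \<i> * of_real (y \<bullet> \<xi>) * h \<xi>) (x + s *\<^sub>R y)) (at s)"
proof -
  have 0: "((\<lambda>t. FT h (x + t *\<^sub>R y)) has_vector_derivative FT (\<lambda>\<xi>. \<i> * of_real (y \<bullet> \<xi>) * h \<xi>) x) (at 0)" for x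
  proof -
    have c': "csupp R (\<lambda>\<xi>. \<i> * of_real (y \<bullet> \<xi>) * h \<xi>)"
      by (intro csupp_mult assms continuous_intros)
    have "((\<lambda>t. \<integral>\<xi>. h \<xi> * cis (x \<bullet> \<xi> + t * (y \<bullet> \<xi>)) \<partial>lborel) has_vector_derivative
       (\<integral>\<xi>. h \<xi> * (\<i> * of_real (y \<bullet> \<xi>) * cis (x \<bullet> \<xi> + 0 * (y \<bullet> \<xi>))) \<partial>lborel)) (at 0)"
    proof (rule has_vector_derivative_integral(1)[where w="\<lambda>\<xi>. norm ((\<i> * of_real (y \<bullet> \<xi>) * h \<xi>) * 1)"])
      show "integrable lborel (\<lambda>\<xi>. h \<xi> * cis (x \<bullet> \<xi> + t * (y \<bullet> \<xi>)))" for t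
        using FT_integrable[OF assms, of "x + t *\<^sub>R y"] by (simp add: inner_add_left)
      show "((\<lambda>t. h \<xi> * cis (x \<bullet> \<xi> + t * (y \<bullet> \<xi>))) has_vector_derivative h \<xi> * (\<i> * of_real (y \<bullet> \<xi>) * cis (x \<bullet> \<xi> + t * (y \<bullet> \<xi>)))) (at t)" for t \<xi>
        by (intro has_vector_derivative_mult_right cis_line_derivative)
      show "integrable lborel (\<lambda>\<xi>. norm ((\<i> * of_real (y \<bullet> \<xi>) * h \<xi>) * 1))"
        by (intro integrable_norm csupp_integrable(1)[OF c']) auto
    qed (simp add: norm_mult)
    then show ?thesis by (simp add: FT_def inner_add_left algebra_simps)
  qed
  have "((\<lambda>t. t - s) has_vector_derivative 1) (at s)"
    by (auto intro!: derivative_eq_intros)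
  moreover have "((\<lambda>t. FT h ((x + s *\<^sub>R y) + t *\<^sub>R y)) has_vector_derivative FT (\<lambda>\<xi>. \<i> * of_real (y \<bullet> \<xi>) * h \<xi>) (x + s *\<^sub>R y)) (at (s - s))"
    using 0[of "x + s *\<^sub>R y"] by simp
  ultimately have "(((\<lambda>t. FT h ((x + s *\<^sub>R y) + t *\<^sub>R y)) \<circ> (\<lambda>t. t - s)) has_vector_derivative 1 *\<^sub>R FT (\<lambda>\<xi>. \<i> * of_real (y \<bullet> \<xi>) * h \<xi>) (x + s *\<^sub>R y)) (at s)"
    by (rule vector_diff_chain_at)
  then show ?thesis by (simp add: comp_def algebra_simps)
qed

lemma FT_has_pd:
  assumes "csupp R h"
  shows "has_pd (FT h) i (FT (\<lambda>\<xi>. \<i> * of_real (\<xi>$i) * h \<xi>))"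
  unfolding has_pd_def using FT_line[OF assms, of _ "axis i 1" 0] by (simp add: inner_axis')

lemma FT_continuous: "csupp R h \<Longrightarrow> continuous_on UNIV (FT h)"
  unfolding FT_def[abs_def]
proof (rule continuous_on_integral_dominated[where w="\<lambda>\<xi>. norm (h \<xi> * 1)"])
  assume h: "csupp R h"
  show "integrable lborel (\<lambda>\<xi>. norm (h \<xi> * 1))" by (intro integrable_norm csupp_integrable(1)[OF h]) auto
  show "(\<lambda>\<xi>. h \<xi> * cis (x \<bullet> \<xi>)) \<in> borel_measurable lborel" for x using csupp_measurable[OF h] by measurable
qed (auto simp: norm_mult intro!: continuous_intros)

text \<open>The Fourier symbol of \<open>Dlist ds\<close>, kept as a list because derivatives are
  iterated along lists.\<close>

definition monl :: "'n list \<Rightarrow> real^'n::finite \<Rightarrow> complex" where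
  "monl ds \<xi> = (\<Prod>i\<leftarrow>ds. \<i> * of_real (\<xi>$i))"

lemma monl_simps [simp]: "monl [] \<xi> = 1" "monl (i # ds) \<xi> = \<i> * of_real (\<xi>$i) * monl ds \<xi>"
  by (auto simp: monl_def)

lemma monl_append: "monl (ds @ es) \<xi> = monl ds \<xi> * monl es \<xi>"
  by (simp add: monl_def)

lemma continuous_on_monl [continuous_intros]: "continuous_on S (monl ds)"
  by (induction ds) (auto simp: monl_simps[abs_def] intro!: continuous_intros simp del: monl_simps)

lemma Dlist_FT: "csupp R h \<Longrightarrow> Dlist ds (FT h) = FT (\<lambda>\<xi>. monl ds \<xi> * h \<xi>)"
proof (induction ds)
  case (Cons i ds)
  have "has_pd (FT (\<lambda>\<xi>. monl ds \<xi> * h \<xi>)) i (FT (\<lambda>\<xi>. \<i> * of_real (\<xi>$i) * (monl ds \<xi> * h \<xi>)))"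
    by (rule FT_has_pd[OF csupp_mult[OF Cons.prems continuous_on_monl]])
  then show ?case using Cons by (simp add: partial_eq mult.assoc)
qed simp

lemma smooth_csupp_partial:
  assumes "smooth_fn h" "csupp R h"
  shows "csupp R (partial i h)"
  unfolding csupp_def
proof (intro conjI allI impI)
  show "continuous_on UNIV (partial i h)" using smooth_fn_continuous[OF assms(1), of "[i]"] by simp
  fix \<xi> :: "real^'a" assume "norm \<xi> > R"
  have "((\<lambda>t. h (\<xi> + t *\<^sub>R axis i 1)) has_vector_derivative partial i h \<xi>) (at 0)"
    using smooth_fn_has_pd[OF assms(1), of "[]" i] by (auto simp: has_pd_def)
  moreover have "((\<lambda>t. h (\<xi> + t *\<^sub>R axis i 1)) has_vector_derivative 0) (at 0)"
  proof (rule has_vector_derivative_transform_within_open[of "\<lambda>_. 0"])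
    show "open ((\<lambda>t. norm (\<xi> + t *\<^sub>R axis i 1)) -` {R<..})"
      by (intro open_vimage continuous_intros)
  qed (use assms(2) \<open>norm \<xi> > R\<close> in \<open>auto simp: csupp_def\<close>)
  ultimately show "partial i h \<xi> = 0" by (rule vector_derivative_unique_at)
qed

lemma smooth_csupp_Dlist: "smooth_fn h \<Longrightarrow> csupp R h \<Longrightarrow> csupp R (Dlist ds h)"
proof (induction ds)
  case (Cons i ds)
  then show ?case using smooth_csupp_partial[of "Dlist ds h" R i] smooth_fn_Dlist by auto
qed simp

text \<open>Integration by parts without boundary terms: the integral of H at the shifted point
  \<xi> + t e_i does not depend on t, so its derivative at t = 0, which is the integral of H',
  vanishes. The product rule for H = h cis (x . \<xi>) then gives the formula.\<close>

lemma FT_partial: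
  assumes "smooth_fn h" "csupp R h"
  shows "FT (partial i h) x = - \<i> * of_real (x$i) * FT h x"
proof -
  define H where "H \<xi> = h \<xi> * cis (x \<bullet> \<xi>)" for \<xi>
  define H' where "H' \<xi> = h \<xi> * (\<i> * of_real (x$i) * cis (x \<bullet> \<xi>)) + partial i h \<xi> * cis (x \<bullet> \<xi>)" for \<xi>
  note cp = smooth_csupp_partial[OF assms, of i]
  have "has_pd (\<lambda>\<xi>. cis (x \<bullet> \<xi>)) i (\<lambda>\<xi>. \<i> * of_real (x$i) * cis (x \<bullet> \<xi>))"
    using cis_line_derivative[of "x \<bullet> _" "x$i" 0]
    by (auto simp: has_pd_def inner_add_right inner_axis)
  moreover have "has_pd h i (partial i h)" using smooth_fn_has_pd[OF assms(1), of "[]" i] by simp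
  ultimately have pd: "has_pd H i H'" unfolding H_def[abs_def] H'_def[abs_def] by (intro has_pd_mult)
  have Hc: "csupp R H'" using cp assms(2) unfolding H'_def csupp_def by (auto intro!: continuous_intros)
  have Hm: "H \<in> borel_measurable borel" unfolding H_def using csupp_measurable[OF assms(2)] by measurable
  have Hi: "integrable lborel H" unfolding H_def by (rule FT_integrable[OF assms(2)])
  obtain M where M: "M \<ge> 0" "\<And>\<xi>. norm (H' \<xi>) \<le> M" using csupp_bounded[OF Hc] by auto
  have "((\<lambda>t. \<integral>\<xi>. H (\<xi> + t *\<^sub>R axis i 1) \<partial>lborel) has_vector_derivative (\<integral>\<xi>. H' (\<xi> + 0 *\<^sub>R axis i 1) \<partial>lborel)) (at 0)"
  \<comment> \<open>For |t| \<le> 1 the shifted support stays inside the ball of radius R +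
    1.\<close>
  proof (rule has_vector_derivative_integral(1)[where w="\<lambda>\<xi>. M * indicator (cball 0 (R + 1)) \<xi>"])
    show "integrable lborel (\<lambda>\<xi>. H (\<xi> + t *\<^sub>R axis i 1))" for t
      using lborel_translate(2)[OF Hm, of "t *\<^sub>R axis i 1"] Hi by (simp add: add.commute)
    show "((\<lambda>t. H (\<xi> + t *\<^sub>R axis i 1)) has_vector_derivative H' (\<xi> + t *\<^sub>R axis i 1)) (at t)" for t \<xi>
      by (rule has_pd_at[OF pd])
    fix t :: real and \<xi> assume t: "\<bar>t\<bar> \<le> 1"
    show "norm (H' (\<xi> + t *\<^sub>R axis i 1)) \<le> M * indicator (cball 0 (R + 1)) \<xi>"
    proof (cases "norm \<xi> \<le> R + 1")
      case False
      have "norm \<xi> \<le> norm (\<xi> + t *\<^sub>R axis i 1) + norm (t *\<^sub>R axis i 1 :: real^'a)"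
        using norm_triangle_ineq4[of "\<xi> + t *\<^sub>R axis i 1" "t *\<^sub>R axis i 1"] by simp
      then have "norm (\<xi> + t *\<^sub>R axis i 1) > R" using False t by simp
      then show ?thesis using Hc M by (simp add: csupp_def)
    qed (use M in auto)
  qed (rule integrable_indicator_cball)
  moreover have "(\<integral>\<xi>. H (\<xi> + t *\<^sub>R axis i 1) \<partial>lborel) = (\<integral>\<xi>. H \<xi> \<partial>lborel)" for t
    using lborel_translate(1)[OF Hm, of "t *\<^sub>R axis i 1"] by (simp add: add.commute)
  ultimately have "((\<lambda>t::real. \<integral>\<xi>. H \<xi> \<partial>lborel) has_vector_derivative (\<integral>\<xi>. H' \<xi> \<partial>lborel)) (at 0)" by simp
  then have "(\<integral>\<xi>. H' \<xi> \<partial>lborel) = 0" by (rule vector_derivative_unique_at) simp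
  moreover have "(\<integral>\<xi>. H' \<xi> \<partial>lborel) = \<i> * of_real (x$i) * FT h x + FT (partial i h) x"
  proof -
    have "(\<integral>\<xi>. H' \<xi> \<partial>lborel) = (\<integral>\<xi>. \<i> * of_real (x$i) * (h \<xi> * cis (x \<bullet> \<xi>)) + partial i h \<xi> * cis (x \<bullet> \<xi>) \<partial>lborel)"
      by (simp add: H'_def algebra_simps)
    also have "\<dots> = \<i> * of_real (x$i) * FT h x + FT (partial i h) x"
      unfolding FT_def using FT_integrable[OF assms(2)] FT_integrable[OF cp] by (subst Bochner_Integration.integral_add) auto
    finally show ?thesis .
  qed
  ultimately show ?thesis by (simp add: add_eq_0_iff)
qed

lemma FT_Dlist_replicate:
  assumes "smooth_fn h" "csupp R h"
  shows "FT (Dlist (replicate k i) h) x = (- \<i> * of_real (x$i)) ^ k * FT h x"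
proof (induction k)
  case (Suc k)
  have "FT (partial i (Dlist (replicate k i) h)) x = - \<i> * of_real (x$i) * FT (Dlist (replicate k i) h) x"
    using assms by (intro FT_partial smooth_fn_Dlist smooth_csupp_Dlist)
  then show ?case by (simp add: Suc)
qed simp

text \<open>The largest coordinate dominates the norm up to the factor n. Decay of order k therefore
  follows from the pure powers of single coordinates, that is, from repeated derivatives in one
  direction on the frequency side.\<close>

lemma weight_le_coordinates:
  fixes x :: "real^'n::finite"
  shows "(1 + norm x) ^ k \<le> (1 + real CARD('n)) ^ k * (1 + (\<Sum>i\<in>UNIV. \<bar>x$i\<bar> ^ k))"
proof -
  have "\<exists>i. \<forall>j. \<bar>x$j\<bar> \<le> \<bar>x$i\<bar>"
    using Max_in[of "range (\<lambda>i. \<bar>x$i\<bar>)"] Max_ge[of "range (\<lambda>i. \<bar>x$i\<bar>)"] by fastforce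
  then obtain i where i: "\<And>j. \<bar>x$j\<bar> \<le> \<bar>x$i\<bar>" by auto
  have "norm x \<le> (\<Sum>j\<in>UNIV. \<bar>x$j\<bar>)" by (rule norm_le_l1_cart)
  also have "\<dots> \<le> real CARD('n) * \<bar>x$i\<bar>" using sum_bounded_above[of UNIV "\<lambda>j. \<bar>x$j\<bar>" "\<bar>x$i\<bar>"] i by simp
  finally have n: "norm x \<le> real CARD('n) * \<bar>x$i\<bar>" .
  have "1 + norm x \<le> (1 + real CARD('n)) * max 1 \<bar>x$i\<bar>"
  proof -
    have "real CARD('n) * \<bar>x$i\<bar> \<le> real CARD('n) * max 1 \<bar>x$i\<bar>" by (intro mult_left_mono) auto
    then show ?thesis using n by (simp only: distrib_right)
  qed
  then have "(1 + norm x) ^ k \<le> ((1 + real CARD('n)) * max 1 \<bar>x$i\<bar>) ^ k" by (rule power_mono) simp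
  also have "\<dots> = (1 + real CARD('n)) ^ k * max 1 \<bar>x$i\<bar> ^ k" by (rule power_mult_distrib)
  also have "max 1 \<bar>x$i\<bar> ^ k \<le> 1 + \<bar>x$i\<bar> ^ k" by (auto simp: max_def)
  also have "1 + \<bar>x$i\<bar> ^ k \<le> 1 + (\<Sum>i\<in>UNIV. \<bar>x$i\<bar> ^ k)" by (auto intro!: member_le_sum)
  finally show ?thesis by (simp add: mult_left_mono)
qed

text \<open>Each factor \<open>x$i\<close> costs one derivative of h in direction i, and the
  derivatives of h are bounded uniformly on the common support ball; hence one constant serves all
  indices.\<close>

lemma FT_decay:
  fixes h :: "'a \<Rightarrow> real^'n::finite \<Rightarrow> complex"
  assumes u: "usmooth I (cball 0 R) h" and c: "\<And>a. a \<in> I \<Longrightarrow> csupp R (h a)"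
  shows "\<exists>M. \<forall>a\<in>I. \<forall>x. (1 + norm x) ^ k * norm (FT (h a) x) \<le> M"
proof -
  define V where "V = measure lborel (cball 0 R :: (real^'n) set)"
  have "\<exists>M. \<forall>a\<in>I. \<forall>x. norm (FT (Dlist ds (h a)) x) \<le> M" for ds
  proof -
    obtain M where M: "\<And>a \<xi>. a \<in> I \<Longrightarrow> norm \<xi> \<le> R \<Longrightarrow> norm (Dlist ds (h a) \<xi>) \<le> M"
      using u unfolding usmooth_def by (metis mem_cball_0)
    have "norm (FT (Dlist ds (h a)) x) \<le> max M 0 * V" if "a \<in> I" for a x
      unfolding V_def
    proof (rule FT_bound)
      show cs: "csupp R (Dlist ds (h a))" using u c that by (intro smooth_csupp_Dlist) (auto simp: usmooth_def)
      show "norm (Dlist ds (h a) \<xi>) \<le> max M 0" for \<xi>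
        using M[OF that, of \<xi>] cs by (cases "norm \<xi> \<le> R") (auto simp: csupp_def)
    qed
    then show ?thesis by blast
  qed
  then obtain M where M: "\<And>ds a x. a \<in> I \<Longrightarrow> norm (FT (Dlist ds (h a)) x) \<le> M ds" by metis
  have "(1 + norm x) ^ k * norm (FT (h a) x) \<le> (1 + real CARD('n)) ^ k * (M [] + (\<Sum>i\<in>UNIV. M (replicate k i)))" if "a \<in> I" for a x
  proof -
    have i: "\<bar>x$i\<bar> ^ k * norm (FT (h a) x) \<le> M (replicate k i)" for i
    proof -
      have "norm (FT (Dlist (replicate k i) (h a)) x) = \<bar>x$i\<bar> ^ k * norm (FT (h a) x)"
        using u c that by (subst FT_Dlist_replicate[of _ R]) (auto simp: usmooth_def norm_mult norm_power)
      then show ?thesis using M[OF that, of "replicate k i" x] by simp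
    qed
    have "(1 + norm x) ^ k * norm (FT (h a) x) \<le> ((1 + real CARD('n)) ^ k * (1 + (\<Sum>i\<in>UNIV. \<bar>x$i\<bar> ^ k))) * norm (FT (h a) x)"
      by (intro mult_right_mono weight_le_coordinates) auto
    also have "\<dots> = (1 + real CARD('n)) ^ k * (norm (FT (h a) x) + (\<Sum>i\<in>UNIV. \<bar>x$i\<bar> ^ k * norm (FT (h a) x)))"
      by (simp add: algebra_simps sum_distrib_right sum_distrib_left)
    also have "\<dots> \<le> (1 + real CARD('n)) ^ k * (M [] + (\<Sum>i\<in>UNIV. M (replicate k i)))"
      using M[OF that, of "[]" x] by (intro mult_left_mono add_mono sum_mono i) auto
    finally show ?thesis .
  qed
  then show ?thesis by blast
qed

lemma smooth_fn_mult: "smooth_fn f \<Longrightarrow> smooth_fn g \<Longrightarrow> smooth_fn (\<lambda>x. f x * g x)"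
  unfolding smooth_fn_usmooth by (rule usmooth_mult)

lemma smooth_fn_monl: "smooth_fn (monl ds)"
proof (induction ds)
  case Nil
  then show ?case using usmooth_const[of "{()}" "{}" 1] by (simp add: monl_def[abs_def] smooth_fn_usmooth)
next
  case (Cons i ds)
  have "smooth_fn (\<lambda>\<xi>. (\<i> * of_real (\<xi>$i)) * monl ds \<xi>)"
    using usmooth_const[of "{()}" "{}" \<i>] smooth_fn_coord[of i]
    by (intro smooth_fn_mult Cons) (auto simp: smooth_fn_usmooth)
  then show ?case by (simp add: monl_def)
qed

lemma FT_rapid:
  assumes "smooth_fn h" "csupp R h"
  shows "rapid (FT h)"
proof -
  have "usmooth {()} (cball 0 R) (\<lambda>_. h)" by (intro usmooth_const_family assms) auto
  then have "\<exists>M. \<forall>a\<in>{()}. \<forall>x. (1 + norm x) ^ k * norm (FT h x) \<le> M" for k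
    using assms by (intro FT_decay) auto
  then show ?thesis unfolding rapid_def using FT_continuous[OF assms(2)] by auto
qed

lemma FT_schwartz:
  assumes "smooth_fn h" "csupp R h"
  shows "FT h \<in> schwartz"
proof (rule schwartzI)
  show r: "rapid (Dlist ds (FT h))" for ds
    unfolding Dlist_FT[OF assms(2)]
    using assms by (intro FT_rapid[of _ R] smooth_fn_mult smooth_fn_monl csupp_mult continuous_intros)
  show "smooth_fn (FT h)"
  proof (rule smooth_fnI)
    show "continuous_on UNIV (Dlist ds (FT h))" for ds using r by (auto simp: rapid_def)
    show "\<exists>g. has_pd (Dlist ds (FT h)) i g" for ds i
      unfolding Dlist_FT[OF assms(2)]
      using FT_has_pd[OF csupp_mult[OF assms(2) continuous_on_monl]] by blast
  qed
qed

lemma FT_dil: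
  assumes "csupp R h" "s > 0"
  shows "FT (\<lambda>\<xi>. h (dil \<kappa> s \<xi>)) x = of_real (inverse s ^ (\<Sum>l\<in>UNIV. \<kappa> l)) * FT h (dil \<kappa> (inverse s) x)"
proof -
  have m: "(\<lambda>\<xi>. h (dil \<kappa> s \<xi>) * cis (x \<bullet> \<xi>)) \<in> borel_measurable borel"
    using csupp_measurable[OF assms(1)] by measurable
  have inv: "dil \<kappa> s (dil \<kappa> (inverse s) \<xi>) = \<xi>" for \<xi> :: "real^'a"
    using assms(2) by (simp add: vec_eq_iff power_inverse)
  have inn: "x \<bullet> dil \<kappa> (inverse s) \<xi> = dil \<kappa> (inverse s) x \<bullet> \<xi>" for \<xi> :: "real^'a"
    by (simp add: inner_vec_def algebra_simps)
  show ?thesis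
    unfolding FT_def using lborel_dil[OF m, of "inverse s" \<kappa>] assms(2) by (simp add: inv inn)
qed

section \<open>Fourier inversion at the origin and smooth cut-offs\<close>

text \<open>This is the characteristic function of the standard normal law, multiplied by the
  normalising constant of its density.\<close>

lemma gaussian_transform_1d:
  "\<exists>C>0. \<forall>r. integrable lborel (\<lambda>t. complex_of_real (exp (- (t^2) / 2)) * cis (t * r)) \<and>
      (\<integral>t. complex_of_real (exp (- (t^2) / 2)) * cis (t * r) \<partial>lborel) = of_real (C * exp (- (r^2) / 2))"
proof (intro exI[of _ "sqrt (2 * pi)"] conjI allI)
  show "0 < sqrt (2 * pi)" by simp
  have gi: "integrable lborel (\<lambda>t::real. exp (- (t^2) / 2))"
  proof -
    have "integrable lborel (\<lambda>t::real. sqrt (2 * pi) * std_normal_density t)"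
      by (intro integrable_mult_right) auto
    then show ?thesis by (simp add: std_normal_density_def)
  qed
  fix r :: real
  show "integrable lborel (\<lambda>t. complex_of_real (exp (- (t^2) / 2)) * cis (t * r))"
    by (rule Bochner_Integration.integrable_bound[OF gi])
       (auto simp: norm_mult intro!: borel_measurable_continuous_onI continuous_intros)
  have "(\<integral>t. complex_of_real (exp (- (t^2) / 2)) * cis (t * r) \<partial>lborel)
     = (\<integral>t. of_real (sqrt (2 * pi)) * (std_normal_density t *\<^sub>R iexp (r * t)) \<partial>lborel)"
    by (intro Bochner_Integration.integral_cong refl)
       (simp add: std_normal_density_def scaleR_conv_of_real cis_conv_exp mult.commute)
  also have "\<dots> = of_real (sqrt (2 * pi)) * char std_normal_distribution r"
    unfolding char_def integral_mult_right_zero by (subst integral_density) (auto simp: normal_density_nonneg)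
  also have "\<dots> = of_real (sqrt (2 * pi) * exp (- (r^2) / 2))"
    by (simp add: char_std_normal_distribution)
  finally show "(\<integral>t. complex_of_real (exp (- (t^2) / 2)) * cis (t * r) \<partial>lborel) = of_real (sqrt (2 * pi) * exp (- (r^2) / 2))" .
qed

lemma integrable_pair_mult:
  fixes a b :: "real^'n::finite \<Rightarrow> complex"
  assumes "integrable lborel a" "integrable lborel b"
  shows "integrable (lborel \<Otimes>\<^sub>M lborel) (\<lambda>(x, y). a x * b y)"
proof (rule lborel_pair.Fubini_integrable)
  have [measurable]: "a \<in> borel_measurable borel" "b \<in> borel_measurable borel"
    using assms[THEN borel_measurable_integrable] by auto
  show "(\<lambda>(x, y). a x * b y) \<in> borel_measurable (lborel \<Otimes>\<^sub>M lborel)" by measurable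
  show "integrable lborel (\<lambda>x. \<integral>y. norm (case (x, y) of (x, y) \<Rightarrow> a x * b y) \<partial>lborel)"
    using assms by (simp add: norm_mult)
  show "AE x in lborel. integrable lborel (\<lambda>y. case (x, y) of (x, y) \<Rightarrow> a x * b y)"
    using assms by simp
qed

text \<open>Fourier inversion at the origin. A Gaussian \<gamma> is its own transform up to a
  constant. When \<gamma>(x / (n + 1)) is inserted, Fubini and rescaling give the identity
  \<open>key\<close>, and both of its sides converge by domination. The constant is chosen before
  h.\<close>

theorem integral_FT:
  "\<exists>c\<noteq>0. \<forall>h R. csupp R h \<longrightarrow> rapid (FT h) \<longrightarrow> (\<integral>x. FT h x \<partial>lborel) = c * h (0::real^'n::finite)"
proof -
  obtain C where C: "C > 0" "\<And>r. integrable lborel (\<lambda>t. complex_of_real (exp (- (t^2) / 2)) * cis (t * r))"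
     "\<And>r. (\<integral>t. complex_of_real (exp (- (t^2) / 2)) * cis (t * r) \<partial>lborel) = of_real (C * exp (- (r^2) / 2))"
    using gaussian_transform_1d by auto
  define \<gamma> where "\<gamma> x = (\<Prod>i\<in>UNIV. complex_of_real (exp (- ((x$i)^2) / 2)))" for x :: "real^'n"
  have cisp: "cis (\<Sum>i\<in>S. w i) = (\<Prod>i\<in>S. cis (w i))" for S :: "'n set" and w
    by (induction S rule: infinite_finite_induct) (auto simp: cis_mult[symmetric])
  have \<gamma>cis: "\<gamma> x * cis (x \<bullet> \<xi>) = (\<Prod>i\<in>UNIV. complex_of_real (exp (- ((x$i)^2) / 2)) * cis (x$i * \<xi>$i))" for x \<xi>
    by (simp add: \<gamma>_def inner_vec_def cisp prod.distrib)
  have \<Gamma>: "integrable lborel (\<lambda>x. \<gamma> x * cis (x \<bullet> \<xi>))" "(\<integral>x. \<gamma> x * cis (x \<bullet> \<xi>) \<partial>lborel) = of_real (C ^ CARD('n)) * \<gamma> \<xi>" for \<xi>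
  proof -
    note * = integral_vec_prod[of "\<lambda>i t. complex_of_real (exp (- (t^2) / 2)) * cis (t * \<xi>$i)", OF C(2)]
    show "integrable lborel (\<lambda>x. \<gamma> x * cis (x \<bullet> \<xi>))" unfolding \<gamma>cis by (rule *(1))
    show "(\<integral>x. \<gamma> x * cis (x \<bullet> \<xi>) \<partial>lborel) = of_real (C ^ CARD('n)) * \<gamma> \<xi>"
      unfolding \<gamma>cis *(2) C(3) by (simp add: \<gamma>_def prod.distrib)
  qed
  have \<gamma>i: "integrable lborel \<gamma>" using \<Gamma>(1)[of 0] by simp
  have \<gamma>c: "continuous_on UNIV \<gamma>" unfolding \<gamma>_def by (intro continuous_intros) auto
  have \<gamma>b: "norm (\<gamma> x) \<le> 1" for x
    unfolding \<gamma>_def by (simp add: prod_norm[symmetric] prod_le_1)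
  have \<gamma>0: "\<gamma> 0 = 1" by (simp add: \<gamma>_def)
  have [measurable]: "\<gamma> \<in> borel_measurable borel" by (rule borel_measurable_continuous_onI[OF \<gamma>c])
  define c where "c = complex_of_real (C ^ CARD('n)) * (\<integral>x. \<gamma> x \<partial>lborel)"
  \<comment> \<open>The integral of \<gamma> is the value of its transform at 0, which is a positive
    power of C.\<close>
  have "c \<noteq> 0" using \<Gamma>(2)[of 0] C(1) \<gamma>0 by (simp add: c_def)
  moreover have "(\<integral>x. FT h x \<partial>lborel) = c * h 0" if h: "csupp R h" and r: "rapid (FT h)" for h :: "real^'n \<Rightarrow> complex" and R
  proof -
    obtain M where M: "M \<ge> 0" "\<And>\<xi>. norm (h \<xi>) \<le> M" using csupp_bounded[OF h] by auto
    have [measurable]: "h \<in> borel_measurable borel" "FT h \<in> borel_measurable borel"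
      using csupp_measurable[OF h] rapid_measurable[OF r] by auto
    define d where "d n = dil (\<lambda>_::'n. 1) (1 / real (Suc n))" for n
    have d: "d n x = (1 / real (Suc n)) *\<^sub>R x" for n x
      by (simp add: d_def vec_eq_iff)
    have dlim: "(\<lambda>n. d n x) \<longlonglongrightarrow> 0" for x
      unfolding d using tendsto_scaleR[OF LIMSEQ_inverse_real_of_nat tendsto_const[of x]] by (simp add: divide_inverse)
    have dm: "d n \<in> borel_measurable borel" for n unfolding d_def by simp
    note [measurable] = dm
    have key: "(\<integral>x. FT h x * \<gamma> (d n x) \<partial>lborel) = of_real (C ^ CARD('n)) * (\<integral>\<xi>. h (d n \<xi>) * \<gamma> \<xi> \<partial>lborel)" for n
    proof -
      have s: "1 / real (Suc n) > 0" by simp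
      have cd: "csupp (R * Suc n) (\<lambda>\<xi>. h (d n \<xi>))"
        unfolding csupp_def d
      proof (intro conjI allI impI)
        show "continuous_on UNIV (\<lambda>\<xi>. h ((1 / real (Suc n)) *\<^sub>R \<xi>))"
          using h by (auto simp: csupp_def intro!: continuous_on_compose2[of UNIV h] continuous_intros)
        fix \<xi> :: "real^'n" assume "R * Suc n < norm \<xi>"
        then have "norm ((1 / real (Suc n)) *\<^sub>R \<xi>) > R" by (simp add: field_simps)
        then show "h ((1 / real (Suc n)) *\<^sub>R \<xi>) = 0" using h by (auto simp: csupp_def)
      qed
      have hi: "integrable lborel (\<lambda>\<xi>. h (d n \<xi>))" using csupp_integrable(1)[OF cd, of "\<lambda>_. 1"] by simp
      have "integrable (lborel \<Otimes>\<^sub>M lborel) (\<lambda>(x, \<xi>). \<gamma> x * h (d n \<xi>))"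
        by (rule integrable_pair_mult[OF \<gamma>i hi])
      then have fi: "integrable (lborel \<Otimes>\<^sub>M lborel) (\<lambda>(x, \<xi>). h (d n \<xi>) * (\<gamma> x * cis (x \<bullet> \<xi>)))"
      proof (rule Bochner_Integration.integrable_bound)
        have [measurable]: "cis \<in> borel_measurable borel"
          by (intro borel_measurable_continuous_onI continuous_intros)
        show "(\<lambda>(x, \<xi>). h (d n \<xi>) * (\<gamma> x * cis (x \<bullet> \<xi>))) \<in> borel_measurable (lborel \<Otimes>\<^sub>M lborel)"
          by measurable
      qed (auto simp: norm_mult)
      have "of_real (C ^ CARD('n)) * (\<integral>\<xi>. h (d n \<xi>) * \<gamma> \<xi> \<partial>lborel) = (\<integral>\<xi>. h (d n \<xi>) * (\<integral>x. \<gamma> x * cis (x \<bullet> \<xi>) \<partial>lborel) \<partial>lborel)"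
        unfolding \<Gamma>(2) integral_mult_right_zero[symmetric] by (simp add: algebra_simps)
      also have "\<dots> = (\<integral>\<xi>. (\<integral>x. h (d n \<xi>) * (\<gamma> x * cis (x \<bullet> \<xi>)) \<partial>lborel) \<partial>lborel)" by simp
      also have "\<dots> = (\<integral>x. (\<integral>\<xi>. h (d n \<xi>) * (\<gamma> x * cis (x \<bullet> \<xi>)) \<partial>lborel) \<partial>lborel)"
        using lborel_pair.Fubini_integral[OF fi] by simp
      also have "\<dots> = (\<integral>x. \<gamma> x * FT (\<lambda>\<xi>. h (d n \<xi>)) x \<partial>lborel)"
        unfolding FT_def integral_mult_right_zero[symmetric] by (simp add: algebra_simps)
      also have "\<dots> = of_real ((1 / real (Suc n)) ^ CARD('n)) * (\<integral>x. \<gamma> (d n x) * FT (\<lambda>\<xi>. h (d n \<xi>)) (d n x) \<partial>lborel)"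
      proof -
        have "FT (\<lambda>\<xi>. h (d n \<xi>)) \<in> borel_measurable borel"
          by (rule borel_measurable_continuous_onI[OF FT_continuous[OF cd]])
        then have "(\<lambda>x. \<gamma> x * FT (\<lambda>\<xi>. h (d n \<xi>)) x) \<in> borel_measurable borel" by measurable
        from lborel_dil[OF this s, of "\<lambda>_. 1"] show ?thesis by (simp add: d_def)
      qed
      also have "\<dots> = (\<integral>x. FT h x * \<gamma> (d n x) \<partial>lborel)"
      proof -
        have di: "dil (\<lambda>_. 1) (inverse (1 / real (Suc n))) (d n x) = x" for x
          by (simp add: d_def vec_eq_iff)
        have "FT (\<lambda>\<xi>. h (d n \<xi>)) (d n x) = of_real (inverse (1 / real (Suc n)) ^ CARD('n)) * FT h x" for x
          unfolding d_def using FT_dil[OF h s, of "\<lambda>_. 1" "d n x"] di[of x] by (simp add: d_def)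
        then show ?thesis
          unfolding integral_mult_right_zero[symmetric] by (simp add: field_simps del: of_nat_Suc)
      qed
      finally show ?thesis by simp
    qed
    have l1: "(\<lambda>n. \<integral>x. FT h x * \<gamma> (d n x) \<partial>lborel) \<longlonglongrightarrow> (\<integral>x. FT h x * \<gamma> 0 \<partial>lborel)"
    proof (rule integral_dominated_convergence[where w="\<lambda>x. norm (FT h x)"])
      show "integrable lborel (\<lambda>x. norm (FT h x))" using rapid_integrable[OF r] by simp
      show "AE x in lborel. (\<lambda>n. FT h x * \<gamma> (d n x)) \<longlonglongrightarrow> FT h x * \<gamma> 0"
        using \<gamma>c dlim by (intro AE_I2 tendsto_intros continuous_on_tendsto_compose[of UNIV \<gamma>]) auto
      show "AE x in lborel. norm (FT h x * \<gamma> (d n x)) \<le> norm (FT h x)" for n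
        using \<gamma>b by (auto simp: norm_mult mult_left_le)
    qed measurable
    have l2: "(\<lambda>n. \<integral>\<xi>. h (d n \<xi>) * \<gamma> \<xi> \<partial>lborel) \<longlonglongrightarrow> (\<integral>\<xi>. h 0 * \<gamma> \<xi> \<partial>lborel)"
    proof (rule integral_dominated_convergence[where w="\<lambda>x. M * norm (\<gamma> x)"])
      show "integrable lborel (\<lambda>x. M * norm (\<gamma> x))" using \<gamma>i by simp
      show "AE x in lborel. (\<lambda>n. h (d n x) * \<gamma> x) \<longlonglongrightarrow> h 0 * \<gamma> x"
        using h dlim by (intro AE_I2 tendsto_intros continuous_on_tendsto_compose[of UNIV h]) (auto simp: csupp_def)
      show "AE x in lborel. norm (h (d n x) * \<gamma> x) \<le> M * norm (\<gamma> x)" for n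
        using M by (auto simp: norm_mult mult_right_mono)
    qed measurable
    have "(\<integral>x. FT h x * \<gamma> 0 \<partial>lborel) = of_real (C ^ CARD('n)) * (\<integral>\<xi>. h 0 * \<gamma> \<xi> \<partial>lborel)"
      by (rule LIMSEQ_unique[OF l1]) (use tendsto_mult[OF tendsto_const l2] in \<open>simp add: key\<close>)
    then show ?thesis by (simp add: \<gamma>0 c_def mult_ac)
  qed
  ultimately show ?thesis by blast
qed

text \<open>The usual quotient of flat functions: the numerator lives on |x|^2 < 2 and the other
  summand on |x|^2 > 1, so the denominator never vanishes. The coefficients -1 and 1 are spelled out
  to match the shape c + d |x|^2 in \<open>smooth_fn_flatexp\<close>.\<close>

definition eta :: "real^'n::finite \<Rightarrow> complex" where
  "eta x = complex_of_real (flatexp 0 (2 + (-1) * (norm x)\<^sup>2)) *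
      inverse (complex_of_real (flatexp 0 (2 + (-1) * (norm x)\<^sup>2)) + complex_of_real (flatexp 0 (-1 + 1 * (norm x)\<^sup>2)))"

lemma flatexp_pos: "t > 0 \<Longrightarrow> flatexp k t > 0" by (simp add: flatexp_def)

lemma flatexp_zero: "t \<le> 0 \<Longrightarrow> flatexp k t = 0" by (simp add: flatexp_def)

lemma smooth_fn_eta: "smooth_fn (eta :: real^'n::finite \<Rightarrow> complex)"
  unfolding eta_def[abs_def] smooth_fn_usmooth
proof (intro usmooth_mult usmooth_inverse[where c=1] usmooth_add)
  fix x :: "real^'n"
  have "0 < flatexp 0 (2 + (-1) * (norm x)\<^sup>2) + flatexp 0 (-1 + 1 * (norm x)\<^sup>2)"
  proof (cases "(norm x)\<^sup>2 < 2")
    case True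
    then show ?thesis by (intro add_pos_nonneg[OF flatexp_pos flatexp_nonneg]) auto
  next
    case False
    then show ?thesis by (intro add_nonneg_pos[OF flatexp_nonneg flatexp_pos]) auto
  qed
  then show "complex_of_real (flatexp 0 (2 + (-1) * (norm x)\<^sup>2)) + complex_of_real (flatexp 0 (-1 + 1 * (norm x)\<^sup>2)) \<noteq> 0"
    unfolding of_real_add[symmetric] of_real_eq_0_iff by linarith
qed (rule smooth_fn_flatexp[unfolded smooth_fn_usmooth] | simp)+

lemma eta_1: "norm x \<le> 1 \<Longrightarrow> eta x = 1"
proof -
  assume "norm x \<le> 1"
  then have "(norm x)\<^sup>2 \<le> 1" by (simp add: power_le_one)
  then show ?thesis using flatexp_pos[of "2 - (norm x)\<^sup>2" 0] by (simp add: eta_def flatexp_zero)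
qed

lemma eta_0: "norm x \<ge> 2 \<Longrightarrow> eta x = 0"
proof -
  assume "norm x \<ge> 2"
  then have "(norm x)\<^sup>2 \<ge> 2\<^sup>2" by (intro power_mono) auto
  then show ?thesis by (simp add: eta_def flatexp_zero)
qed

lemma csupp_eta: "csupp 2 eta"
  using smooth_fn_continuous[OF smooth_fn_eta, of "[]"] by (auto simp: csupp_def eta_0)

lemma norm_dil_le: "0 \<le> s \<Longrightarrow> s \<le> 1 \<Longrightarrow> (\<And>l. 1 \<le> \<kappa> l) \<Longrightarrow> norm (dil \<kappa> s x) \<le> s * norm x"
proof -
  assume s: "0 \<le> s" "s \<le> 1" "\<And>l. 1 \<le> \<kappa> l"
  have "norm (dil \<kappa> s x) \<le> norm (s *\<^sub>R x)"
  proof (rule norm_le_componentwise_cart)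
    fix i
    have "s ^ \<kappa> i \<le> s ^ 1" using s by (intro power_decreasing) auto
    then show "norm (dil \<kappa> s x $ i) \<le> norm ((s *\<^sub>R x) $ i)" using s by (simp add: abs_mult mult_right_mono)
  qed
  then show ?thesis using s by simp
qed

lemma norm_dil_ge: "0 \<le> s \<Longrightarrow> s \<le> 1 \<Longrightarrow> (\<And>l. \<kappa> l \<le> D) \<Longrightarrow> s ^ D * norm x \<le> norm (dil \<kappa> s x)"
proof -
  assume s: "0 \<le> s" "s \<le> 1" "\<And>l. \<kappa> l \<le> D"
  have "norm (s ^ D *\<^sub>R x) \<le> norm (dil \<kappa> s x)"
  proof (rule norm_le_componentwise_cart)
    fix i
    have "s ^ D \<le> s ^ \<kappa> i" using s by (intro power_decreasing) auto
    then show "norm ((s ^ D *\<^sub>R x) $ i) \<le> norm (dil \<kappa> s x $ i)" using s by (simp add: abs_mult mult_right_mono)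
  qed
  then show ?thesis using s by simp
qed

definition chi :: "('n::finite \<Rightarrow> nat) \<Rightarrow> real^'n \<Rightarrow> complex" where
  "chi \<kappa> x = eta (dil \<kappa> (1/2) x) - eta x"

lemma smooth_fn_chi: "smooth_fn (chi \<kappa>)"
  unfolding chi_def[abs_def] smooth_fn_usmooth
  by (intro usmooth_minus) (auto simp: smooth_fn_usmooth[symmetric] smooth_fn_eta smooth_fn_dil)

lemma chi_near_0: "(\<And>l. 1 \<le> \<kappa> l) \<Longrightarrow> norm x \<le> 1 \<Longrightarrow> chi \<kappa> x = 0"
  using norm_dil_le[of "1/2" \<kappa> x] by (simp add: chi_def eta_1)

text \<open>The dilation by 1/2 shrinks norms by at most the factor 2^(-D), so beyond this radius
  both cut-offs are zero.\<close>

lemma csupp_chi: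
  assumes "\<And>l. \<kappa> l \<le> D"
  shows "csupp (2 * 2 ^ D) (chi \<kappa>)"
  unfolding csupp_def
proof (intro conjI allI impI)
  show "continuous_on UNIV (chi \<kappa>)" using smooth_fn_continuous[OF smooth_fn_chi, of "[]"] by simp
  fix x :: "real^'a" assume x: "2 * 2 ^ D < norm x"
  have "2 \<le> (1/2) ^ D * norm x" using x by (simp add: field_simps)
  then have "2 \<le> norm (dil \<kappa> (1/2) x)" using norm_dil_ge[of "1/2" \<kappa> D x] assms by simp
  moreover have "2 \<le> norm x" using x one_le_power[of "2::real" D] by linarith
  ultimately show "chi \<kappa> x = 0" by (simp add: chi_def eta_0)
qed

section \<open>Anisotropic distance and kernel estimates\<close>

lemma kdist_knorm: "kdist \<kappa> x y = knorm \<kappa> (x - y)"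
  by (simp add: knorm_def kdist_def)

lemma knorm_alt: "knorm \<kappa> z = sqrt (\<Sum>l\<in>UNIV. (\<bar>z$l\<bar> powr (1 / real (\<kappa> l)))\<^sup>2)"
proof -
  have "\<bar>z$l\<bar> powr (2 / real (\<kappa> l)) = (\<bar>z$l\<bar> powr (1 / real (\<kappa> l)))\<^sup>2" for l
    by (simp add: power2_eq_square powr_add[symmetric])
  then show ?thesis by (simp add: knorm_def kdist_def)
qed

lemma knorm_nonneg [simp]: "0 \<le> knorm \<kappa> z"
  by (simp add: knorm_alt sum_nonneg)

lemma knorm_minus [simp]: "knorm \<kappa> (- z) = knorm \<kappa> z"
  by (simp add: knorm_alt)

lemma knorm_mono:
  assumes "\<And>l. \<bar>x$l\<bar> \<le> \<bar>y$l\<bar>"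
  shows "knorm \<kappa> x \<le> knorm \<kappa> y"
  unfolding knorm_alt using assms
  by (intro real_sqrt_le_mono sum_mono power_mono powr_mono2) auto

lemma powr_inverse_power: "0 \<le> s \<Longrightarrow> 1 \<le> k \<Longrightarrow> (s ^ k) powr (1 / real k) = s"
  by (cases "s = 0") (auto simp: powr_powr simp flip: powr_realpow)

lemma coordinate_le_knorm:
  assumes "1 \<le> \<kappa> l"
  shows "\<bar>z$l\<bar> \<le> knorm \<kappa> z ^ \<kappa> l"
proof -
  have "sqrt ((\<bar>z$l\<bar> powr (1 / real (\<kappa> l)))\<^sup>2) \<le> knorm \<kappa> z"
    unfolding knorm_alt by (intro real_sqrt_le_mono member_le_sum) auto
  then have "\<bar>z$l\<bar> powr (1 / real (\<kappa> l)) \<le> knorm \<kappa> z" by simp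
  then have "(\<bar>z$l\<bar> powr (1 / real (\<kappa> l))) ^ \<kappa> l \<le> knorm \<kappa> z ^ \<kappa> l" by (rule power_mono) simp
  moreover have "(\<bar>z$l\<bar> powr (1 / real (\<kappa> l))) ^ \<kappa> l = \<bar>z$l\<bar>"
    using assms by (cases "z$l = 0") (auto simp: powr_powr simp flip: powr_realpow)
  ultimately show ?thesis by simp
qed

lemma knorm_le:
  fixes z :: "real^'n::finite"
  assumes "\<And>l. 1 \<le> \<kappa> l"
  shows "knorm \<kappa> z \<le> real CARD('n) * (1 + norm z)"
proof -
  have "knorm \<kappa> z \<le> (\<Sum>l\<in>UNIV. \<bar>z$l\<bar> powr (1 / real (\<kappa> l)))"
    using L2_set_le_sum[of UNIV "\<lambda>l. \<bar>z$l\<bar> powr (1 / real (\<kappa> l))"] by (simp add: knorm_alt L2_set_def)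
  also have "\<dots> \<le> (\<Sum>l\<in>(UNIV::'n set). 1 + norm z)"
  proof (rule sum_mono)
    fix l
    have "\<bar>z$l\<bar> powr (1 / real (\<kappa> l)) \<le> (1 + norm z) powr (1 / real (\<kappa> l))"
      using component_le_norm_cart[of z l] by (intro powr_mono2) auto
    also have "\<dots> \<le> (1 + norm z) powr 1" using assms[of l] by (intro powr_mono) auto
    finally show "\<bar>z$l\<bar> powr (1 / real (\<kappa> l)) \<le> 1 + norm z" by simp
  qed
  finally show ?thesis by simp
qed

lemma knorm_dil:
  assumes "\<And>l. 1 \<le> \<kappa> l" "0 \<le> s"
  shows "knorm \<kappa> (dil \<kappa> s z) = s * knorm \<kappa> z"
proof -
  have "\<bar>dil \<kappa> s z $ l\<bar> powr (1 / real (\<kappa> l)) = s * \<bar>z$l\<bar> powr (1 / real (\<kappa> l))" for l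
    using assms by (simp add: abs_mult powr_mult powr_inverse_power)
  then have "knorm \<kappa> (dil \<kappa> s z) = sqrt (s\<^sup>2 * (\<Sum>l\<in>UNIV. (\<bar>z$l\<bar> powr (1 / real (\<kappa> l)))\<^sup>2))"
    by (simp add: knorm_alt power_mult_distrib sum_distrib_left)
  then show ?thesis using assms by (simp add: knorm_alt real_sqrt_mult)
qed

text \<open>The straight step z = (x - y) / t^D is no longer in any coordinate than x - y dilated by
  1/t, hence has anisotropic length at most \<rho>, and t^D such steps lead from y to x. The power D
  pays for the coordinates on which the dilation acts most strongly.\<close>

lemma modulus_chain:
  fixes f :: "real^'n::finite \<Rightarrow> complex"
  assumes k: "\<And>l. 1 \<le> \<kappa> l" and D: "\<And>l. \<kappa> l \<le> D" and t: "1 \<le> t"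
    and w: "\<And>x y. knorm \<kappa> (x - y) \<le> \<rho> \<Longrightarrow> norm (f x - f y) \<le> w"
    and xy: "knorm \<kappa> (x - y) \<le> real t * \<rho>"
  shows "norm (f x - f y) \<le> real t ^ D * w"
proof -
  define z where "z = (1 / real t ^ D) *\<^sub>R (x - y)"
  have "knorm \<kappa> z \<le> knorm \<kappa> (dil \<kappa> (1 / real t) (x - y))"
  proof (rule knorm_mono)
    fix l
    have "(1 / real t) ^ D \<le> (1 / real t) ^ \<kappa> l" using D t by (intro power_decreasing) auto
    then show "\<bar>z$l\<bar> \<le> \<bar>dil \<kappa> (1 / real t) (x - y) $ l\<bar>"
      using t by (simp add: z_def abs_mult mult_right_mono divide_inverse power_inverse del: vector_minus_component)
  qed
  also have "\<dots> = 1 / real t * knorm \<kappa> (x - y)" using k by (rule knorm_dil) simp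
  also have "\<dots> \<le> \<rho>" using xy t by (simp add: field_simps)
  finally have z: "knorm \<kappa> z \<le> \<rho>" .
  have "norm (f (y + real j *\<^sub>R z) - f y) \<le> real j * w" for j
  proof (induction j)
    case (Suc j)
    have "norm (f (y + real (Suc j) *\<^sub>R z) - f (y + real j *\<^sub>R z)) \<le> w"
      by (rule w) (use z in \<open>simp add: algebra_simps\<close>)
    then show ?case using Suc norm_triangle_ineq[of "f (y + real (Suc j) *\<^sub>R z) - f (y + real j *\<^sub>R z)" "f (y + real j *\<^sub>R z) - f y"]
      by (simp add: algebra_simps)
  qed simp
  from this[of "t ^ D"] show ?thesis using t by (simp add: z_def)
qed

text \<open>Control of the modulus at the single scale s yields polynomial growth of the rescaled
  increments. Its order D is the D in the weight 2 n + D of the kernel bounds.\<close>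

lemma modulus_dil:
  fixes f :: "real^'n::finite \<Rightarrow> complex"
  assumes k: "\<And>l. 1 \<le> \<kappa> l" and D: "\<And>l. \<kappa> l \<le> D" and s: "s > 0"
    and w: "\<And>x y. knorm \<kappa> (x - y) \<le> s \<Longrightarrow> norm (f x - f y) \<le> w"
  shows "norm (f (x + dil \<kappa> s y) - f x) \<le> (real CARD('n) + 2) ^ D * w * (1 + norm y) ^ D"
proof -
  \<comment> \<open>An integer at least 1 that lies between the anisotropic length of y and that
    length plus 2; this 2 is the one in n + 2.\<close>
  define t where "t = nat \<lceil>knorm \<kappa> y\<rceil> + 1"
  have t1: "knorm \<kappa> y \<le> real t" "real t \<le> knorm \<kappa> y + 2" unfolding t_def using knorm_nonneg[of \<kappa> y] by linarith+
  have tt: "real t \<le> (real CARD('n) + 2) * (1 + norm y)"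
  proof -
    have "real t \<le> real CARD('n) * (1 + norm y) + 2 * 1" using t1 knorm_le[of \<kappa> y, OF k] by linarith
    also have "\<dots> \<le> real CARD('n) * (1 + norm y) + 2 * (1 + norm y)" by (intro add_left_mono mult_left_mono) auto
    finally show ?thesis by (simp only: distrib_right)
  qed
  have w0: "0 \<le> w" using w[of x x] s by (simp add: knorm_alt)
  have "norm (f (x + dil \<kappa> s y) - f x) \<le> real t ^ D * w"
  proof (rule modulus_chain[OF k D _ w])
    show "1 \<le> t" by (simp add: t_def)
    show "knorm \<kappa> (x + dil \<kappa> s y - x) \<le> real t * s"
      using t1 s by (simp add: knorm_dil[OF k] mult.commute)
  qed
  also have "\<dots> \<le> ((real CARD('n) + 2) * (1 + norm y)) ^ D * w"
    by (intro mult_right_mono power_mono tt w0) auto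
  finally show ?thesis by (simp add: power_mult_distrib mult_ac)
qed

lemma dil_add: "dil \<kappa> s (x + y) = dil \<kappa> s x + dil \<kappa> s y"
  by (simp add: vec_eq_iff algebra_simps)

lemma dil_dil_inverse: "s \<noteq> 0 \<Longrightarrow> dil \<kappa> s (dil \<kappa> (inverse s) x) = x"
  by (simp add: vec_eq_iff power_inverse)

lemma growth_dil:
  fixes f :: "real^'n::finite \<Rightarrow> complex"
  assumes "\<And>x. norm (f x) \<le> Cf * (1 + norm x) ^ N"
  shows "\<exists>C. \<forall>y. norm (f (x + dil \<kappa> s y)) \<le> C * (1 + norm y) ^ N"
proof -
  have Cf: "0 \<le> Cf" using order_trans[OF norm_ge_zero assms[of 0]] by simp
  have "bounded_linear (dil \<kappa> s :: real^'n \<Rightarrow> real^'n)"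
    by (intro linear_conv_bounded_linear[THEN iffD1] linearI) (auto simp: vec_eq_iff algebra_simps)
  then obtain L where L: "L > 0" "\<And>y::real^'n. norm (dil \<kappa> s y) \<le> norm y * L" using bounded_linear.pos_bounded by blast
  have "norm (f (x + dil \<kappa> s y)) \<le> (Cf * (1 + norm x) ^ N * (1 + L) ^ N) * (1 + norm y) ^ N" for y
  proof -
    have "(1 + norm (x + dil \<kappa> s y)) ^ N \<le> (1 + norm x) ^ N * (1 + norm (dil \<kappa> s y)) ^ N" by (rule peetre_power)
    also have "(1 + norm (dil \<kappa> s y)) ^ N \<le> ((1 + L) * (1 + norm y)) ^ N"
      using L(2)[of y] L(1) norm_ge_zero[of y] by (intro power_mono) (auto simp: algebra_simps intro: order_trans)
    finally have "(1 + norm (x + dil \<kappa> s y)) ^ N \<le> (1 + norm x) ^ N * ((1 + L) ^ N * (1 + norm y) ^ N)"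
      by (simp add: power_mult_distrib mult_left_mono)
    from order_trans[OF assms[of "x + dil \<kappa> s y"] mult_left_mono[OF this Cf]] show ?thesis by (simp add: mult_ac)
  qed
  then show ?thesis by blast
qed

text \<open>Mean zero of the kernel allows f to be replaced by its increment from f x. For far
  points the increment is integrated against k itself. For near points the translation is moved onto
  the kernel, and the increment is integrated against a difference of translates of k, which is
  small by the mean value inequality. Of the weight 2 n + D, the part 2 n makes the integrals
  converge and D absorbs the growth of the increments.\<close>

lemma kernel_estimate:
  fixes f k :: "real^'n::finite \<Rightarrow> complex"
  assumes \<kappa>: "\<And>l. 1 \<le> \<kappa> l" and D: "\<And>l. \<kappa> l \<le> D" and s: "s > 0"
    and f: "continuous_on UNIV f" "\<And>x. norm (f x) \<le> Cf * (1 + norm x) ^ N"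
    and w: "\<And>x y. knorm \<kappa> (x - y) \<le> s \<Longrightarrow> norm (f x - f y) \<le> w"
    and k: "rapid k" "(\<integral>y. k y \<partial>lborel) = 0" and M: "\<And>y. (1 + norm y) ^ (2 * CARD('n) + D) * norm (k y) \<le> M"
    and k': "\<And>i. has_pd k i (k' i)" and M': "\<And>i y. (1 + norm y) ^ (2 * CARD('n) + D) * norm (k' i y) \<le> M"
  shows "norm ((\<integral>y. f (x + dil \<kappa> s y) * k y \<partial>lborel) - (\<integral>y. f (x' + dil \<kappa> s y) * k y \<partial>lborel))
    \<le> ((2 + real CARD('n) * (1 + real CARD('n)) ^ (2 * CARD('n) + D)) * (real CARD('n) + 2) ^ D * wint TYPE('n)) * M
        * min 1 (knorm \<kappa> (x - x') / s) * w"
proof -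
  define n where "n = real CARD('n)"
  define P where "P = 2 * CARD('n) + D"
  define E where "E = (n + 2) ^ D"
  define I where "I = wint TYPE('n)"
  have I0: "I \<ge> 0" unfolding I_def by (rule wint_nonneg)
  have n0: "n \<ge> 0" by (simp add: n_def)
  have E0: "E \<ge> 0" by (simp add: E_def n_def)
  have M0: "M \<ge> 0" using order_trans[OF _ M[of 0]] by simp
  have w0: "0 \<le> w" using w[of x x] s by (simp add: knorm_alt)
  have fm [measurable]: "f \<in> borel_measurable borel" by (rule borel_measurable_continuous_onI[OF f(1)])
  have km [measurable]: "k \<in> borel_measurable borel" by (rule rapid_measurable[OF k(1)])
  define K where "K x = (\<integral>y. f (x + dil \<kappa> s y) * k y \<partial>lborel)" for x
  have int: "integrable lborel (\<lambda>y. f (x + dil \<kappa> s y) * k y)" for x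
  proof -
    obtain C where "\<And>y. norm (f (x + dil \<kappa> s y)) \<le> C * (1 + norm y) ^ N" using growth_dil[OF f(2)] by metis
    then show ?thesis by (intro rapid_mult_growth[OF k(1)]) auto
  qed
  have ki: "integrable lborel k" by (rule rapid_integrable[OF k(1)])
  have md: "norm (f (x + dil \<kappa> s y) - f x) \<le> E * w * (1 + norm y) ^ D" for x y
    unfolding E_def n_def by (rule modulus_dil[OF \<kappa> D s w])
  have est: "norm (\<integral>y. (f (x + dil \<kappa> s y) - f x) * q y \<partial>lborel) \<le> (E * w * B) * I"
    if q: "q \<in> borel_measurable borel" "\<And>y. (1 + norm y) ^ P * norm (q y) \<le> B" for q x B
    unfolding I_def
  proof (rule weight_dominated(2))
    show "(\<lambda>y. (f (x + dil \<kappa> s y) - f x) * q y) \<in> borel_measurable borel" using q(1) by measurable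
    fix y
    have "(1 + norm y) ^ (2 * CARD('n)) * norm ((f (x + dil \<kappa> s y) - f x) * q y)
      \<le> (1 + norm y) ^ (2 * CARD('n)) * ((E * w * (1 + norm y) ^ D) * norm (q y))"
      unfolding norm_mult by (intro mult_left_mono mult_right_mono md) auto
    also have "\<dots> = E * w * ((1 + norm y) ^ P * norm (q y))" by (simp add: P_def power_add mult_ac)
    also have "\<dots> \<le> E * w * B" by (intro mult_left_mono q mult_nonneg_nonneg E0 w0)
    finally show "(1 + norm y) ^ (2 * CARD('n)) * norm ((f (x + dil \<kappa> s y) - f x) * q y) \<le> E * w * B" .
  qed
  have K1: "norm (K x) \<le> (E * w * M) * I" for x
  proof -
    have "K x = (\<integral>y. f (x + dil \<kappa> s y) * k y \<partial>lborel) - f x * (\<integral>y. k y \<partial>lborel)" by (simp add: K_def k)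
    also have "\<dots> = (\<integral>y. f (x + dil \<kappa> s y) * k y - f x * k y \<partial>lborel)"
      using int ki by (subst Bochner_Integration.integral_diff) auto
    also have "\<dots> = (\<integral>y. (f (x + dil \<kappa> s y) - f x) * k y \<partial>lborel)" by (simp add: algebra_simps)
    finally show ?thesis using est[OF km M[folded P_def]] by simp
  qed
  have K2: "norm (K x' - K x) \<le> (E * w * (n * knorm \<kappa> z * ((1 + n) ^ P * M))) * I"
    if z: "z = dil \<kappa> (inverse s) (x' - x)" "knorm \<kappa> z \<le> 1" for z
  proof -
    \<comment> \<open>In rescaled coordinates the displacement is z. Its coordinates are at most
      \<open>knorm \<kappa> z\<close>, because that number is at most 1 and the exponents \<kappa>
      are at least 1.\<close>
    have x': "x' = x + dil \<kappa> s z" using s by (simp add: z dil_dil_inverse)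
    have zl: "\<bar>z$l\<bar> \<le> knorm \<kappa> z" for l
    proof -
      have "\<bar>z$l\<bar> \<le> knorm \<kappa> z ^ \<kappa> l" by (rule coordinate_le_knorm[OF \<kappa>])
      also have "\<dots> \<le> knorm \<kappa> z ^ 1" using z(2) \<kappa> by (intro power_decreasing) auto
      finally show ?thesis by simp
    qed
    have z1: "(\<Sum>l\<in>UNIV. \<bar>z$l\<bar>) \<le> n * knorm \<kappa> z" using sum_bounded_above[of UNIV "\<lambda>l. \<bar>z$l\<bar>" "knorm \<kappa> z"] zl by (simp add: n_def)
    also have "\<dots> \<le> n * 1" by (intro mult_left_mono z n0)
    finally have zn: "(\<Sum>l\<in>UNIV. \<bar>z$l\<bar>) \<le> n" by simp
    \<comment> \<open>The difference q inherits mean zero from k, so f x may be subtracted once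
      more.\<close>
    define q where "q y = k (- z + y) - k y" for y
    have qm: "q \<in> borel_measurable borel" unfolding q_def by measurable
    have kzi: "integrable lborel (\<lambda>y. k (- z + y))" unfolding lborel_translate(2)[OF km] by (rule ki)
    have kz0: "(\<integral>y. k (- z + y) \<partial>lborel) = 0" unfolding lborel_translate(1)[OF km] by (rule k(2))
    have fz: "(\<integral>y. f (x + dil \<kappa> s y) * k (- z + y) \<partial>lborel) = K x'"
      "integrable lborel (\<lambda>y. f (x + dil \<kappa> s y) * k (- z + y))"
    proof -
      have m: "(\<lambda>y. f (x + dil \<kappa> s y) * k (- z + y)) \<in> borel_measurable borel" by measurable
      have e: "(\<lambda>y. f (x + dil \<kappa> s (z + y)) * k (- z + (z + y))) = (\<lambda>y. f (x' + dil \<kappa> s y) * k y)"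
        by (simp add: x' dil_add algebra_simps)
      show "(\<integral>y. f (x + dil \<kappa> s y) * k (- z + y) \<partial>lborel) = K x'"
        using lborel_translate(1)[OF m, of z] by (simp only: e K_def)
      show "integrable lborel (\<lambda>y. f (x + dil \<kappa> s y) * k (- z + y))"
        using lborel_translate(2)[OF m, of z] int[of x'] by (simp only: e)
    qed
    have "K x' - K x = (\<integral>y. f (x + dil \<kappa> s y) * k (- z + y) \<partial>lborel) - (\<integral>y. f (x + dil \<kappa> s y) * k y \<partial>lborel)
         - f x * ((\<integral>y. k (- z + y) \<partial>lborel) - (\<integral>y. k y \<partial>lborel))"
      unfolding fz(1) kz0 k(2) by (simp add: K_def)
    also have "\<dots> = (\<integral>y. (f (x + dil \<kappa> s y) * k (- z + y) - f (x + dil \<kappa> s y) * k y) - f x * (k (- z + y) - k y) \<partial>lborel)"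
      using fz(2) int kzi ki by simp
    also have "\<dots> = (\<integral>y. (f (x + dil \<kappa> s y) - f x) * q y \<partial>lborel)" by (simp add: q_def algebra_simps)
    finally have e: "K x' - K x = (\<integral>y. (f (x + dil \<kappa> s y) - f x) * q y \<partial>lborel)" .
    have "(1 + norm y) ^ P * norm (q y) \<le> n * knorm \<kappa> z * ((1 + n) ^ P * M)" for y
    proof -
      \<comment> \<open>All points met by the mean value inequality lie within n of y; moving the
        weight from them to y costs (1 + n)^P by Peetre's inequality, the origin of that factor in
        the constant.\<close>
      define Bd where "Bd = (1 + n) ^ P * M / (1 + norm y) ^ P"
      have "norm (k (y + (- z)) - k y) \<le> (\<Sum>l\<in>UNIV. \<bar>(- z)$l\<bar>) * Bd"
      proof (rule coordinate_mean_value[OF k'])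
        fix i y' assume "norm (y' - y) \<le> (\<Sum>l\<in>UNIV. \<bar>(- z)$l\<bar>)"
        then have "norm (y - y') \<le> n" using zn by (simp add: norm_minus_commute)
        then have "(1 + norm (y - y')) ^ P \<le> (1 + n) ^ P" by (intro power_mono) auto
        then have "(1 + norm y) ^ P * norm (k' i y') \<le> ((1 + norm y') ^ P * (1 + n) ^ P) * norm (k' i y')"
          using peetre_power[of y' "y - y'" P]
          by (intro mult_right_mono) (auto intro: order_trans mult_left_mono)
        also have "\<dots> = (1 + n) ^ P * ((1 + norm y') ^ P * norm (k' i y'))" by simp
        also have "\<dots> \<le> (1 + n) ^ P * M" using M'[of y' i] n0 by (intro mult_left_mono) (auto simp: P_def)
        finally show "norm (k' i y') \<le> Bd" by (simp add: Bd_def field_simps)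
      qed
      also have "\<dots> \<le> (n * knorm \<kappa> z) * Bd"
        using z1 M0 n0 by (intro mult_right_mono) (auto simp: Bd_def)
      finally have "norm (q y) \<le> (n * knorm \<kappa> z) * Bd" by (simp add: q_def add.commute)
      then show ?thesis by (simp add: Bd_def field_simps)
    qed
    from est[OF qm this] show ?thesis unfolding e .
  qed
  define d where "d = knorm \<kappa> (x - x')"
  have d0: "d \<ge> 0" by (simp add: d_def)
  define G where "G = n * (1 + n) ^ P"
  have G0: "G \<ge> 0" by (simp add: G_def n0)
  \<comment> \<open>The summand 2 covers far points, where both values are bounded separately; G
    covers near points.\<close>
  have "norm (K x - K x') \<le> ((2 + G) * E * I) * M * min 1 (d / s) * w"
  proof (cases "d / s \<le> 1")
    case True
    define z where "z = dil \<kappa> (inverse s) (x' - x)"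
    have kz: "knorm \<kappa> z = d / s"
      using s knorm_minus[of \<kappa> "x - x'"] by (simp add: z_def knorm_dil[OF \<kappa>] d_def divide_inverse mult.commute)
    have "norm (K x - K x') \<le> (E * w * (n * (d / s) * ((1 + n) ^ P * M))) * I"
      using K2[OF z_def] True by (simp add: kz norm_minus_commute)
    also have "\<dots> = (G * E * I) * M * (d / s) * w" by (simp add: G_def mult_ac)
    also have "\<dots> \<le> ((2 + G) * E * I) * M * (d / s) * w"
      using E0 I0 M0 w0 d0 s by (intro mult_right_mono) auto
    finally show ?thesis using True by simp
  next
    case False
    have "norm (K x - K x') \<le> (E * w * M) * I + (E * w * M) * I"
      using norm_triangle_ineq4[of "K x" "K x'"] K1[of x] K1[of x'] by linarith
    also have "\<dots> = (2 * E * I) * M * 1 * w" by simp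
    also have "\<dots> \<le> ((2 + G) * E * I) * M * 1 * w"
      using E0 I0 M0 w0 G0 by (intro mult_right_mono) auto
    finally show ?thesis using False by simp
  qed
  then show ?thesis by (simp add: K_def G_def n_def P_def E_def I_def d_def)
qed

section \<open>Multipliers built from the symbol\<close>

definition imon :: "'n::finite mindex \<Rightarrow> real^'n \<Rightarrow> complex" where
  "imon \<gamma> \<xi> = (\<Prod>i\<in>UNIV. (\<i> * complex_of_real (\<xi>$i)) ^ \<gamma> i)"

lemma imon_madd: "imon (madd \<alpha> \<beta>) \<xi> = imon \<alpha> \<xi> * imon \<beta> \<xi>"
  by (simp add: imon_def madd_def power_add prod.distrib)

lemma imon_dil: "imon \<gamma> (dil \<kappa> s \<xi>) = of_real (s ^ mdot \<gamma> \<kappa>) * imon \<gamma> \<xi>"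
proof -
  have "(\<i> * complex_of_real (dil \<kappa> s \<xi> $ i)) ^ \<gamma> i = of_real (s ^ (\<gamma> i * \<kappa> i)) * (\<i> * complex_of_real (\<xi>$i)) ^ \<gamma> i" for i
    by (simp add: power_mult_distrib power_mult[symmetric] mult.commute[of "\<kappa> i"])
  then show ?thesis by (simp add: imon_def mdot_def power_sum prod.distrib)
qed

lemma imon_minus: "imon \<gamma> (- \<xi>) = (-1) ^ mlen \<gamma> * imon \<gamma> \<xi>"
proof -
  have "(\<i> * complex_of_real ((- \<xi>) $ i)) ^ \<gamma> i = (-1) ^ \<gamma> i * (\<i> * complex_of_real (\<xi>$i)) ^ \<gamma> i" for i
    by (simp add: power_mult_distrib[symmetric])
  then show ?thesis by (simp add: imon_def mlen_def power_sum prod.distrib)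
qed

lemma continuous_on_imon: "continuous_on S (imon \<gamma>)"
  unfolding imon_def by (intro continuous_intros)

lemma smooth_fn_imon: "smooth_fn (imon \<gamma>)"
  unfolding imon_def[abs_def] smooth_fn_usmooth
  by (intro usmooth_prod usmooth_power usmooth_mult usmooth_const)
     (auto simp: smooth_fn_usmooth[symmetric] smooth_fn_coord)

lemma idx_list: "distinct (idx_list :: 'n::finite list)" "set (idx_list :: 'n list) = UNIV"
proof -
  have "\<exists>xs::'n list. distinct xs \<and> set xs = UNIV" using finite_distinct_list[of "UNIV :: 'n set"] by auto
  from someI_ex[OF this] show "distinct (idx_list :: 'n list)" "set (idx_list :: 'n list) = UNIV"
    by (auto simp: idx_list_def)
qed

lemma monl_replicate: "monl (replicate k i) \<xi> = (\<i> * of_real (\<xi>$i)) ^ k"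
  by (induction k) auto

text \<open>The order of coordinates in \<open>idx_list\<close> is an arbitrary choice. It
  disappears on the frequency side, where the factors commute.\<close>

lemma monl_Dm: "monl (concat (map (\<lambda>i. replicate (\<gamma> i) i) idx_list)) = imon \<gamma>"
proof
  fix \<xi>
  have "monl (concat (map (\<lambda>i. replicate (\<gamma> i) i) xs)) \<xi> = (\<Prod>i\<leftarrow>xs. (\<i> * of_real (\<xi>$i)) ^ \<gamma> i)" for xs
    by (induction xs) (auto simp: monl_append monl_replicate)
  then show "monl (concat (map (\<lambda>i. replicate (\<gamma> i) i) idx_list)) \<xi> = imon \<gamma> \<xi>"
    using prod.distinct_set_conv_list[OF idx_list(1), of "\<lambda>i. (\<i> * of_real (\<xi>$i)) ^ \<gamma> i"]
    by (simp add: imon_def idx_list)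
qed

lemma Dm_conv_FT:
  assumes "\<phi> \<in> schwartz" "smooth_fn h" "csupp R h"
  shows "Dm \<gamma> (conv \<phi> (FT h)) = conv \<phi> (FT (\<lambda>\<xi>. imon \<gamma> \<xi> * h \<xi>))"
  unfolding Dm_def using assms
  by (simp add: Dlist_conv_right FT_schwartz Dlist_FT monl_Dm)

lemma csupp_dil:
  fixes h :: "real^'n::finite \<Rightarrow> complex"
  assumes "csupp R h" "s > 0"
  shows "\<exists>R'. csupp R' (\<lambda>\<xi>. h (dil \<kappa> s \<xi>))"
proof -
  have "bounded_linear (dil \<kappa> (inverse s) :: real^'n \<Rightarrow> real^'n)"
    by (intro linear_conv_bounded_linear[THEN iffD1] linearI) (auto simp: vec_eq_iff algebra_simps)
  then obtain L where L: "L > 0" "\<And>y::real^'n. norm (dil \<kappa> (inverse s) y) \<le> norm y * L" using bounded_linear.pos_bounded by blast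
  have "csupp (R * L) (\<lambda>\<xi>. h (dil \<kappa> s \<xi>))"
    unfolding csupp_def
  proof (intro conjI allI impI)
    show "continuous_on UNIV (\<lambda>\<xi>. h (dil \<kappa> s \<xi>))"
      using assms(1) by (auto simp: csupp_def intro!: continuous_on_compose2[of UNIV h] continuous_intros)
    fix \<xi> :: "real^'n" assume "R * L < norm \<xi>"
    also have "norm \<xi> = norm (dil \<kappa> (inverse s) (dil \<kappa> s \<xi>))"
      using dil_dil_inverse[of "inverse s" \<kappa> \<xi>] assms(2) by simp
    also have "\<dots> \<le> norm (dil \<kappa> s \<xi>) * L" by (rule L)
    finally show "h (dil \<kappa> s \<xi>) = 0" using L(1) assms(1) by (auto simp: csupp_def)
  qed
  then show ?thesis by blast
qed

text \<open>Dilating the multiplier by s rescales the kernel inversely. After the change of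
  variables the Jacobians cancel and the dilation acts on the argument of f.\<close>

lemma correlation_dil:
  fixes f :: "real^'n::finite \<Rightarrow> complex"
  assumes h: "csupp R h" and s: "s > 0" and f: "f \<in> borel_measurable borel"
  shows "(\<integral>y. f (x + y) * FT (\<lambda>\<xi>. h (dil \<kappa> s \<xi>)) y \<partial>lborel) = (\<integral>y. f (x + dil \<kappa> s y) * FT h y \<partial>lborel)"
proof -
  define S where "S = (\<Sum>l\<in>UNIV. \<kappa> l)"
  obtain R' where R': "csupp R' (\<lambda>\<xi>. h (dil \<kappa> s \<xi>))" using csupp_dil[OF h s] by blast
  have [measurable]: "FT (\<lambda>\<xi>. h (dil \<kappa> s \<xi>)) \<in> borel_measurable borel"
    by (rule borel_measurable_continuous_onI[OF FT_continuous[OF R']])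
  note [measurable] = f
  have m: "(\<lambda>y. f (x + y) * FT (\<lambda>\<xi>. h (dil \<kappa> s \<xi>)) y) \<in> borel_measurable borel" by measurable
  have "FT (\<lambda>\<xi>. h (dil \<kappa> s \<xi>)) (dil \<kappa> s y) = of_real (inverse s ^ S) * FT h y" for y
    unfolding FT_dil[OF h s] S_def using dil_dil_inverse[of "inverse s" \<kappa> y] s by simp
  then have "(\<integral>y. f (x + y) * FT (\<lambda>\<xi>. h (dil \<kappa> s \<xi>)) y \<partial>lborel)
     = of_real (s ^ S) * (\<integral>y. of_real (inverse s ^ S) * (f (x + dil \<kappa> s y) * FT h y) \<partial>lborel)"
    using lborel_dil[OF m s, of \<kappa>] by (simp add: S_def algebra_simps)
  then show ?thesis using s by (simp add: power_inverse)
qed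

lemma symb_alt: "symb A B a \<xi> = (\<Sum>\<alpha>\<in>A. \<Sum>\<beta>\<in>B. a \<alpha> \<beta> * imon (madd \<alpha> \<beta>) \<xi>)"
  by (simp add: symb_def imon_def)

lemma symb_dil:
  assumes "\<forall>\<alpha>\<in>A. \<forall>\<beta>\<in>B. mdot (madd \<alpha> \<beta>) \<kappa> = m"
  shows "symb A B a (dil \<kappa> s \<xi>) = of_real (s ^ m) * symb A B a \<xi>"
  unfolding symb_alt imon_dil sum_distrib_left using assms
  by (intro sum.cong refl) (simp add: mult_ac)

lemma linepoly_cmult_sum:
  assumes "finite J" "\<And>j. j \<in> J \<Longrightarrow> linepoly d (p j)"
  shows "linepoly d (\<lambda>x. \<Sum>j\<in>J. c j * p j x)"
  unfolding linepoly_def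
proof (intro allI)
  fix x i
  have "\<forall>j. \<exists>e. j \<in> J \<longrightarrow> (\<forall>t. p j (x + t *\<^sub>R axis i 1) = (\<Sum>k\<le>d. e k * complex_of_real t ^ k))"
    using assms(2) unfolding linepoly_def by metis
  then obtain e where e: "\<And>j t. j \<in> J \<Longrightarrow> p j (x + t *\<^sub>R axis i 1) = (\<Sum>k\<le>d. e j k * complex_of_real t ^ k)"
    by metis
  have "(\<Sum>j\<in>J. c j * p j (x + t *\<^sub>R axis i 1)) = (\<Sum>k\<le>d. (\<Sum>j\<in>J. c j * e j k) * complex_of_real t ^ k)" for t
  proof -
    have "(\<Sum>j\<in>J. c j * p j (x + t *\<^sub>R axis i 1)) = (\<Sum>j\<in>J. \<Sum>k\<le>d. c j * e j k * complex_of_real t ^ k)"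
      by (intro sum.cong refl) (simp add: e sum_distrib_left mult.assoc)
    also have "\<dots> = (\<Sum>k\<le>d. \<Sum>j\<in>J. c j * e j k * complex_of_real t ^ k)" by (rule sum.swap)
    finally show ?thesis by (simp add: sum_distrib_right)
  qed
  then show "\<exists>e. \<forall>t. (\<Sum>j\<in>J. c j * p j (x + t *\<^sub>R axis i 1)) = (\<Sum>k\<le>d. e k * complex_of_real t ^ k)"
    by (intro exI[of _ "\<lambda>k. \<Sum>j\<in>J. c j * e j k"]) auto
qed

text \<open>Along a coordinate line only the factor of that coordinate varies, and the binomial
  theorem expands it.\<close>

lemma linepoly_imon:
  assumes "\<And>i. \<gamma> i \<le> d"
  shows "linepoly d (\<lambda>\<xi>. imon \<gamma> (- \<xi>))"
  unfolding linepoly_def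
proof (intro allI)
  fix x :: "real^'a" and i
  define Q where "Q = (\<Prod>l\<in>UNIV - {i}. (\<i> * complex_of_real (- x$l)) ^ \<gamma> l)"
  define b where "b = \<i> * complex_of_real (- x$i)"
  have "imon \<gamma> (- (x + t *\<^sub>R axis i 1)) = (\<Sum>k\<le>d. (Q * (of_nat (\<gamma> i choose k) * (- \<i>) ^ k * b ^ (\<gamma> i - k))) * complex_of_real t ^ k)" for t
  proof -
    have "imon \<gamma> (- (x + t *\<^sub>R axis i 1)) = (\<i> * complex_of_real ((- (x + t *\<^sub>R axis i 1)) $ i)) ^ \<gamma> i * Q"
      unfolding imon_def Q_def by (subst prod.remove[of _ i]) (auto intro!: prod.cong simp: axis_def)
    also have "(\<i> * complex_of_real ((- (x + t *\<^sub>R axis i 1)) $ i)) ^ \<gamma> i = (- \<i> * of_real t + b) ^ \<gamma> i"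
      by (rule arg_cong[where f="\<lambda>z. z ^ \<gamma> i"]) (simp add: b_def axis_def algebra_simps)
    also have "\<dots> = (\<Sum>k\<le>\<gamma> i. of_nat (\<gamma> i choose k) * (- \<i> * of_real t) ^ k * b ^ (\<gamma> i - k))"
      by (rule binomial_ring)
    also have "\<dots> = (\<Sum>k\<le>d. of_nat (\<gamma> i choose k) * (- \<i> * of_real t) ^ k * b ^ (\<gamma> i - k))"
      using assms[of i] by (intro sum.mono_neutral_left) auto
    finally show ?thesis unfolding power_mult_distrib[of "- \<i>"] by (simp add: sum_distrib_right sum_distrib_left mult_ac)
  qed
  then show "\<exists>c. \<forall>t. imon \<gamma> (- (x + t *\<^sub>R axis i 1)) = (\<Sum>k\<le>d. c k * complex_of_real t ^ k)"
    by (intro exI[of _ "\<lambda>k. Q * (of_nat (\<gamma> i choose k) * (- \<i>) ^ k * b ^ (\<gamma> i - k))"]) auto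
qed

text \<open>The index set of the uniform families: a bound uniform over it does not depend on the
  coefficients.\<close>

definition adm :: "('n::finite \<Rightarrow> nat) \<Rightarrow> 'n mindex set \<Rightarrow> 'n mindex set \<Rightarrow> nat \<Rightarrow> real \<Rightarrow> real \<Rightarrow> ('n mindex \<Rightarrow> 'n mindex \<Rightarrow> complex) set" where
  "adm \<kappa> A B m lam Lam = {a. \<forall>\<xi>. lam * knorm \<kappa> \<xi> ^ m \<le> norm (symb A B a \<xi>) \<and> norm (symb A B a \<xi>) \<le> Lam * knorm \<kappa> \<xi> ^ m}"

text \<open>A globally smooth version of \<open>\<chi>(\<xi>) / p(-\<xi>)\<close>: the summand \<open>flatexp\<close> vanishes on the support of
  \<open>\<chi>\<close> and keeps the denominator positive near the origin, where \<open>p\<close> may vanish.\<close>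

definition Esym :: "('n::finite \<Rightarrow> nat) \<Rightarrow> 'n mindex set \<Rightarrow> 'n mindex set \<Rightarrow> ('n mindex \<Rightarrow> 'n mindex \<Rightarrow> complex) \<Rightarrow> real^'n \<Rightarrow> complex" where
  "Esym \<kappa> A B a \<xi> = chi \<kappa> \<xi> * (cnj (symb A B a (- \<xi>)) *
     inverse (symb A B a (- \<xi>) * cnj (symb A B a (- \<xi>)) + of_real (flatexp 0 (1 + (-1) * (norm \<xi>)\<^sup>2))))"

text \<open>Were \<open>knorm \<kappa> \<xi>\<close> smaller, it would be at most 1, so it would
  bound each coordinate, and n times it would bound the Euclidean norm. Away from the origin this
  turns ellipticity into a positive lower bound for p.\<close>

lemma knorm_lower:
  fixes \<xi> :: "real^'n::finite"
  assumes "\<And>l. 1 \<le> \<kappa> l" "1/2 \<le> norm \<xi>"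
  shows "1 / (2 * real CARD('n)) \<le> knorm \<kappa> \<xi>"
proof (rule ccontr)
  assume "\<not> ?thesis"
  then have k: "knorm \<kappa> \<xi> < 1 / (2 * real CARD('n))" by simp
  have "real 1 \<le> real CARD('n)" by (rule of_nat_mono) (simp add: Suc_le_eq)
  then have "1 \<le> 2 * real CARD('n)" by linarith
  then have "1 / (2 * real CARD('n)) \<le> 1" by simp
  then have k1: "knorm \<kappa> \<xi> \<le> 1" using k by linarith
  have "\<bar>\<xi>$l\<bar> \<le> knorm \<kappa> \<xi>" for l
  proof -
    have "\<bar>\<xi>$l\<bar> \<le> knorm \<kappa> \<xi> ^ \<kappa> l" by (rule coordinate_le_knorm[OF assms(1)])
    also have "\<dots> \<le> knorm \<kappa> \<xi> ^ 1" using k1 assms(1) by (intro power_decreasing) auto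
    finally show ?thesis by simp
  qed
  then have "norm \<xi> \<le> real CARD('n) * knorm \<kappa> \<xi>"
    using norm_le_l1_cart[of \<xi>] sum_bounded_above[of UNIV "\<lambda>l. \<bar>\<xi>$l\<bar>" "knorm \<kappa> \<xi>"] by simp
  also have "\<dots> < 1/2" using k by (simp add: field_simps)
  finally show False using assms(2) by simp
qed

lemma exponent_le:
  assumes "\<And>l. 1 \<le> \<kappa> l" "mdot \<gamma> \<kappa> = m" shows "\<gamma> i \<le> m"
proof -
  have "\<gamma> i \<le> \<gamma> i * \<kappa> i" using assms(1)[of i] by simp
  also have "\<dots> \<le> mdot \<gamma> \<kappa>" unfolding mdot_def by (rule member_le_sum) auto
  finally show ?thesis using assms by simp
qed

text \<open>The two ellipticity bounds have separate duties: the upper one bounds the values of p on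
  balls; the lower one, helped near the origin by the flat summand, keeps the denominator above
  \<open>c\<close>.\<close>

lemma usmooth_Esym:
  fixes \<kappa> :: "'n::finite \<Rightarrow> nat"
  assumes \<kappa>: "\<And>l. 1 \<le> \<kappa> l" and fin: "finite A" "finite B"
    and hom: "\<forall>\<alpha>\<in>A. \<forall>\<beta>\<in>B. mdot (madd \<alpha> \<beta>) \<kappa> = m" and lam: "0 < lam"
  shows "usmooth (adm \<kappa> A B m lam Lam) (cball 0 R) (Esym \<kappa> A B)"
proof -
  let ?I = "adm \<kappa> A B m lam Lam" and ?K = "cball 0 R :: (real^'n) set"
  define P where "P a \<xi> = symb A B a (- \<xi>)" for a and \<xi> :: "real^'n"
  have P: "usmooth ?I ?K P"
  \<comment> \<open>\<open>Suc m\<close> in place of m, since the derivative formula asks for degree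
    at least 1 and m may be 0.\<close>
  proof (rule usmooth_linepoly[of "Suc m"])
    fix a assume "a \<in> ?I"
    have "linepoly (Suc m) (\<lambda>\<xi>. \<Sum>p\<in>A \<times> B. a (fst p) (snd p) * imon (madd (fst p) (snd p)) (- \<xi>))"
    proof (intro linepoly_cmult_sum linepoly_imon)
      fix p i assume "p \<in> A \<times> B"
      then show "madd (fst p) (snd p) i \<le> Suc m"
        using exponent_le[of \<kappa>, OF \<kappa>] hom by (auto intro: le_SucI)
    qed (use fin in auto)
    then show "linepoly (Suc m) (P a)" by (simp add: P_def[abs_def] symb_alt sum.cartesian_product case_prod_beta)
    show "continuous_on UNIV (P a)"
      unfolding P_def symb_def by (intro continuous_intros)
  next
    fix R
    have "norm (P a x) \<le> \<bar>Lam\<bar> * (real CARD('n) * (1 + R)) ^ m" if "a \<in> ?I" "norm x \<le> R" for a x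
    proof -
      have kn: "knorm \<kappa> x \<le> real CARD('n) * (1 + R)"
        by (rule order_trans[OF knorm_le[of \<kappa>, OF \<kappa>]]) (use that in auto)
      have "norm (P a x) \<le> Lam * knorm \<kappa> x ^ m"
        using that knorm_minus[of \<kappa> x] unfolding P_def adm_def by (metis (mono_tags, lifting) mem_Collect_eq)
      also have "\<dots> \<le> \<bar>Lam\<bar> * knorm \<kappa> x ^ m" by (intro mult_right_mono) auto
      also have "\<dots> \<le> \<bar>Lam\<bar> * (real CARD('n) * (1 + R)) ^ m" by (intro mult_left_mono power_mono kn) auto
      finally show ?thesis .
    qed
    then show "\<exists>M. \<forall>a\<in>?I. \<forall>x. norm x \<le> R \<longrightarrow> norm (P a x) \<le> M" by blast
  qed auto
  define th where "th \<xi> = flatexp 0 (1 + (-1) * (norm \<xi>)\<^sup>2)" for \<xi> :: "real^'n"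
  \<comment> \<open>exp (-2) bounds the flat summand from below on |\<xi>| \<le> 1/2; the other
    entry is the squared ellipticity bound outside that ball.\<close>
  define c where "c = min (exp (-2)) ((lam * (1 / (2 * real CARD('n))) ^ m)\<^sup>2)"
  have c0: "c > 0" using lam by (simp add: c_def)
  have low: "c \<le> (norm (P a \<xi>))\<^sup>2 + th \<xi>" if "a \<in> ?I" for a \<xi>
  proof (cases "norm \<xi> \<le> 1/2")
    case True
    have "(norm \<xi>)\<^sup>2 \<le> (1/2)\<^sup>2" using True by (intro power_mono) auto
    then have q: "1/2 \<le> 1 - (norm \<xi>)\<^sup>2" by (simp add: power2_eq_square)
    then have "1 / (1 - (norm \<xi>)\<^sup>2) \<le> 2" by (simp add: field_simps)
    then have "exp (-2) \<le> exp (- (1 / (1 - (norm \<xi>)\<^sup>2)))" by simp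
    also have "\<dots> = th \<xi>" using q by (simp add: th_def flatexp_def)
    finally show ?thesis unfolding c_def by (simp add: add_increasing min_le_iff_disj)
  next
    case False
    have "lam * (1 / (2 * real CARD('n))) ^ m \<le> lam * knorm \<kappa> \<xi> ^ m"
      using knorm_lower[of \<kappa>, OF \<kappa>, of \<xi>] False lam by (intro mult_left_mono power_mono) auto
    also have "\<dots> \<le> norm (P a \<xi>)"
      using that knorm_minus[of \<kappa> \<xi>] unfolding P_def adm_def by (metis (mono_tags, lifting) mem_Collect_eq)
    finally have "(lam * (1 / (2 * real CARD('n))) ^ m)\<^sup>2 \<le> (norm (P a \<xi>))\<^sup>2" using lam by (intro power_mono) auto
    then show ?thesis unfolding c_def using flatexp_nonneg[of 0] by (simp add: th_def add_increasing2 min_le_iff_disj)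
  qed
  have eq: "P a \<xi> * cnj (P a \<xi>) + of_real (th \<xi>) = of_real ((norm (P a \<xi>))\<^sup>2 + th \<xi>)" for a \<xi>
    by (simp only: complex_norm_square of_real_add)
  have "usmooth ?I ?K (\<lambda>a \<xi>. chi \<kappa> \<xi> * (cnj (P a \<xi>) * inverse (P a \<xi> * cnj (P a \<xi>) + of_real (th \<xi>))))"
  proof (intro usmooth_mult usmooth_inverse[where c=c] usmooth_add usmooth_cnj P)
    show "usmooth ?I ?K (\<lambda>a. chi \<kappa>)" by (intro usmooth_const_family smooth_fn_chi) auto
    show "usmooth ?I ?K (\<lambda>a \<xi>. of_real (th \<xi>))"
      unfolding th_def by (intro usmooth_const_family smooth_fn_flatexp) auto
    fix a and \<xi> :: "real^'n" assume a: "a \<in> ?I"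
    have "c \<le> norm (P a \<xi> * cnj (P a \<xi>) + of_real (th \<xi>))"
      unfolding eq norm_of_real using low[OF a, of \<xi>] by linarith
    then show "c \<le> norm (P a \<xi> * cnj (P a \<xi>) + of_real (th \<xi>))" "P a \<xi> * cnj (P a \<xi>) + of_real (th \<xi>) \<noteq> 0" using c0 by auto
  qed (rule c0)
  then show ?thesis by (simp add: P_def th_def Esym_def[abs_def])
qed

text \<open>For |\<xi>| \<le> 1 both sides vanish with \<open>chi\<close>; elsewhere the flat
  summand is zero and the quotient is exactly 1 / p(-\<xi>).\<close>

lemma Esym_mult_symb:
  assumes \<kappa>: "\<And>l. 1 \<le> \<kappa> l" and lam: "0 < lam" and a: "a \<in> adm \<kappa> A B m lam Lam"
  shows "symb A B a (- \<xi>) * Esym \<kappa> A B a \<xi> = chi \<kappa> \<xi>"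
proof (cases "norm \<xi> \<le> 1")
  case True
  then show ?thesis using chi_near_0[of \<kappa> \<xi>, OF \<kappa>] by (simp add: Esym_def)
next
  case False
  then have "1 \<le> (norm \<xi>)\<^sup>2" by simp
  then have t: "flatexp 0 (1 + (-1) * (norm \<xi>)\<^sup>2) = 0" by (intro flatexp_zero) auto
  have "0 < knorm \<kappa> (- \<xi>)" using knorm_lower[of \<kappa>, OF \<kappa>, of \<xi>] False
    by (simp add: order_less_le_trans[of 0 "1 / (2 * real CARD('a))"])
  then have "0 < lam * knorm \<kappa> (- \<xi>) ^ m" using lam by (simp del: knorm_minus)
  also have "\<dots> \<le> norm (symb A B a (- \<xi>))" using a by (auto simp: adm_def simp del: knorm_minus)
  finally have "symb A B a (- \<xi>) \<noteq> 0" by auto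
  then show ?thesis unfolding Esym_def t by (simp add: field_simps)
qed

lemma csupp_Esym:
  assumes \<kappa>: "\<And>l. 1 \<le> \<kappa> l" "\<And>l. \<kappa> l \<le> D" and fin: "finite A" "finite B"
    and hom: "\<forall>\<alpha>\<in>A. \<forall>\<beta>\<in>B. mdot (madd \<alpha> \<beta>) \<kappa> = m" and lam: "0 < lam" and a: "a \<in> adm \<kappa> A B m lam Lam"
  shows "csupp (2 * 2 ^ D) (Esym \<kappa> A B a)" "smooth_fn (Esym \<kappa> A B a)"
proof -
  show s: "smooth_fn (Esym \<kappa> A B a)"
    using usmooth_Esym[OF \<kappa>(1) fin hom lam, of Lam 0] a by (auto simp: usmooth_def)
  show "csupp (2 * 2 ^ D) (Esym \<kappa> A B a)"
    using smooth_fn_continuous[OF s, of "[]"] csupp_chi[of \<kappa> D, OF \<kappa>(2)] by (auto simp: csupp_def Esym_def)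
qed

lemma Esym_at_0: "(\<And>l. 1 \<le> \<kappa> l) \<Longrightarrow> Esym \<kappa> A B a 0 = 0"
  by (simp add: Esym_def chi_near_0)

text \<open>\<open>kernel_estimate\<close> asks for decay of the kernel and of its first partials.
  The latter are transforms of the multiplier times i and a coordinate, so the same decay argument
  covers them; adding absolute values merges the constants.\<close>

lemma kernel_bounds:
  fixes \<kappa> :: "'n::finite \<Rightarrow> nat"
  assumes \<kappa>: "\<And>l. 1 \<le> \<kappa> l" "\<And>l. \<kappa> l \<le> D" and fin: "finite A" "finite B"
    and hom: "\<forall>\<alpha>\<in>A. \<forall>\<beta>\<in>B. mdot (madd \<alpha> \<beta>) \<kappa> = m" and lam: "0 < lam"
  shows "\<exists>M. \<forall>a\<in>adm \<kappa> A B m lam Lam. \<forall>y. (1 + norm y) ^ k * norm (FT (\<lambda>\<xi>. imon \<gamma> \<xi> * Esym \<kappa> A B a \<xi>) y) \<le> M \<and>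
     (\<forall>i. (1 + norm y) ^ k * norm (FT (\<lambda>\<xi>. \<i> * of_real (\<xi>$i) * (imon \<gamma> \<xi> * Esym \<kappa> A B a \<xi>)) y) \<le> M)"
proof -
  let ?I = "adm \<kappa> A B m lam Lam" and ?R = "2 * 2 ^ D :: real"
  have dec: "\<exists>M. \<forall>a\<in>?I. \<forall>y. (1 + norm y) ^ k * norm (FT (\<lambda>\<xi>. g \<xi> * Esym \<kappa> A B a \<xi>) y) \<le> M"
    if g: "smooth_fn g" for g
  proof (rule FT_decay)
    show "usmooth ?I (cball 0 ?R) (\<lambda>a \<xi>. g \<xi> * Esym \<kappa> A B a \<xi>)"
      by (intro usmooth_mult usmooth_const_family g compact_cball usmooth_Esym[OF \<kappa>(1) fin hom lam])
    show "csupp ?R (\<lambda>\<xi>. g \<xi> * Esym \<kappa> A B a \<xi>)" if "a \<in> ?I" for a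
      using csupp_Esym[OF \<kappa> fin hom lam that] smooth_fn_continuous[OF g, of "[]"] by (intro csupp_mult) auto
  qed
  have g': "smooth_fn (\<lambda>\<xi>. \<i> * of_real (\<xi>$i) * imon \<gamma> \<xi>)" for i
  proof -
    have "smooth_fn (\<lambda>\<xi>. monl [i] \<xi> * imon \<gamma> \<xi>)" by (intro smooth_fn_mult smooth_fn_monl smooth_fn_imon)
    then show ?thesis by simp
  qed
  obtain M where M: "\<And>a y. a \<in> ?I \<Longrightarrow> (1 + norm y) ^ k * norm (FT (\<lambda>\<xi>. imon \<gamma> \<xi> * Esym \<kappa> A B a \<xi>) y) \<le> M"
    using dec[OF smooth_fn_imon] by blast
  have "\<forall>i. \<exists>M. \<forall>a\<in>?I. \<forall>y. (1 + norm y) ^ k * norm (FT (\<lambda>\<xi>. (\<i> * of_real (\<xi>$i) * imon \<gamma> \<xi>) * Esym \<kappa> A B a \<xi>) y) \<le> M"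
    using dec[OF g'] by blast
  from choice[OF this] obtain N where N: "\<forall>i. \<forall>a\<in>?I. \<forall>y. (1 + norm y) ^ k * norm (FT (\<lambda>\<xi>. (\<i> * of_real (\<xi>$i) * imon \<gamma> \<xi>) * Esym \<kappa> A B a \<xi>) y) \<le> N i"
    by (elim exE)
  have Ni: "N i \<le> \<bar>M\<bar> + (\<Sum>i\<in>UNIV. \<bar>N i\<bar>)" for i
    using member_le_sum[of i UNIV "\<lambda>i. \<bar>N i\<bar>"] by simp
  have Mi: "M \<le> \<bar>M\<bar> + (\<Sum>i\<in>UNIV. \<bar>N i\<bar>)"
    by (rule add_increasing2) (auto intro: sum_nonneg)
  show ?thesis
  proof (intro exI[of _ "\<bar>M\<bar> + (\<Sum>i\<in>UNIV. \<bar>N i\<bar>)"] ballI allI conjI)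
    fix a y assume a: "a \<in> ?I"
    show "(1 + norm y) ^ k * norm (FT (\<lambda>\<xi>. imon \<gamma> \<xi> * Esym \<kappa> A B a \<xi>) y) \<le> \<bar>M\<bar> + (\<Sum>i\<in>UNIV. \<bar>N i\<bar>)"
      using M[OF a, of y] Mi by linarith
    fix i
    have "(1 + norm y) ^ k * norm (FT (\<lambda>\<xi>. \<i> * of_real (\<xi>$i) * (imon \<gamma> \<xi> * Esym \<kappa> A B a \<xi>)) y) \<le> N i"
      using N a unfolding mult.assoc by blast
    then show "(1 + norm y) ^ k * norm (FT (\<lambda>\<xi>. \<i> * of_real (\<xi>$i) * (imon \<gamma> \<xi> * Esym \<kappa> A B a \<xi>)) y) \<le> \<bar>M\<bar> + (\<Sum>i\<in>UNIV. \<bar>N i\<bar>)"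
      using Ni[of i] by linarith
  qed
qed

section \<open>Finite sums in the Schwartz space and under tempered functionals\<close>

lemma schwartz_zero: "(\<lambda>x::real^'n::finite. 0) \<in> schwartz"
proof -
  have "Dlist ds (\<lambda>x::real^'n. 0) = (\<lambda>x. 0)" for ds
    by (induction ds) (auto simp: partial_def)
  then show ?thesis by (auto simp: schwartz_def smooth_fn_def)
qed

lemma schwartz_sum:
  assumes "finite J" "\<And>j. j \<in> J \<Longrightarrow> \<psi> j \<in> schwartz"
  shows "(\<lambda>x. \<Sum>j\<in>J. c j * \<psi> j x) \<in> schwartz"
  using assms
proof (induction J rule: finite_induct)
  case (insert j J)
  then have "(\<lambda>x. (\<Sum>j\<in>J. c j * \<psi> j x) + c j * \<psi> j x) \<in> schwartz" by (intro schwartz_add) auto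
  then show ?case using insert by (simp add: add.commute)
qed (simp add: schwartz_zero)

lemma schwartz_scale: "\<psi> \<in> schwartz \<Longrightarrow> (\<lambda>x. c * \<psi> x) \<in> schwartz"
  using schwartz_add[OF schwartz_zero, of \<psi> c] by simp

lemma tempered_sum:
  assumes u: "tempered u" and "finite J" "\<And>j. j \<in> J \<Longrightarrow> \<psi> j \<in> schwartz"
  shows "u (\<lambda>x. \<Sum>j\<in>J. c j * \<psi> j x) = (\<Sum>j\<in>J. c j * u (\<psi> j))"
  using assms(2,3)
proof (induction J rule: finite_induct)
  case empty
  have "\<forall>\<phi>\<in>schwartz. \<forall>c. u (\<lambda>x. c * \<phi> x) = c * u \<phi>" using u by (simp add: tempered_def)
  from bspec[OF this schwartz_zero, THEN spec, of 0] show ?case by simp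
next
  case (insert j J)
  have s: "(\<lambda>x. \<Sum>j\<in>J. c j * \<psi> j x) \<in> schwartz" using insert by (intro schwartz_sum) auto
  have p: "\<psi> j \<in> schwartz" using insert by auto
  have "u (\<lambda>x. c j * \<psi> j x + (\<Sum>j\<in>J. c j * \<psi> j x)) = u (\<lambda>x. c j * \<psi> j x) + u (\<lambda>x. \<Sum>j\<in>J. c j * \<psi> j x)"
  proof -
    have "\<forall>\<phi>\<in>schwartz. \<forall>\<psi>\<in>schwartz. u (\<lambda>x. \<phi> x + \<psi> x) = u \<phi> + u \<psi>" using u by (simp add: tempered_def)
    from bspec[OF bspec[OF this schwartz_scale[OF p]] s] show ?thesis by simp
  qed
  also have "u (\<lambda>x. c j * \<psi> j x) = c j * u (\<psi> j)" using u p by (simp add: tempered_def)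
  finally show ?case using insert by simp
qed

lemma conv_FT_sum:
  assumes \<phi>: "rapid \<phi>" and J: "finite J" "\<And>j. j \<in> J \<Longrightarrow> smooth_fn (h j)" "\<And>j. j \<in> J \<Longrightarrow> csupp R (h j)"
  shows "conv \<phi> (FT (\<lambda>\<xi>. \<Sum>j\<in>J. c j * h j \<xi>)) = (\<lambda>x. \<Sum>j\<in>J. c j * conv \<phi> (FT (h j)) x)"
proof
  fix x
  have "conv \<phi> (FT (\<lambda>\<xi>. \<Sum>j\<in>J. c j * h j \<xi>)) x = (\<integral>y. \<phi> (x - y) * (\<Sum>j\<in>J. c j * FT (h j) y) \<partial>lborel)"
    unfolding conv_def using FT_sum[OF J(1) J(3)] by simp
  also have "\<dots> = (\<integral>y. (\<Sum>j\<in>J. c j * (\<phi> (x - y) * FT (h j) y)) \<partial>lborel)"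
    by (simp add: sum_distrib_left mult_ac)
  also have "\<dots> = (\<Sum>j\<in>J. (\<integral>y. c j * (\<phi> (x - y) * FT (h j) y) \<partial>lborel))"
    by (intro Bochner_Integration.integral_sum integrable_mult_right conv_integrable \<phi> FT_rapid[OF J(2,3)])
  finally show "conv \<phi> (FT (\<lambda>\<xi>. \<Sum>j\<in>J. c j * h j \<xi>)) x = (\<Sum>j\<in>J. c j * conv \<phi> (FT (h j)) x)"
    by (simp add: conv_def)
qed

section \<open>Testing the equation with frequency-localised functions\<close>

lemma smooth_fn_const: "smooth_fn (\<lambda>_. c)"
  unfolding smooth_fn_usmooth by (rule usmooth_const)

lemma tempered_add:
  assumes "tempered u" "\<phi> \<in> schwartz" "\<psi> \<in> schwartz"
  shows "u (\<lambda>x. \<phi> x + c * \<psi> x) = u \<phi> + c * u \<psi>"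
proof -
  have "u (\<lambda>x. \<phi> x + (\<lambda>x. c * \<psi> x) x) = u \<phi> + u (\<lambda>x. c * \<psi> x)"
  proof -
    have "\<forall>\<phi>\<in>schwartz. \<forall>\<psi>\<in>schwartz. u (\<lambda>x. \<phi> x + \<psi> x) = u \<phi> + u \<psi>" using assms by (simp add: tempered_def)
    from bspec[OF bspec[OF this assms(2)] schwartz_scale[OF assms(3)]] show ?thesis .
  qed
  then show ?thesis using assms by (simp add: tempered_def)
qed

text \<open>The equation is tested with \<phi> convolved with the transform of (i \<xi>)^\<alpha>
  \<open>E1\<close>. On the left the symbol cancels the denominator and leaves \<open>chi\<close>.
  On the right (i \<xi>)^\<beta> completes the multiplier of the kernel, and by duality the
  convolution becomes a correlation with f.\<close>

lemma piece_identity: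
  fixes \<kappa> :: "'n::finite \<Rightarrow> nat" and u :: "(real^'n \<Rightarrow> complex) \<Rightarrow> complex"
  assumes \<kappa>: "\<And>l. 1 \<le> \<kappa> l" "\<And>l. \<kappa> l \<le> D" and fin: "finite A" "finite B"
    and hom: "\<forall>\<alpha>\<in>A. \<forall>\<beta>\<in>B. mdot (madd \<alpha> \<beta>) \<kappa> = m" and lam: "0 < lam" and a: "a \<in> adm \<kappa> A B m lam Lam"
    and u: "tempered u" and \<alpha>: "\<forall>\<beta>\<in>B. mdot (madd \<alpha> \<beta>) \<kappa> = m"
    and f: "\<And>\<beta>. \<beta> \<in> B \<Longrightarrow> continuous_on UNIV (f \<beta>)" "\<And>\<beta>. \<beta> \<in> B \<Longrightarrow> poly_growth (f \<beta>)"
    and pde: "\<And>\<phi>. \<phi> \<in> schwartz \<Longrightarrow> (\<Sum>\<alpha>\<in>A. \<Sum>\<beta>\<in>B. a \<alpha> \<beta> * distD (madd \<alpha> \<beta>) u \<phi>) = (\<Sum>\<beta>\<in>B. distD \<beta> (fun_dist (f \<beta>)) \<phi>)"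
    and \<phi>: "\<phi> \<in> schwartz" and s: "s > 0"
  shows "distD \<alpha> u (conv \<phi> (FT (\<lambda>\<xi>. chi \<kappa> (dil \<kappa> s \<xi>)))) =
     (\<Sum>\<beta>\<in>B. (-1) ^ (mlen \<alpha> + mlen \<beta>) * (\<integral>x. \<phi> x * (\<integral>y. f \<beta> (x + dil \<kappa> s y) * FT (\<lambda>\<xi>. imon (madd \<alpha> \<beta>) \<xi> * Esym \<kappa> A B a \<xi>) y \<partial>lborel) \<partial>lborel))"
proof -
  note cE = csupp_Esym[OF \<kappa> fin hom lam a]
  \<comment> \<open>The factor s^m compensates homogeneity twice: it turns p(-\<xi>) into the symbol
    at the dilated point, and by (\<alpha> + \<beta>) . \<kappa> = m it turns the monomial on the
    right into a dilated one.\<close>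
  define E1 where "E1 \<xi> = of_real (s ^ m) * Esym \<kappa> A B a (dil \<kappa> s \<xi>)" for \<xi>
  obtain R0 where R0: "csupp R0 (\<lambda>\<xi>. Esym \<kappa> A B a (dil \<kappa> s \<xi>))" using csupp_dil[OF cE(1) s] by blast
  have E1c: "csupp R0 E1" unfolding E1_def by (intro csupp_mult R0 continuous_intros)
  have E1s: "smooth_fn E1"
    unfolding E1_def[abs_def]
    by (rule smooth_fn_mult[OF smooth_fn_const smooth_fn_dil[OF cE(2)]])
  have gs: "smooth_fn (\<lambda>\<xi>. imon \<gamma> \<xi> * h \<xi>)" "csupp R (\<lambda>\<xi>. imon \<gamma> \<xi> * h \<xi>)" if "smooth_fn h" "csupp R h" for \<gamma> R h
    using that by (auto intro: smooth_fn_mult smooth_fn_imon csupp_mult continuous_on_imon)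
  define h1 where "h1 \<xi> = imon \<alpha> \<xi> * E1 \<xi>" for \<xi>
  have h1: "smooth_fn h1" "csupp R0 h1" unfolding h1_def[abs_def] by (rule gs[OF E1s E1c])+
  define \<Psi> where "\<Psi> = conv \<phi> (FT h1)"
  have \<Psi>: "\<Psi> \<in> schwartz" unfolding \<Psi>_def by (intro conv_schwartz \<phi> FT_rapid[OF h1])
  have D\<Psi>: "Dm \<gamma> \<Psi> = conv \<phi> (FT (\<lambda>\<xi>. imon \<gamma> \<xi> * h1 \<xi>))" for \<gamma>
    unfolding \<Psi>_def by (rule Dm_conv_FT[OF \<phi> h1])
  \<comment> \<open>The sign is the one in the duality definition of \<open>distD\<close>; summed
    against the monomials it evaluates the symbol at -\<xi>.\<close>
  define c where "c p = a (fst p) (snd p) * (-1) ^ mlen (madd (fst p) (snd p))" for p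
  define g where "g p = madd (fst p) (snd p)" for p :: "'n mindex \<times> 'n mindex"
  have finAB: "finite (A \<times> B)" using fin by simp
  have "(\<Sum>\<alpha>\<in>A. \<Sum>\<beta>\<in>B. a \<alpha> \<beta> * distD (madd \<alpha> \<beta>) u \<Psi>) = (\<Sum>p\<in>A\<times>B. c p * u (Dm (g p) \<Psi>))"
    unfolding sum.cartesian_product by (intro sum.cong refl) (auto simp: distD_def c_def g_def)
  also have "\<dots> = u (\<lambda>x. \<Sum>p\<in>A\<times>B. c p * Dm (g p) \<Psi> x)"
    by (rule tempered_sum[OF u finAB, symmetric]) (intro schwartz_Dm \<Psi>)
  also have "(\<lambda>x. \<Sum>p\<in>A\<times>B. c p * Dm (g p) \<Psi> x) = conv \<phi> (FT (\<lambda>\<xi>. \<Sum>p\<in>A\<times>B. c p * (imon (g p) \<xi> * h1 \<xi>)))"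
    unfolding D\<Psi> by (rule conv_FT_sum[OF schwartz_rapid0[OF \<phi>] finAB, symmetric]) (rule gs[OF h1])+
  also have "(\<lambda>\<xi>. \<Sum>p\<in>A\<times>B. c p * (imon (g p) \<xi> * h1 \<xi>)) = (\<lambda>\<xi>. imon \<alpha> \<xi> * chi \<kappa> (dil \<kappa> s \<xi>))"
  proof
    fix \<xi>
    have sm: "symb A B a (- \<xi>) = (\<Sum>p\<in>A\<times>B. c p * imon (g p) \<xi>)"
      unfolding symb_alt sum.cartesian_product by (intro sum.cong refl) (auto simp: c_def g_def imon_minus mult.assoc)
    have "(\<Sum>p\<in>A\<times>B. c p * (imon (g p) \<xi> * h1 \<xi>)) = symb A B a (- \<xi>) * h1 \<xi>"
      unfolding sm sum_distrib_right by (simp add: mult.assoc)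
    also have "\<dots> = imon \<alpha> \<xi> * ((of_real (s ^ m) * symb A B a (- \<xi>)) * Esym \<kappa> A B a (dil \<kappa> s \<xi>))"
      by (simp add: h1_def E1_def mult_ac)
    also have "of_real (s ^ m) * symb A B a (- \<xi>) = symb A B a (- dil \<kappa> s \<xi>)"
    proof -
      have "dil \<kappa> s (- \<xi>) = - dil \<kappa> s \<xi>" by (simp add: vec_eq_iff)
      then show ?thesis using symb_dil[OF hom, of a s "- \<xi>"] by simp
    qed
    also have "\<dots> * Esym \<kappa> A B a (dil \<kappa> s \<xi>) = chi \<kappa> (dil \<kappa> s \<xi>)"
      by (rule Esym_mult_symb[OF \<kappa>(1) lam a])
    finally show "(\<Sum>p\<in>A\<times>B. c p * (imon (g p) \<xi> * h1 \<xi>)) = imon \<alpha> \<xi> * chi \<kappa> (dil \<kappa> s \<xi>)" .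
  qed
  also have "conv \<phi> (FT (\<lambda>\<xi>. imon \<alpha> \<xi> * chi \<kappa> (dil \<kappa> s \<xi>))) = Dm \<alpha> (conv \<phi> (FT (\<lambda>\<xi>. chi \<kappa> (dil \<kappa> s \<xi>))))"
  proof -
    obtain R1 where "csupp R1 (\<lambda>\<xi>. chi \<kappa> (dil \<kappa> s \<xi>))" using csupp_dil[OF csupp_chi[of \<kappa> D, OF \<kappa>(2)] s] by blast
    then show ?thesis by (rule Dm_conv_FT[OF \<phi> smooth_fn_dil[OF smooth_fn_chi], symmetric])
  qed
  finally have L: "(\<Sum>\<alpha>\<in>A. \<Sum>\<beta>\<in>B. a \<alpha> \<beta> * distD (madd \<alpha> \<beta>) u \<Psi>) = u (Dm \<alpha> (conv \<phi> (FT (\<lambda>\<xi>. chi \<kappa> (dil \<kappa> s \<xi>)))))" .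
  have R: "distD \<beta> (fun_dist (f \<beta>)) \<Psi> = (-1) ^ mlen \<beta> * (\<integral>x. \<phi> x * (\<integral>y. f \<beta> (x + dil \<kappa> s y) * FT (\<lambda>\<xi>. imon (madd \<alpha> \<beta>) \<xi> * Esym \<kappa> A B a \<xi>) y \<partial>lborel) \<partial>lborel)"
    if \<beta>: "\<beta> \<in> B" for \<beta>
  proof -
    define h where "h \<xi> = imon (madd \<alpha> \<beta>) \<xi> * Esym \<kappa> A B a \<xi>" for \<xi>
    have h: "smooth_fn h" "csupp (2 * 2 ^ D) h" unfolding h_def[abs_def] by (rule gs[OF cE(2,1)])+
    have "(\<lambda>\<xi>. imon \<beta> \<xi> * h1 \<xi>) = (\<lambda>\<xi>. h (dil \<kappa> s \<xi>))"
      using \<alpha> \<beta> by (auto simp: h_def h1_def E1_def imon_dil imon_madd mult_ac)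
    moreover obtain R1 where R1: "csupp R1 (\<lambda>\<xi>. h (dil \<kappa> s \<xi>))" using csupp_dil[OF h(2) s] by blast
    ultimately have D: "Dm \<beta> \<Psi> = conv \<phi> (FT (\<lambda>\<xi>. h (dil \<kappa> s \<xi>)))" unfolding D\<Psi> by simp
    obtain C N where CN: "\<And>x. norm (f \<beta> x) \<le> C * (1 + norm x) ^ N" using f(2)[OF \<beta>] unfolding poly_growth_def by (elim exE) auto
    have fm: "f \<beta> \<in> borel_measurable borel" by (rule borel_measurable_continuous_onI[OF f(1)[OF \<beta>]])
    have "(\<integral>x. f \<beta> x * conv \<phi> (FT (\<lambda>\<xi>. h (dil \<kappa> s \<xi>))) x \<partial>lborel) = (\<integral>x. \<phi> x * (\<integral>y. f \<beta> (x + y) * FT (\<lambda>\<xi>. h (dil \<kappa> s \<xi>)) y \<partial>lborel) \<partial>lborel)"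
      by (rule integral_conv_correlation[OF schwartz_rapid0[OF \<phi>] FT_rapid[OF smooth_fn_dil[OF h(1)] R1] fm CN])
    then show ?thesis
      unfolding distD_def fun_dist_def D correlation_dil[OF h(2) s fm] h_def[symmetric, abs_def] by simp
  qed
  have "distD \<alpha> u (conv \<phi> (FT (\<lambda>\<xi>. chi \<kappa> (dil \<kappa> s \<xi>)))) = (-1) ^ mlen \<alpha> * (\<Sum>\<beta>\<in>B. distD \<beta> (fun_dist (f \<beta>)) \<Psi>)"
    unfolding distD_def[of \<alpha>] L[symmetric] pde[OF \<Psi>] ..
  also have "\<dots> = (\<Sum>\<beta>\<in>B. (-1) ^ (mlen \<alpha> + mlen \<beta>) * (\<integral>x. \<phi> x * (\<integral>y. f \<beta> (x + dil \<kappa> s y) * FT (\<lambda>\<xi>. imon (madd \<alpha> \<beta>) \<xi> * Esym \<kappa> A B a \<xi>) y \<partial>lborel) \<partial>lborel))"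
    unfolding sum_distrib_left by (intro sum.cong refl) (simp add: R power_add mult.assoc)
  finally show ?thesis .
qed

section \<open>Approximate identities in weighted norms\<close>

lemma schwartz_increment:
  fixes \<phi> :: "real^'n::finite \<Rightarrow> complex"
  assumes \<phi>: "\<phi> \<in> schwartz"
  shows "\<exists>M\<ge>0. \<forall>x z. (1 + norm x) ^ k * norm (\<phi> (x + z) - \<phi> x) \<le> M * (\<Sum>l\<in>UNIV. \<bar>z$l\<bar>) * (1 + (\<Sum>l\<in>UNIV. \<bar>z$l\<bar>)) ^ k"
proof -
  have "\<forall>i. \<exists>M. \<forall>x. (1 + norm x) ^ k * norm (Dlist [i] \<phi> x) \<le> M" using rapidD[OF schwartz_rapid[OF \<phi>]] by blast
  from choice[OF this] obtain M where M: "\<forall>i x. (1 + norm x) ^ k * norm (Dlist [i] \<phi> x) \<le> M i" by (elim exE)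
  define M1 where "M1 = (\<Sum>i\<in>UNIV. \<bar>M i\<bar>)"
  have M1: "M i \<le> M1" for i unfolding M1_def using member_le_sum[of i UNIV "\<lambda>i. \<bar>M i\<bar>"] by simp
  have M0: "0 \<le> M1" unfolding M1_def by (rule sum_nonneg) simp
  have "(1 + norm x) ^ k * norm (\<phi> (x + z) - \<phi> x) \<le> M1 * (\<Sum>l\<in>UNIV. \<bar>z$l\<bar>) * (1 + (\<Sum>l\<in>UNIV. \<bar>z$l\<bar>)) ^ k" for x z
  proof -
    define Z where "Z = (\<Sum>l\<in>UNIV. \<bar>z$l\<bar>)"
    have Z0: "0 \<le> Z" unfolding Z_def by (rule sum_nonneg) simp
    define Bd where "Bd = M1 * (1 + Z) ^ k / (1 + norm x) ^ k"
    have "norm (\<phi> (x + z) - \<phi> x) \<le> Z * Bd"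
      unfolding Z_def
    proof (rule coordinate_mean_value)
      show "has_pd \<phi> i (Dlist [i] \<phi>)" for i using smooth_fn_has_pd[OF schwartz_smooth[OF \<phi>], of "[]" i] by simp
      fix i y assume "norm (y - x) \<le> (\<Sum>l\<in>UNIV. \<bar>z$l\<bar>)"
      then have "norm (x - y) \<le> Z" by (simp add: Z_def norm_minus_commute)
      then have "(1 + norm (x - y)) ^ k \<le> (1 + Z) ^ k" by (intro power_mono) auto
      then have "(1 + norm x) ^ k * norm (Dlist [i] \<phi> y) \<le> ((1 + norm y) ^ k * (1 + Z) ^ k) * norm (Dlist [i] \<phi> y)"
        using peetre_power[of y "x - y" k] by (intro mult_right_mono) (auto intro: order_trans mult_left_mono)
      also have "\<dots> = (1 + Z) ^ k * ((1 + norm y) ^ k * norm (Dlist [i] \<phi> y))" by simp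
      also have "\<dots> \<le> (1 + Z) ^ k * M1"
        using order_trans[OF M[rule_format] M1] Z0 by (intro mult_left_mono) auto
      finally show "norm (Dlist [i] \<phi> y) \<le> Bd" by (simp add: Bd_def field_simps)
    qed
    then show ?thesis unfolding Z_def[symmetric] by (simp add: Bd_def field_simps)
  qed
  then show ?thesis using M0 by blast
qed

text \<open>As s tends to 0 the kernel concentrates at the origin with fixed mass. The rate s
  appears because, for s \<le> 1, each coordinate of \<open>dil \<kappa> s y\<close> is at most s
  |y|. The weight in x prepares seminorm estimates.\<close>

lemma approximate_identity:
  fixes \<phi> :: "real^'n::finite \<Rightarrow> complex"
  assumes \<phi>: "\<phi> \<in> schwartz" and h: "smooth_fn h" "csupp R h" and \<kappa>: "\<And>l. 1 \<le> \<kappa> l"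
  shows "\<exists>C. \<forall>s x. 0 < s \<longrightarrow> s \<le> 1 \<longrightarrow> (1 + norm x) ^ k * norm (conv \<phi> (FT (\<lambda>\<xi>. h (dil \<kappa> s \<xi>))) x - (\<integral>y. FT h y \<partial>lborel) * \<phi> x) \<le> C * s"
proof -
  define n where "n = real CARD('n)"
  obtain M where M0: "M \<ge> 0" and M: "\<forall>x z. (1 + norm x) ^ k * norm (\<phi> (x + z) - \<phi> x) \<le> M * (\<Sum>l\<in>UNIV. \<bar>z$l\<bar>) * (1 + (\<Sum>l\<in>UNIV. \<bar>z$l\<bar>)) ^ k"
    using schwartz_increment[OF \<phi>, of k] by blast
  note hr = FT_rapid[OF h]
  \<comment> \<open>Beyond the 2 n powers for convergence, k powers pay for the weight at x and one
    more for the factor |y| of the increment.\<close>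
  obtain N where N: "\<And>y. (1 + norm y) ^ (2 * CARD('n) + (k + 1)) * norm (FT h y) \<le> N" using rapidD[OF hr] by blast
  note [measurable] = rapid_measurable[OF schwartz_rapid0[OF \<phi>]] rapid_measurable[OF hr]
  have "(1 + norm x) ^ k * norm (conv \<phi> (FT (\<lambda>\<xi>. h (dil \<kappa> s \<xi>))) x - (\<integral>y. FT h y \<partial>lborel) * \<phi> x) \<le> (M * n * (1 + n) ^ k * N * wint TYPE('n)) * s"
    if s: "0 < s" "s \<le> 1" for s x
  proof -
    have "conv \<phi> (FT (\<lambda>\<xi>. h (dil \<kappa> s \<xi>))) x = (\<integral>y. \<phi> (- (- x + y)) * FT (\<lambda>\<xi>. h (dil \<kappa> s \<xi>)) y \<partial>lborel)"
      by (simp add: conv_def algebra_simps)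
    also have "\<dots> = (\<integral>y. \<phi> (- (- x + dil \<kappa> s y)) * FT h y \<partial>lborel)"
      by (rule correlation_dil[OF h(2) s(1)]) measurable
    finally have cv: "conv \<phi> (FT (\<lambda>\<xi>. h (dil \<kappa> s \<xi>))) x = (\<integral>y. \<phi> (x - dil \<kappa> s y) * FT h y \<partial>lborel)" by simp
    obtain Mb where Mb: "\<And>x. norm (\<phi> x) \<le> Mb" using rapid_bounded[OF schwartz_rapid0[OF \<phi>]] by blast
    have i1: "integrable lborel (\<lambda>y. \<phi> (x - dil \<kappa> s y) * FT h y)"
      by (rule rapid_mult_growth[OF hr, where C=Mb and N=0]) (use Mb in auto)
    have i2: "integrable lborel (\<lambda>y. \<phi> x * FT h y)" by (intro integrable_mult_right rapid_integrable hr)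
    have "of_real ((1 + norm x) ^ k) * (conv \<phi> (FT (\<lambda>\<xi>. h (dil \<kappa> s \<xi>))) x - (\<integral>y. FT h y \<partial>lborel) * \<phi> x)
       = of_real ((1 + norm x) ^ k) * (\<integral>y. \<phi> (x - dil \<kappa> s y) * FT h y - \<phi> x * FT h y \<partial>lborel)"
      using i1 i2 by (simp add: cv mult.commute)
    also have "\<dots> = (\<integral>y. of_real ((1 + norm x) ^ k) * ((\<phi> (x - dil \<kappa> s y) - \<phi> x) * FT h y) \<partial>lborel)"
      by (simp only: integral_mult_right_zero left_diff_distrib)
    finally have eq: "of_real ((1 + norm x) ^ k) * (conv \<phi> (FT (\<lambda>\<xi>. h (dil \<kappa> s \<xi>))) x - (\<integral>y. FT h y \<partial>lborel) * \<phi> x)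
       = (\<integral>y. of_real ((1 + norm x) ^ k) * ((\<phi> (x - dil \<kappa> s y) - \<phi> x) * FT h y) \<partial>lborel)" .
    have "(1 + norm x) ^ k * norm (conv \<phi> (FT (\<lambda>\<xi>. h (dil \<kappa> s \<xi>))) x - (\<integral>y. FT h y \<partial>lborel) * \<phi> x)
       = norm (\<integral>y. of_real ((1 + norm x) ^ k) * ((\<phi> (x - dil \<kappa> s y) - \<phi> x) * FT h y) \<partial>lborel)"
      unfolding eq[symmetric] norm_mult[of "of_real _"] norm_of_real by simp
    also have "\<dots> \<le> (M * n * (1 + n) ^ k * s * N) * wint TYPE('n)"
    proof (rule weight_dominated(2))
      show "(\<lambda>y. of_real ((1 + norm x) ^ k) * ((\<phi> (x - dil \<kappa> s y) - \<phi> x) * FT h y)) \<in> borel_measurable borel" by measurable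
      fix y :: "real^'n"
      define Z where "Z = (\<Sum>l\<in>UNIV. \<bar>(- dil \<kappa> s y)$l\<bar>)"
      have Z0: "0 \<le> Z" unfolding Z_def by (rule sum_nonneg) simp
      have n1: "0 \<le> n" by (simp add: n_def)
      have "Z \<le> (\<Sum>l\<in>(UNIV::'n set). s * norm y)"
        unfolding Z_def
      proof (rule sum_mono)
        fix l
        have "s ^ \<kappa> l \<le> s ^ 1" using s \<kappa> by (intro power_decreasing) auto
        then have "\<bar>s ^ \<kappa> l * y$l\<bar> \<le> s * norm y"
          unfolding abs_mult using s component_le_norm_cart[of y l] by (intro mult_mono) auto
        then show "\<bar>(- dil \<kappa> s y)$l\<bar> \<le> s * norm y" by simp
      qed
      then have Zs: "Z \<le> n * s * norm y" by (simp add: n_def)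
      have "n * s * norm y \<le> n * 1 * norm y" using s n1 by (intro mult_right_mono mult_left_mono) auto
      moreover have "(1 + n) * (1 + norm y) = 1 + n + norm y + n * 1 * norm y" by (simp add: algebra_simps)
      ultimately have "1 + Z \<le> (1 + n) * (1 + norm y)" using Zs n1 norm_ge_zero[of y] by linarith
      then have Zk: "(1 + Z) ^ k \<le> (1 + n) ^ k * (1 + norm y) ^ k"
        using power_mono[of "1 + Z" "(1 + n) * (1 + norm y)" k] Z0 by (simp add: power_mult_distrib)
      have "(1 + norm x) ^ k * norm (\<phi> (x - dil \<kappa> s y) - \<phi> x) \<le> M * Z * (1 + Z) ^ k"
        using M[rule_format, of x "- dil \<kappa> s y"] by (simp add: Z_def)
      also have "\<dots> \<le> M * (n * s * (1 + norm y)) * ((1 + n) ^ k * (1 + norm y) ^ k)"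
        using Zs M0 n1 s Z0 by (intro mult_mono Zk mult_left_mono order_trans[OF Zs]) auto
      finally have b: "(1 + norm x) ^ k * norm (\<phi> (x - dil \<kappa> s y) - \<phi> x) \<le> (M * n * (1 + n) ^ k * s) * (1 + norm y) ^ (k + 1)"
        by (simp add: mult_ac)
      have "(1 + norm y) ^ (2 * CARD('n)) * norm (of_real ((1 + norm x) ^ k) * ((\<phi> (x - dil \<kappa> s y) - \<phi> x) * FT h y))
         = (1 + norm y) ^ (2 * CARD('n)) * (((1 + norm x) ^ k * norm (\<phi> (x - dil \<kappa> s y) - \<phi> x)) * norm (FT h y))"
        unfolding norm_mult norm_of_real by simp
      also have "\<dots> \<le> (1 + norm y) ^ (2 * CARD('n)) * (((M * n * (1 + n) ^ k * s) * (1 + norm y) ^ (k + 1)) * norm (FT h y))"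
        by (intro mult_left_mono mult_right_mono b) auto
      also have "\<dots> = (M * n * (1 + n) ^ k * s) * ((1 + norm y) ^ (2 * CARD('n) + (k + 1)) * norm (FT h y))"
        unfolding power_add by (simp add: mult_ac)
      also have "\<dots> \<le> (M * n * (1 + n) ^ k * s) * N"
        using M0 n1 s by (intro mult_left_mono N) auto
      finally show "(1 + norm y) ^ (2 * CARD('n)) * norm (of_real ((1 + norm x) ^ k) * ((\<phi> (x - dil \<kappa> s y) - \<phi> x) * FT h y)) \<le> M * n * (1 + n) ^ k * s * N" .
    qed
    finally show ?thesis by (simp add: mult_ac)
  qed
  then show ?thesis by blast
qed

section \<open>Monomials indexed by lists and Taylor expansion\<close>

definition lenlists :: "nat \<Rightarrow> 'n::finite list set" where
  "lenlists j = {ds. length ds = j}"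

lemma finite_lenlists: "finite (lenlists j :: 'n::finite list set)"
  using finite_lists_length_eq[of "UNIV :: 'n set" j] by (simp add: lenlists_def)

definition rmon :: "'n list \<Rightarrow> real^'n::finite \<Rightarrow> complex" where
  "rmon ds y = (\<Prod>i\<leftarrow>ds. complex_of_real (y$i))"

lemma rmon_simps [simp]: "rmon [] y = 1" "rmon (i # ds) y = of_real (y$i) * rmon ds y"
  by (auto simp: rmon_def)

lemma norm_rmon: "norm (rmon ds y) \<le> (1 + norm y) ^ length ds"
proof (induction ds)
  case (Cons i ds)
  have "\<bar>y$i\<bar> * norm (rmon ds y) \<le> (1 + norm y) * (1 + norm y) ^ length ds"
    using component_le_norm_cart[of y i] Cons by (intro mult_mono) auto
  then show ?case by (simp add: norm_mult)
qed simp

lemma rmon_minus: "rmon ds (- y) = (-1) ^ length ds * rmon ds y"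
  by (induction ds) auto

lemma continuous_on_rmon [continuous_intros]: "continuous_on S (rmon ds)"
  by (induction ds) (auto simp: rmon_simps[abs_def] intro!: continuous_intros simp del: rmon_simps)

text \<open>Indexing by ordered lists instead of multi-indices makes the multinomial coefficients
  disappear.\<close>

lemma inner_power_expand: "(\<i> * complex_of_real (w \<bullet> \<xi>)) ^ j = (\<Sum>ds\<in>lenlists j. rmon ds w * monl ds \<xi>)"
proof (induction j)
  case 0
  have "lenlists 0 = {[] :: 'a list}" by (auto simp: lenlists_def)
  then show ?case by simp
next
  case (Suc j)
  have im: "lenlists (Suc j) = (\<lambda>(i, ds). i # ds) ` ((UNIV::'a set) \<times> lenlists j)"
    by (auto simp: lenlists_def length_Suc_conv image_iff)
  have "(\<Sum>ds\<in>lenlists (Suc j). rmon ds w * monl ds \<xi>) = (\<Sum>(i, ds)\<in>UNIV \<times> lenlists j. rmon (i # ds) w * monl (i # ds) \<xi>)"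
    unfolding im by (subst sum.reindex) (auto simp: inj_on_def case_prod_unfold)
  also have "\<dots> = (\<Sum>i\<in>UNIV. \<Sum>ds\<in>lenlists j. (\<i> * of_real (w$i * \<xi>$i)) * (rmon ds w * monl ds \<xi>))"
    unfolding sum.cartesian_product[symmetric] by (simp add: mult_ac)
  also have "\<dots> = (\<i> * complex_of_real (w \<bullet> \<xi>)) * (\<Sum>ds\<in>lenlists j. rmon ds w * monl ds \<xi>)"
  proof -
    have "\<i> * complex_of_real (w \<bullet> \<xi>) = (\<Sum>i\<in>UNIV. \<i> * of_real (w$i * \<xi>$i))"
      by (simp add: inner_vec_def sum_distrib_left)
    then show ?thesis by (simp only: sum_product)
  qed
  finally show ?case by (simp add: Suc)
qed

text \<open>Taylor's formula with integral remainder along the segment from x to x - y. The j-th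
  derivative inserts the j-th power of i (-y . \<xi>) into the integral, which expands into list
  monomials; the bound b concerns order M on the segment.\<close>

lemma FT_taylor:
  fixes h :: "real^'n::finite \<Rightarrow> complex"
  assumes h: "csupp R h" and M: "0 < M"
    and b: "\<And>t ds. 0 \<le> t \<Longrightarrow> t \<le> 1 \<Longrightarrow> ds \<in> lenlists M \<Longrightarrow> norm (FT (\<lambda>\<xi>. monl ds \<xi> * h \<xi>) (x - t *\<^sub>R y)) \<le> b"
  shows "norm (FT h (x - y) - (\<Sum>j<M. (1 / fact j) *\<^sub>R (\<Sum>ds\<in>lenlists j. rmon ds (- y) * FT (\<lambda>\<xi>. monl ds \<xi> * h \<xi>) x)))
     \<le> real (card (lenlists M :: 'n list set)) * (1 + norm y) ^ M * b"
proof -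
  define g where "g j \<xi> = (\<i> * complex_of_real ((- y) \<bullet> \<xi>)) ^ j * h \<xi>" for j \<xi>
  have gc: "csupp R (g j)" for j unfolding g_def by (intro csupp_mult h continuous_intros)
  define Df where "Df j t = FT (g j) (x + t *\<^sub>R (- y))" for j t
  have ex: "Df j t = (\<Sum>ds\<in>lenlists j. rmon ds (- y) * FT (\<lambda>\<xi>. monl ds \<xi> * h \<xi>) (x - t *\<^sub>R y))" for j t
  proof -
    have "g j = (\<lambda>\<xi>. \<Sum>ds\<in>lenlists j. rmon ds (- y) * (monl ds \<xi> * h \<xi>))"
      unfolding g_def inner_power_expand by (simp add: sum_distrib_right mult.assoc)
    then show ?thesis unfolding Df_def
      by (simp add: FT_sum[OF finite_lenlists csupp_mult[OF h continuous_on_monl]])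
  qed
  have der: "(Df j has_vector_derivative Df (Suc j) t) (at t)" for j t
    using FT_line[OF gc, of j x "- y" t] unfolding Df_def g_def by (simp add: mult.assoc)
  have "((\<lambda>t. ((1 - t) ^ (M - 1) / fact (M - 1)) *\<^sub>R Df M t) has_integral
      Df 0 1 - (\<Sum>j<M. ((1 - 0) ^ j / fact j) *\<^sub>R Df j 0)) {0..1}"
    by (rule Taylor_has_integral[OF M]) (use der in \<open>auto intro: has_vector_derivative_at_within\<close>)
  moreover have "b \<ge> 0"
  proof -
    obtain ds :: "'n list" where "ds \<in> lenlists M" using Ex_list_of_length[of M] by (auto simp: lenlists_def)
    from order_trans[OF norm_ge_zero b[OF _ _ this, of 0]] show ?thesis by simp
  qed
  moreover have "norm (((1 - t) ^ (M - 1) / fact (M - 1)) *\<^sub>R Df M t) \<le> real (card (lenlists M :: 'n list set)) * (1 + norm y) ^ M * b"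
    if t: "t \<in> cbox 0 1" for t
  proof -
    have "norm (Df M t) \<le> (\<Sum>ds\<in>(lenlists M :: 'n list set). (1 + norm y) ^ M * b)"
      unfolding ex
    proof (rule order_trans[OF norm_sum], rule sum_mono)
      fix ds :: "'n list" assume ds: "ds \<in> lenlists M"
      have "norm (rmon ds (- y)) \<le> (1 + norm y) ^ M" using norm_rmon[of ds "- y"] ds by (simp add: lenlists_def)
      then show "norm (rmon ds (- y) * FT (\<lambda>\<xi>. monl ds \<xi> * h \<xi>) (x - t *\<^sub>R y)) \<le> (1 + norm y) ^ M * b"
        unfolding norm_mult using b[OF _ _ ds, of t] t by (intro mult_mono) auto
    qed
    moreover have "norm ((1 - t) ^ (M - 1) / fact (M - 1)) \<le> 1"
    proof -
      have "(1 - t) ^ (M - 1) \<le> 1" "0 \<le> (1 - t) ^ (M - 1)" using t by (auto intro: power_le_one)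
      moreover have "(1::real) \<le> fact (M - 1)" by (rule fact_ge_1)
      ultimately have "(1 - t) ^ (M - 1) \<le> fact (M - 1)" "0 \<le> (1 - t) ^ (M - 1)" by linarith+
      then show ?thesis by simp
    qed
    ultimately have "norm ((1 - t) ^ (M - 1) / fact (M - 1)) * norm (Df M t) \<le> 1 * (\<Sum>ds\<in>(lenlists M :: 'n list set). (1 + norm y) ^ M * b)"
      by (intro mult_mono) auto
    then show ?thesis by (simp add: norm_scaleR)
  qed
  ultimately have "norm (Df 0 1 - (\<Sum>j<M. ((1 - 0) ^ j / fact j) *\<^sub>R Df j 0)) \<le> real (card (lenlists M :: 'n list set)) * (1 + norm y) ^ M * b * measure lborel (cbox 0 (1::real))"
    by (intro has_integral_bound[where f="\<lambda>t. ((1 - t) ^ (M - 1) / fact (M - 1)) *\<^sub>R Df M t"]) (auto simp: cbox_interval)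
  moreover have "Df 0 1 = FT h (x - y)" by (simp add: Df_def g_def[abs_def])
  moreover have "Df j 0 = (\<Sum>ds\<in>lenlists j. rmon ds (- y) * FT (\<lambda>\<xi>. monl ds \<xi> * h \<xi>) x)" for j by (simp add: ex)
  ultimately show ?thesis by simp
qed

section \<open>High- and low-frequency limits\<close>

text \<open>The anisotropic order of a derivative: the power of s that its symbol gains under
  dilation.\<close>

definition kl :: "('n \<Rightarrow> nat) \<Rightarrow> 'n list \<Rightarrow> nat" where
  "kl \<kappa> ds = (\<Sum>i\<leftarrow>ds. \<kappa> i)"

lemma monl_dil: "monl ds (dil \<kappa> s \<xi>) = of_real (s ^ kl \<kappa> ds) * monl ds \<xi>"
  by (induction ds) (auto simp: kl_def power_add mult_ac)

lemma kl_ge_length: "(\<And>l. 1 \<le> \<kappa> l) \<Longrightarrow> length ds \<le> kl \<kappa> ds"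
proof (induction ds)
  case (Cons i ds)
  have "length ds \<le> kl \<kappa> ds" by (rule Cons.IH[OF Cons.prems])
  then show ?case using Cons.prems[of i] by (simp add: kl_def)
qed (simp add: kl_def)

lemma FT_monl_dil:
  assumes h: "csupp R h" and s: "\<epsilon> > 0"
  shows "FT (\<lambda>\<xi>. monl ds \<xi> * h (dil \<kappa> (inverse \<epsilon>) \<xi>)) x =
    of_real (\<epsilon> ^ (kl \<kappa> ds + (\<Sum>l\<in>UNIV. \<kappa> l))) * FT (\<lambda>\<xi>. monl ds \<xi> * h \<xi>) (dil \<kappa> \<epsilon> x)"
proof -
  have e: "monl ds \<xi> = of_real (\<epsilon> ^ kl \<kappa> ds) * monl ds (dil \<kappa> (inverse \<epsilon>) \<xi>)" for \<xi>
    using s by (simp add: monl_dil power_inverse)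
  have "(\<lambda>\<xi>. monl ds \<xi> * h (dil \<kappa> (inverse \<epsilon>) \<xi>))
      = (\<lambda>\<xi>. of_real (\<epsilon> ^ kl \<kappa> ds) * (monl ds (dil \<kappa> (inverse \<epsilon>) \<xi>) * h (dil \<kappa> (inverse \<epsilon>) \<xi>)))"
    by (rule ext, subst e) (simp only: mult.assoc)
  then have "FT (\<lambda>\<xi>. monl ds \<xi> * h (dil \<kappa> (inverse \<epsilon>) \<xi>)) x =
      of_real (\<epsilon> ^ kl \<kappa> ds) * FT (\<lambda>\<xi>. (\<lambda>\<xi>. monl ds \<xi> * h \<xi>) (dil \<kappa> (inverse \<epsilon>) \<xi>)) x"
    by (simp add: FT_cmult)
  also have "FT (\<lambda>\<xi>. (\<lambda>\<xi>. monl ds \<xi> * h \<xi>) (dil \<kappa> (inverse \<epsilon>) \<xi>)) x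
      = of_real (\<epsilon> ^ (\<Sum>l\<in>UNIV. \<kappa> l)) * FT (\<lambda>\<xi>. monl ds \<xi> * h \<xi>) (dil \<kappa> \<epsilon> x)"
    using FT_dil[OF csupp_mult[OF h continuous_on_monl[of UNIV ds]], of "inverse \<epsilon>" \<kappa> x] s by simp
  finally show ?thesis by (simp add: power_add mult.assoc)
qed

text \<open>The moments remove the Taylor polynomial of degree below M of the low-frequency kernel.
  Derivatives of order M gain at least \<epsilon>^M, while passing from the weight at the dilated
  point to the weight at the point itself loses at most \<epsilon>^(-D k). The condition D k < M
  leaves one factor \<epsilon>.\<close>

lemma vanishing_moments_bound:
  fixes \<phi> :: "real^'n::finite \<Rightarrow> complex"
  assumes \<phi>: "rapid \<phi>" and h: "smooth_fn h" "csupp R h" and \<kappa>: "\<And>l. 1 \<le> \<kappa> l" "\<And>l. \<kappa> l \<le> D"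
    and mom: "\<And>ds. length ds < M \<Longrightarrow> (\<integral>y. rmon ds y * \<phi> y \<partial>lborel) = 0" and M: "D * k < M"
  shows "\<exists>C. \<forall>\<epsilon> x. 0 < \<epsilon> \<longrightarrow> \<epsilon> \<le> 1 \<longrightarrow>
    (1 + norm x) ^ k * norm (conv \<phi> (FT (\<lambda>\<xi>. monl es \<xi> * h (dil \<kappa> (inverse \<epsilon>) \<xi>))) x) \<le> C * \<epsilon>"
proof -
  have Mp: "0 < M" using M by simp
  have "\<forall>ds. \<exists>N. \<forall>x. (1 + norm x) ^ k * norm (FT (\<lambda>\<xi>. monl ds \<xi> * h \<xi>) x) \<le> N"
    using rapidD[OF FT_rapid[OF smooth_fn_mult[OF smooth_fn_monl h(1)] csupp_mult[OF h(2) continuous_on_monl]]] by blast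
  from choice[OF this] obtain N0 where N0: "\<forall>ds x. (1 + norm x) ^ k * norm (FT (\<lambda>\<xi>. monl ds \<xi> * h \<xi>) x) \<le> N0 ds" by (elim exE)
  define N where "N = (\<Sum>ds\<in>lenlists M. \<bar>N0 (ds @ es)\<bar>)"
  have Nn: "0 \<le> N" unfolding N_def by (rule sum_nonneg) simp
  have N: "(1 + norm x) ^ k * norm (FT (\<lambda>\<xi>. monl (ds @ es) \<xi> * h \<xi>) x) \<le> N" if "ds \<in> lenlists M" for ds x
  proof -
    have "N0 (ds @ es) \<le> N" unfolding N_def
      using member_le_sum[OF that, of "\<lambda>ds. \<bar>N0 (ds @ es)\<bar>", OF abs_ge_zero finite_lenlists] by linarith
    then show ?thesis using N0[rule_format, of x "ds @ es"] by linarith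
  qed
  obtain Q where Q: "\<And>y. (1 + norm y) ^ (2 * CARD('n) + (k + M)) * norm (\<phi> y) \<le> Q" using rapidD[OF \<phi>] by blast
  define cL where "cL = real (card (lenlists M :: 'n list set))"
  have cL0: "0 \<le> cL" by (simp add: cL_def)
  have "(1 + norm x) ^ k * norm (conv \<phi> (FT (\<lambda>\<xi>. monl es \<xi> * h (dil \<kappa> (inverse \<epsilon>) \<xi>))) x) \<le> (cL * N * Q * wint TYPE('n)) * \<epsilon>"
    if \<epsilon>: "0 < \<epsilon>" "\<epsilon> \<le> 1" for \<epsilon> x
  proof -
    define h1 where "h1 \<xi> = monl es \<xi> * h (dil \<kappa> (inverse \<epsilon>) \<xi>)" for \<xi>
    have i\<epsilon>: "inverse \<epsilon> > 0" using \<epsilon> by simp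
    obtain R1 where R1: "csupp R1 (\<lambda>\<xi>. h (dil \<kappa> (inverse \<epsilon>) \<xi>))" using csupp_dil[OF h(2) i\<epsilon>] by blast
    have h1c: "csupp R1 h1" unfolding h1_def by (intro csupp_mult R1 continuous_intros)
    have h1s: "smooth_fn h1" unfolding h1_def[abs_def] by (rule smooth_fn_mult[OF smooth_fn_monl smooth_fn_dil[OF h(1)]])
    have h1r: "rapid (FT h1)" by (rule FT_rapid[OF h1s h1c])
    have dec: "(1 + norm z) ^ k * norm (FT (\<lambda>\<xi>. monl ds \<xi> * h1 \<xi>) z) \<le> \<epsilon> * N" if ds: "ds \<in> lenlists M" for ds z
    proof -
      \<comment> \<open>The anisotropic order of all derivatives plus the Jacobian exponent; it is
        at least M because every derivative contributes at least 1.\<close>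
      define S where "S = kl \<kappa> (ds @ es) + (\<Sum>l\<in>UNIV. \<kappa> l)"
      have "FT (\<lambda>\<xi>. monl ds \<xi> * h1 \<xi>) z = of_real (\<epsilon> ^ S) * FT (\<lambda>\<xi>. monl (ds @ es) \<xi> * h \<xi>) (dil \<kappa> \<epsilon> z)"
        unfolding S_def FT_monl_dil[OF h(2) \<epsilon>(1), symmetric] by (simp add: h1_def monl_append mult.assoc)
      then have e: "norm (FT (\<lambda>\<xi>. monl ds \<xi> * h1 \<xi>) z) = \<epsilon> ^ S * norm (FT (\<lambda>\<xi>. monl (ds @ es) \<xi> * h \<xi>) (dil \<kappa> \<epsilon> z))"
        using \<epsilon> by (simp add: norm_mult norm_power)
      have "M \<le> S" unfolding S_def using kl_ge_length[of \<kappa> "ds @ es", OF \<kappa>(1)] ds by (simp add: lenlists_def)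
      then have "D * k + 1 \<le> S" using M by simp
      then have "\<epsilon> ^ S \<le> \<epsilon> ^ (D * k + 1)" using \<epsilon> by (intro power_decreasing) auto
      then have S: "\<epsilon> ^ S \<le> \<epsilon> * (\<epsilon> ^ D) ^ k" by (simp add: power_mult)
      \<comment> \<open>For \<epsilon> \<le> 1 the dilation shrinks norms by at most \<epsilon>^D,
        so decay in the dilated variable becomes decay in z at this cost.\<close>
      have "\<epsilon> ^ D * (1 + norm z) \<le> 1 + norm (dil \<kappa> \<epsilon> z)"
        using norm_dil_ge[of \<epsilon> \<kappa> D z, OF _ _ \<kappa>(2)] \<epsilon> power_le_one[of \<epsilon> D] by (simp add: algebra_simps)
      then have w: "(\<epsilon> ^ D) ^ k * (1 + norm z) ^ k \<le> (1 + norm (dil \<kappa> \<epsilon> z)) ^ k"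
        using power_mono[of "\<epsilon> ^ D * (1 + norm z)" "1 + norm (dil \<kappa> \<epsilon> z)" k] \<epsilon> by (simp add: power_mult_distrib)
      have "(1 + norm z) ^ k * norm (FT (\<lambda>\<xi>. monl ds \<xi> * h1 \<xi>) z)
          \<le> (1 + norm z) ^ k * ((\<epsilon> * (\<epsilon> ^ D) ^ k) * norm (FT (\<lambda>\<xi>. monl (ds @ es) \<xi> * h \<xi>) (dil \<kappa> \<epsilon> z)))"
        unfolding e by (intro mult_left_mono mult_right_mono S) auto
      also have "\<dots> = \<epsilon> * (((\<epsilon> ^ D) ^ k * (1 + norm z) ^ k) * norm (FT (\<lambda>\<xi>. monl (ds @ es) \<xi> * h \<xi>) (dil \<kappa> \<epsilon> z)))" by (simp add: mult_ac)
      also have "\<dots> \<le> \<epsilon> * ((1 + norm (dil \<kappa> \<epsilon> z)) ^ k * norm (FT (\<lambda>\<xi>. monl (ds @ es) \<xi> * h \<xi>) (dil \<kappa> \<epsilon> z)))"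
        using \<epsilon> by (intro mult_left_mono mult_right_mono w) auto
      also have "\<dots> \<le> \<epsilon> * N" using \<epsilon> by (intro mult_left_mono N[OF ds]) auto
      finally show ?thesis .
    qed
    define T where "T y = (\<Sum>j<M. (1 / fact j) *\<^sub>R (\<Sum>ds\<in>lenlists j. rmon ds (- y) * FT (\<lambda>\<xi>. monl ds \<xi> * h1 \<xi>) x))" for y
    have rem: "norm (FT h1 (x - y) - T y) \<le> cL * (1 + norm y) ^ M * (\<epsilon> * N * (1 + norm y) ^ k / (1 + norm x) ^ k)" for y
      unfolding T_def cL_def
    proof (rule FT_taylor[OF h1c Mp])
      fix t :: real and ds :: "'n list" assume t: "0 \<le> t" "t \<le> 1" and ds: "ds \<in> lenlists M"
      have "(1 + norm x) ^ k \<le> (1 + norm (x - t *\<^sub>R y)) ^ k * (1 + norm (t *\<^sub>R y)) ^ k"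
        using peetre_power[of "x - t *\<^sub>R y" "t *\<^sub>R y" k] by simp
      also have "(1 + norm (t *\<^sub>R y)) ^ k \<le> (1 + norm y) ^ k" using t by (intro power_mono) (auto simp: mult_left_le_one_le)
      finally have px: "(1 + norm x) ^ k \<le> (1 + norm (x - t *\<^sub>R y)) ^ k * (1 + norm y) ^ k" by (simp add: mult_left_mono)
      have "(1 + norm x) ^ k * norm (FT (\<lambda>\<xi>. monl ds \<xi> * h1 \<xi>) (x - t *\<^sub>R y))
         \<le> ((1 + norm (x - t *\<^sub>R y)) ^ k * (1 + norm y) ^ k) * norm (FT (\<lambda>\<xi>. monl ds \<xi> * h1 \<xi>) (x - t *\<^sub>R y))"
        by (intro mult_right_mono px) auto
      also have "\<dots> = (1 + norm y) ^ k * ((1 + norm (x - t *\<^sub>R y)) ^ k * norm (FT (\<lambda>\<xi>. monl ds \<xi> * h1 \<xi>) (x - t *\<^sub>R y)))"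
        by (simp add: mult_ac)
      also have "\<dots> \<le> (1 + norm y) ^ k * (\<epsilon> * N)" by (intro mult_left_mono dec[OF ds]) auto
      finally show "norm (FT (\<lambda>\<xi>. monl ds \<xi> * h1 \<xi>) (x - t *\<^sub>R y)) \<le> \<epsilon> * N * (1 + norm y) ^ k / (1 + norm x) ^ k"
        by (simp add: field_simps)
    qed
    have mi: "integrable lborel (\<lambda>y. rmon ds (- y) * \<phi> y)" for ds
      by (rule rapid_mult_growth[OF \<phi>, where C=1 and N="length ds"])
         (use norm_rmon[of ds "- _"] in \<open>auto intro!: borel_measurable_continuous_onI continuous_on_compose2[OF continuous_on_rmon] continuous_intros\<close>)
    have Te: "T y * \<phi> y = (\<Sum>j<M. \<Sum>ds\<in>lenlists j. ((1 / fact j) *\<^sub>R FT (\<lambda>\<xi>. monl ds \<xi> * h1 \<xi>) x) * (rmon ds (- y) * \<phi> y))" for y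
      unfolding T_def sum_distrib_right scaleR_sum_right by (intro sum.cong refl) (simp add: scaleR_conv_of_real mult_ac)
    have Ti: "integrable lborel (\<lambda>y. T y * \<phi> y)"
      unfolding Te by (intro Bochner_Integration.integrable_sum integrable_mult_right mi)
    \<comment> \<open>Each term of the Taylor polynomial integrates, up to sign and a factor free of
      y, to a moment of \<phi> of order below M.\<close>
    have T0: "(\<integral>y. T y * \<phi> y \<partial>lborel) = 0"
    proof -
      have "(\<integral>y. T y * \<phi> y \<partial>lborel) = (\<Sum>j<M. \<Sum>ds\<in>lenlists j. ((1 / fact j) *\<^sub>R FT (\<lambda>\<xi>. monl ds \<xi> * h1 \<xi>) x) * (\<integral>y. rmon ds (- y) * \<phi> y \<partial>lborel))"
        unfolding Te
        by (subst Bochner_Integration.integral_sum, intro Bochner_Integration.integrable_sum integrable_mult_right mi)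
           (intro sum.cong refl, subst Bochner_Integration.integral_sum, auto intro!: mi)
      also have "\<dots> = 0"
      proof (intro sum.neutral ballI)
        fix j and ds :: "'n list" assume "j \<in> {..<M}" "ds \<in> lenlists j"
        then have "(\<integral>y. rmon ds y * \<phi> y \<partial>lborel) = 0" by (intro mom) (simp add: lenlists_def)
        then have "(\<integral>y. rmon ds (- y) * \<phi> y \<partial>lborel) = 0" by (simp add: rmon_minus mult.assoc)
        then show "((1 / fact j) *\<^sub>R FT (\<lambda>\<xi>. monl ds \<xi> * h1 \<xi>) x) * (\<integral>y. rmon ds (- y) * \<phi> y \<partial>lborel) = 0" by simp
      qed
      finally show ?thesis .
    qed
    have "conv \<phi> (FT h1) x = (\<integral>y. FT h1 (x - y) * \<phi> y \<partial>lborel) - (\<integral>y. T y * \<phi> y \<partial>lborel)"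
      unfolding T0 conv_commute[OF \<phi> h1r] by (simp add: conv_def)
    also have "\<dots> = (\<integral>y. (FT h1 (x - y) - T y) * \<phi> y \<partial>lborel)"
      unfolding left_diff_distrib by (rule Bochner_Integration.integral_diff[symmetric, OF conv_integrable[OF h1r \<phi>] Ti])
    finally have "(1 + norm x) ^ k * norm (conv \<phi> (FT h1) x) = norm (\<integral>y. of_real ((1 + norm x) ^ k) * ((FT h1 (x - y) - T y) * \<phi> y) \<partial>lborel)"
      unfolding integral_mult_right_zero norm_mult[of "of_real _"] norm_of_real by simp
    also have "\<dots> \<le> (cL * \<epsilon> * N * Q) * wint TYPE('n)"
    proof (rule weight_dominated(2))
      have "(\<lambda>y. (FT h1 (x - y) - T y) * \<phi> y) \<in> borel_measurable borel"
        unfolding left_diff_distrib using borel_measurable_integrable[OF conv_integrable[OF h1r \<phi>, of x]] borel_measurable_integrable[OF Ti] by simp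
      then show "(\<lambda>y. of_real ((1 + norm x) ^ k) * ((FT h1 (x - y) - T y) * \<phi> y)) \<in> borel_measurable borel" by measurable
      fix y
      have "(1 + norm y) ^ (2 * CARD('n)) * norm (of_real ((1 + norm x) ^ k) * ((FT h1 (x - y) - T y) * \<phi> y))
        = (1 + norm y) ^ (2 * CARD('n)) * ((1 + norm x) ^ k * (norm (FT h1 (x - y) - T y) * norm (\<phi> y)))"
        unfolding norm_mult norm_of_real by simp
      also have "\<dots> \<le> (1 + norm y) ^ (2 * CARD('n)) * ((1 + norm x) ^ k * ((cL * (1 + norm y) ^ M * (\<epsilon> * N * (1 + norm y) ^ k / (1 + norm x) ^ k)) * norm (\<phi> y)))"
        by (intro mult_left_mono mult_right_mono rem) auto
      also have "\<dots> = cL * \<epsilon> * N * ((1 + norm y) ^ (2 * CARD('n) + (k + M)) * norm (\<phi> y))"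
      proof -
        have "1 + norm x \<noteq> 0" by (simp add: add_nonneg_eq_0_iff)
        then show ?thesis by (simp add: power_add mult_ac)
      qed
      also have "\<dots> \<le> cL * \<epsilon> * N * Q" using cL0 \<epsilon> Nn by (intro mult_left_mono Q) auto
      finally show "(1 + norm y) ^ (2 * CARD('n)) * norm (of_real ((1 + norm x) ^ k) * ((FT h1 (x - y) - T y) * \<phi> y)) \<le> cL * \<epsilon> * N * Q" .
    qed
    finally show ?thesis by (simp add: h1_def[abs_def] mult_ac)
  qed
  then show ?thesis by blast
qed

section \<open>Continuity of tempered functionals through pointwise bounds\<close>

lemma seminorm_le:
  fixes \<psi> :: "real^'n::finite \<Rightarrow> complex"
  assumes b: "\<And>ds k x. length ds \<le> N \<Longrightarrow> k \<le> N \<Longrightarrow> (1 + norm x) ^ k * norm (Dlist ds \<psi> x) \<le> b"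
  shows "schwartz_seminorm N \<psi> \<le> real (card {ds::'n list. length ds \<le> N}) * (real N + 1) * b"
proof -
  have "schwartz_seminorm N \<psi> \<le> (\<Sum>ds\<in>{ds::'n list. length ds \<le> N}. \<Sum>k\<le>N. b)"
    unfolding schwartz_seminorm_def
    by (intro sum_mono cSUP_least) (auto intro: b)
  then show ?thesis by (simp add: algebra_simps)
qed

lemma seminorm_nonneg:
  assumes "\<psi> \<in> schwartz" shows "0 \<le> schwartz_seminorm N \<psi>"
  unfolding schwartz_seminorm_def
proof (intro sum_nonneg)
  fix ds k
  obtain M where M: "\<And>x. (1 + norm x) ^ k * norm (Dlist ds \<psi> x) \<le> M" using rapidD[OF schwartz_rapid[OF assms]] by blast
  have "0 \<le> (1 + norm (0::real^'a)) ^ k * norm (Dlist ds \<psi> 0)" by simp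
  also have "\<dots> \<le> (SUP x. (1 + norm x) ^ k * norm (Dlist ds \<psi> x))"
    by (rule cSUP_upper) (auto intro!: bdd_aboveI2 M)
  finally show "0 \<le> (SUP x. (1 + norm x) ^ k * norm (Dlist ds \<psi> x))" .
qed

text \<open>Continuity restated without suprema: a common bound b for all weighted derivatives up to
  order N bounds the functional by a fixed multiple of b.\<close>

lemma tempered_bound:
  fixes u :: "(real^'n::finite \<Rightarrow> complex) \<Rightarrow> complex"
  assumes u: "tempered u"
  shows "\<exists>K N. K \<ge> 0 \<and> (\<forall>\<psi> b. \<psi> \<in> schwartz \<longrightarrow> (\<forall>ds k x. length ds \<le> N \<longrightarrow> k \<le> N \<longrightarrow> (1 + norm x) ^ k * norm (Dlist ds \<psi> x) \<le> b) \<longrightarrow> norm (u \<psi>) \<le> K * b)"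
proof -
  obtain C N where CN: "\<forall>\<phi>\<in>schwartz. norm (u \<phi>) \<le> C * schwartz_seminorm N \<phi>" using u by (auto simp: tempered_def)
  let ?K = "\<bar>C\<bar> * (real (card {ds::'n list. length ds \<le> N}) * (real N + 1))"
  have "norm (u \<psi>) \<le> ?K * b" if \<psi>: "\<psi> \<in> schwartz" and b: "\<forall>ds k x. length ds \<le> N \<longrightarrow> k \<le> N \<longrightarrow> (1 + norm x) ^ k * norm (Dlist ds \<psi> x) \<le> b" for \<psi> b
  proof -
    have "norm (u \<psi>) \<le> C * schwartz_seminorm N \<psi>" using CN \<psi> by blast
    also have "\<dots> \<le> \<bar>C\<bar> * schwartz_seminorm N \<psi>" using seminorm_nonneg[OF \<psi>] by (intro mult_right_mono) auto
    also have "\<dots> \<le> \<bar>C\<bar> * (real (card {ds::'n list. length ds \<le> N}) * (real N + 1) * b)"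
      using b by (intro mult_left_mono seminorm_le) auto
    finally show ?thesis by (simp add: mult.assoc)
  qed
  moreover have "?K \<ge> 0" by simp
  ultimately show ?thesis by blast
qed

lemma finite_bound_choice:
  assumes "finite J" "\<And>j. j \<in> J \<Longrightarrow> \<exists>C::real. \<forall>x. P x \<longrightarrow> F j x \<le> C * G x" "\<And>x. P x \<Longrightarrow> 0 \<le> G x"
  shows "\<exists>C\<ge>0. \<forall>j\<in>J. \<forall>x. P x \<longrightarrow> F j x \<le> C * G x"
proof -
  have "\<forall>j\<in>J. \<exists>C::real. \<forall>x. P x \<longrightarrow> F j x \<le> C * G x" using assms(2) by blast
  from bchoice[OF this] obtain C where C: "\<forall>j\<in>J. \<forall>x. P x \<longrightarrow> F j x \<le> C j * G x" by (elim exE)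
  show ?thesis
  proof (intro exI[of _ "\<Sum>j\<in>J. \<bar>C j\<bar>"] conjI ballI allI impI)
    show "0 \<le> (\<Sum>j\<in>J. \<bar>C j\<bar>)" by (rule sum_nonneg) simp
    fix j x assume j: "j \<in> J" and x: "P x"
    have "C j \<le> (\<Sum>j\<in>J. \<bar>C j\<bar>)" using member_le_sum[OF j, of "\<lambda>j. \<bar>C j\<bar>"] assms(1) by auto
    then show "F j x \<le> (\<Sum>j\<in>J. \<bar>C j\<bar>) * G x"
      using C j x assms(3)[OF x] mult_right_mono order_trans by blast
  qed
qed

lemma finite_lists_le: "finite {ds::'n::finite list. length ds \<le> N}"
  using finite_lists_length_le[of "UNIV :: 'n set" N] by simp

text \<open>D^\<alpha> is moved onto \<phi>, and derivatives commute with convolution, so every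
  seminorm of the error is an instance of \<open>approximate_identity\<close>.\<close>

lemma distD_approximate_identity:
  fixes u :: "(real^'n::finite \<Rightarrow> complex) \<Rightarrow> complex"
  assumes u: "tempered u" and \<phi>: "\<phi> \<in> schwartz" and h: "smooth_fn h" "csupp R h" and \<kappa>: "\<And>l. 1 \<le> \<kappa> l"
  shows "\<exists>C. \<forall>s. 0 < s \<longrightarrow> s \<le> 1 \<longrightarrow> norm (distD \<alpha> u (conv \<phi> (FT (\<lambda>\<xi>. h (dil \<kappa> s \<xi>)))) - (\<integral>y. FT h y \<partial>lborel) * distD \<alpha> u \<phi>) \<le> C * s"
proof -
  obtain K N where K: "K \<ge> 0" and KN: "\<forall>\<psi> b. \<psi> \<in> schwartz \<longrightarrow> (\<forall>ds k x. length ds \<le> N \<longrightarrow> k \<le> N \<longrightarrow> (1 + norm x) ^ k * norm (Dlist ds \<psi> x) \<le> b) \<longrightarrow> norm (u \<psi>) \<le> K * b"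
    using tempered_bound[OF u] by blast
  define c where "c = (\<integral>y. FT h y \<partial>lborel)"
  define \<phi>' where "\<phi>' = Dm \<alpha> \<phi>"
  have \<phi>': "\<phi>' \<in> schwartz" unfolding \<phi>'_def by (rule schwartz_Dm[OF \<phi>])
  let ?J = "{ds::'n list. length ds \<le> N} \<times> {..N}"
  have "\<exists>C\<ge>0. \<forall>p\<in>?J. \<forall>q. (0 < fst q \<and> fst q \<le> 1) \<longrightarrow>
     (1 + norm (snd q)) ^ snd p * norm (conv (Dlist (fst p) \<phi>') (FT (\<lambda>\<xi>. h (dil \<kappa> (fst q) \<xi>))) (snd q) - c * Dlist (fst p) \<phi>' (snd q)) \<le> C * fst q"
  proof (rule finite_bound_choice)
    show "finite ?J" by (intro finite_cartesian_product finite_lists_le finite_atMost)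
    fix p :: "'n list \<times> nat" assume "p \<in> ?J"
    obtain C where "\<forall>s x. 0 < s \<longrightarrow> s \<le> 1 \<longrightarrow> (1 + norm x) ^ snd p * norm (conv (Dlist (fst p) \<phi>') (FT (\<lambda>\<xi>. h (dil \<kappa> s \<xi>))) x - c * Dlist (fst p) \<phi>' x) \<le> C * s"
      using approximate_identity[OF schwartz_Dlist[OF \<phi>', of "fst p"] h, of \<kappa> "snd p", OF \<kappa>] unfolding c_def by blast
    then show "\<exists>C. \<forall>q. (0 < fst q \<and> fst q \<le> 1) \<longrightarrow> (1 + norm (snd q)) ^ snd p * norm (conv (Dlist (fst p) \<phi>') (FT (\<lambda>\<xi>. h (dil \<kappa> (fst q) \<xi>))) (snd q) - c * Dlist (fst p) \<phi>' (snd q)) \<le> C * fst q"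
      by blast
  qed auto
  then obtain C where C: "\<forall>p\<in>?J. \<forall>q. (0 < fst q \<and> fst q \<le> 1) \<longrightarrow>
     (1 + norm (snd q)) ^ snd p * norm (conv (Dlist (fst p) \<phi>') (FT (\<lambda>\<xi>. h (dil \<kappa> (fst q) \<xi>))) (snd q) - c * Dlist (fst p) \<phi>' (snd q)) \<le> C * fst q"
    by blast
  have "norm (distD \<alpha> u (conv \<phi> (FT (\<lambda>\<xi>. h (dil \<kappa> s \<xi>)))) - c * distD \<alpha> u \<phi>) \<le> (K * C) * s" if s: "0 < s" "s \<le> 1" for s
  proof -
    obtain R1 where R1: "csupp R1 (\<lambda>\<xi>. h (dil \<kappa> s \<xi>))" using csupp_dil[OF h(2) s(1)] by blast
    define g where "g = FT (\<lambda>\<xi>. h (dil \<kappa> s \<xi>))"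
    have g: "rapid g" unfolding g_def by (rule FT_rapid[OF smooth_fn_dil[OF h(1)] R1])
    have cg: "conv \<phi>' g \<in> schwartz" by (rule conv_schwartz[OF \<phi>' g])
    have dist: "distD \<alpha> u (conv \<phi> g) - c * distD \<alpha> u \<phi> = (-1) ^ mlen \<alpha> * u (\<lambda>x. conv \<phi>' g x + (- c) * \<phi>' x)"
      unfolding tempered_add[OF u cg \<phi>'] unfolding distD_def \<phi>'_def Dm_def Dlist_conv[OF \<phi> g] by (simp add: algebra_simps)
    have "norm (u (\<lambda>x. conv \<phi>' g x + (- c) * \<phi>' x)) \<le> K * (C * s)"
    proof (rule KN[rule_format])
      show "(\<lambda>x. conv \<phi>' g x + (- c) * \<phi>' x) \<in> schwartz" by (rule schwartz_add[OF cg \<phi>'])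
      fix ds :: "'n list" and k x assume "length ds \<le> N" "k \<le> N"
      then have "(ds, k) \<in> ?J" by simp
      from C[rule_format, OF this, of "(s, x)"] s
      have "(1 + norm x) ^ k * norm (conv (Dlist ds \<phi>') g x - c * Dlist ds \<phi>' x) \<le> C * s" by (simp add: g_def)
      then show "(1 + norm x) ^ k * norm (Dlist ds (\<lambda>x. conv \<phi>' g x + (- c) * \<phi>' x) x) \<le> C * s"
        unfolding Dlist_add[OF cg \<phi>'] Dlist_conv[OF \<phi>' g] by simp
    qed
    then show ?thesis unfolding dist[unfolded g_def] by (simp add: norm_mult norm_power g_def mult.assoc)
  qed
  then show ?thesis unfolding c_def by blast
qed

text \<open>M is chosen before \<phi>: weights up to the order N of u, each power losing
  \<epsilon>^(-D), call for D N + 1 orders of moments. This uniformity is what makes finitely many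
  moments suffice for the final representation.\<close>

lemma distD_vanishing_moments:
  fixes u :: "(real^'n::finite \<Rightarrow> complex) \<Rightarrow> complex"
  assumes u: "tempered u" and h: "smooth_fn h" "csupp R h" and \<kappa>: "\<And>l. 1 \<le> \<kappa> l" "\<And>l. \<kappa> l \<le> D"
  shows "\<exists>M. \<forall>\<phi>\<in>schwartz. (\<forall>ds. length ds < M \<longrightarrow> (\<integral>y. rmon ds y * \<phi> y \<partial>lborel) = 0) \<longrightarrow>
     (\<exists>C. \<forall>\<epsilon>. 0 < \<epsilon> \<longrightarrow> \<epsilon> \<le> 1 \<longrightarrow> norm (distD \<alpha> u (conv \<phi> (FT (\<lambda>\<xi>. h (dil \<kappa> (inverse \<epsilon>) \<xi>))))) \<le> C * \<epsilon>)"
proof -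
  obtain K N where K: "K \<ge> 0" and KN: "\<forall>\<psi> b. \<psi> \<in> schwartz \<longrightarrow> (\<forall>ds k x. length ds \<le> N \<longrightarrow> k \<le> N \<longrightarrow> (1 + norm x) ^ k * norm (Dlist ds \<psi> x) \<le> b) \<longrightarrow> norm (u \<psi>) \<le> K * b"
    using tempered_bound[OF u] by blast
  define as where "as = concat (map (\<lambda>i. replicate (\<alpha> i) i) idx_list)"
  have "\<exists>C. \<forall>\<epsilon>. 0 < \<epsilon> \<longrightarrow> \<epsilon> \<le> 1 \<longrightarrow> norm (distD \<alpha> u (conv \<phi> (FT (\<lambda>\<xi>. h (dil \<kappa> (inverse \<epsilon>) \<xi>))))) \<le> C * \<epsilon>"
    if \<phi>: "\<phi> \<in> schwartz" and mom: "\<forall>ds. length ds < Suc (D * N) \<longrightarrow> (\<integral>y. rmon ds y * \<phi> y \<partial>lborel) = 0" for \<phi>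
  proof -
    let ?J = "{ds::'n list. length ds \<le> N} \<times> {..N}"
    have "\<exists>C\<ge>0. \<forall>p\<in>?J. \<forall>q. (0 < fst q \<and> fst q \<le> 1) \<longrightarrow>
       (1 + norm (snd q)) ^ snd p * norm (conv \<phi> (FT (\<lambda>\<xi>. monl (fst p @ as) \<xi> * h (dil \<kappa> (inverse (fst q)) \<xi>))) (snd q)) \<le> C * fst q"
    proof (rule finite_bound_choice)
      show "finite ?J" by (intro finite_cartesian_product finite_lists_le finite_atMost)
      fix p :: "'n list \<times> nat" assume p: "p \<in> ?J"
      then have "D * snd p < Suc (D * N)" by (auto simp: less_Suc_eq_le)
      from vanishing_moments_bound[OF schwartz_rapid0[OF \<phi>] h, of \<kappa> D "Suc (D * N)" "snd p" "fst p @ as", OF \<kappa> mom[rule_format] this]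
      show "\<exists>C. \<forall>q. (0 < fst q \<and> fst q \<le> 1) \<longrightarrow> (1 + norm (snd q)) ^ snd p * norm (conv \<phi> (FT (\<lambda>\<xi>. monl (fst p @ as) \<xi> * h (dil \<kappa> (inverse (fst q)) \<xi>))) (snd q)) \<le> C * fst q"
        by blast
    qed auto
    then obtain C where C: "\<forall>p\<in>?J. \<forall>q. (0 < fst q \<and> fst q \<le> 1) \<longrightarrow>
       (1 + norm (snd q)) ^ snd p * norm (conv \<phi> (FT (\<lambda>\<xi>. monl (fst p @ as) \<xi> * h (dil \<kappa> (inverse (fst q)) \<xi>))) (snd q)) \<le> C * fst q"
      by blast
    have "norm (distD \<alpha> u (conv \<phi> (FT (\<lambda>\<xi>. h (dil \<kappa> (inverse \<epsilon>) \<xi>))))) \<le> (K * C) * \<epsilon>" if \<epsilon>: "0 < \<epsilon>" "\<epsilon> \<le> 1" for \<epsilon>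
    proof -
      define h2 where "h2 \<xi> = h (dil \<kappa> (inverse \<epsilon>) \<xi>)" for \<xi>
      have i\<epsilon>: "inverse \<epsilon> > 0" using \<epsilon> by simp
      obtain R1 where R1: "csupp R1 h2" unfolding h2_def using csupp_dil[OF h(2) i\<epsilon>] by blast
      have s2: "smooth_fn h2" unfolding h2_def[abs_def] by (rule smooth_fn_dil[OF h(1)])
      have D: "Dlist ds (Dm \<alpha> (conv \<phi> (FT h2))) = conv \<phi> (FT (\<lambda>\<xi>. monl (ds @ as) \<xi> * h2 \<xi>))" for ds
      proof -
        have "Dlist ds (Dm \<alpha> (conv \<phi> (FT h2))) = Dlist (ds @ as) (conv \<phi> (FT h2))"
          by (simp add: Dm_def as_def Dlist_append)
        then show ?thesis by (simp only: Dlist_conv_right[OF \<phi> FT_schwartz[OF s2 R1]] Dlist_FT[OF R1])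
      qed
      have "norm (u (Dm \<alpha> (conv \<phi> (FT h2)))) \<le> K * (C * \<epsilon>)"
      proof (rule KN[rule_format])
        show "Dm \<alpha> (conv \<phi> (FT h2)) \<in> schwartz" by (intro schwartz_Dm conv_schwartz \<phi> FT_rapid[OF s2 R1])
        fix ds :: "'n list" and k x assume "length ds \<le> N" "k \<le> N"
        then have "(ds, k) \<in> ?J" by simp
        from C[rule_format, OF this, of "(\<epsilon>, x)"] \<epsilon>
        show "(1 + norm x) ^ k * norm (Dlist ds (Dm \<alpha> (conv \<phi> (FT h2))) x) \<le> C * \<epsilon>" by (simp add: D h2_def)
      qed
      then show ?thesis unfolding distD_def h2_def[abs_def] by (simp add: norm_mult norm_power mult.assoc)
    qed
    then show ?thesis by blast
  qed
  then show ?thesis by blast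
qed

section \<open>Dyadic sums\<close>

text \<open>The spatial scale of the j-th piece: large j means fine scale and high
  frequency.\<close>

abbreviation dyad :: "int \<Rightarrow> real" where "dyad j \<equiv> 2 powi (- j)"

lemma dyad_pos: "0 < dyad j" by simp

lemma dyad_le: "i < j \<Longrightarrow> 2 * dyad j \<le> dyad i"
proof -
  assume "i < j"
  then have "(2::real) powi (1 + - j) \<le> 2 powi (- i)" by (intro power_int_increasing) auto
  then show ?thesis by (subst (asm) power_int_add) auto
qed

text \<open>The term at scale s is compared with the integral over (s, 2 s). There omega is at least
  its value at s, 1/\<rho> \<ge> 1/(4 s) and d/\<rho>^2 \<ge> d/(4 s^2), so the integrand dominates
  on either side of d. The factor 4 is the loss from (2 s)^2.\<close>

lemma dyadic_sum_le:
  fixes om :: "real \<Rightarrow> ennreal"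
  assumes mono: "mono om" and fin: "\<And>\<rho>. om \<rho> \<noteq> \<infinity>" and d: "0 \<le> d" and F: "finite F"
  shows "(\<Sum>j\<in>F. ennreal (min 1 (d / dyad j) * enn2real (om (dyad j)))) \<le>
    4 * ((\<integral>\<^sup>+\<rho>\<in>{0<..<d}. om \<rho> * ennreal (1 / \<rho>) \<partial>lborel) + ennreal d * (\<integral>\<^sup>+\<rho>\<in>{d<..}. om \<rho> * ennreal (1 / \<rho>\<^sup>2) \<partial>lborel))"
proof -
  have om: "om \<rho> = ennreal (enn2real (om \<rho>))" for \<rho> using fin[of \<rho>] by (simp add: less_top)
  have "mono (\<lambda>\<rho>. enn2real (om \<rho>))"
    using mono fin by (auto simp: mono_def less_top[symmetric] intro!: enn2real_mono)
  then have "(\<lambda>\<rho>. enn2real (om \<rho>)) \<in> borel_measurable borel" by (rule borel_measurable_mono)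
  then have "(\<lambda>\<rho>. ennreal (enn2real (om \<rho>))) \<in> borel_measurable borel" by measurable
  then have [measurable]: "om \<in> borel_measurable borel" by (simp only: om[symmetric])
  define V where "V \<rho> = om \<rho> * ennreal (1 / \<rho>) * indicator {0<..<d} \<rho> + ennreal d * (om \<rho> * ennreal (1 / \<rho>\<^sup>2) * indicator {d<..} \<rho>)" for \<rho>
  have Vm [measurable]: "V \<in> borel_measurable borel" unfolding V_def by measurable
  \<comment> \<open>At \<rho> = d both indicators in V are zero; deleting this null set avoids the
    exceptional point.\<close>
  define I where "I j = {dyad j <..< 2 * dyad j} - {d}" for j
  have Im [measurable]: "I j \<in> sets borel" for j unfolding I_def by measurable
  have low: "ennreal (min 1 (d / dyad j) * enn2real (om (dyad j))) \<le> 4 * (\<integral>\<^sup>+\<rho>. V \<rho> * indicator (I j) \<rho> \<partial>lborel)" for j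
  proof -
    define s where "s = dyad j"
    have s: "0 < s" by (simp add: s_def)
    define c where "c = min 1 (d / s)"
    have c0: "0 \<le> c" using d s by (simp add: c_def)
    have pw: "om s * ennreal (c / (4 * s)) * indicator (I j) \<rho> \<le> V \<rho> * indicator (I j) \<rho>" for \<rho>
    proof (cases "\<rho> \<in> I j")
      case True
      then have \<rho>: "s < \<rho>" "\<rho> < 2 * s" "\<rho> \<noteq> d" by (auto simp: I_def s_def)
      have omr: "om s \<le> om \<rho>" using mono \<rho> by (auto simp: mono_def)
      show ?thesis
      proof (cases "\<rho> < d")
        case True
        have "c / (4 * s) \<le> 1 / (4 * s)" using s by (simp add: c_def divide_right_mono)
        also have "\<dots> \<le> 1 / \<rho>" using \<rho> s by (simp add: field_simps)
        finally have "om s * ennreal (c / (4 * s)) \<le> om \<rho> * ennreal (1 / \<rho>)"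
          using omr by (intro mult_mono ennreal_leI) auto
        then show ?thesis using True \<rho> s \<open>\<rho> \<in> I j\<close> by (simp add: V_def)
      next
        case False
        have "c / (4 * s) \<le> (d / s) / (4 * s)" using s by (intro divide_right_mono) (auto simp: c_def)
        also have "\<dots> = d / (2 * s)\<^sup>2" by (simp add: power2_eq_square)
        also have "\<dots> \<le> d / \<rho>\<^sup>2" using \<rho> s d by (intro divide_left_mono power_mono) auto
        finally have "om s * ennreal (c / (4 * s)) \<le> om \<rho> * ennreal (d * (1 / \<rho>\<^sup>2))"
          using omr by (intro mult_mono ennreal_leI) auto
        also have "\<dots> = ennreal d * (om \<rho> * ennreal (1 / \<rho>\<^sup>2))" using ennreal_mult[of d "1 / \<rho>\<^sup>2"] d by (simp add: mult.left_commute)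
        finally show ?thesis using False \<rho> \<open>\<rho> \<in> I j\<close> by (simp add: V_def)
      qed
    qed simp
    have em: "emeasure lborel (I j) = ennreal s"
    proof -
      have "emeasure lborel (I j) = emeasure lborel {s<..<2 * s}"
        unfolding I_def s_def[symmetric] by (rule emeasure_Diff_null_set) (auto simp: null_sets_def)
      also have "\<dots> = ennreal s" using s by simp
      finally show ?thesis .
    qed
    have "ennreal (c * enn2real (om s)) = 4 * (om s * ennreal (c / (4 * s)) * ennreal s)"
    proof -
      have "4 * (om s * ennreal (c / (4 * s)) * ennreal s) = ennreal (4 * (enn2real (om s) * (c / (4 * s)) * s))"
        using s c0 by (subst om) (simp add: ennreal_mult[symmetric] ennreal_numeral[symmetric] del: ennreal_numeral)
      also have "4 * (enn2real (om s) * (c / (4 * s)) * s) = c * enn2real (om s)" using s by simp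
      finally show ?thesis by simp
    qed
    also have "om s * ennreal (c / (4 * s)) * ennreal s = (\<integral>\<^sup>+\<rho>. om s * ennreal (c / (4 * s)) * indicator (I j) \<rho> \<partial>lborel)"
      by (subst nn_integral_cmult_indicator) (auto simp: em)
    also have "4 * \<dots> \<le> 4 * (\<integral>\<^sup>+\<rho>. V \<rho> * indicator (I j) \<rho> \<partial>lborel)"
      by (intro mult_left_mono nn_integral_mono pw) auto
    finally show ?thesis by (simp add: c_def s_def)
  qed
  have disj: "disjoint_family_on I F"
  proof (unfold disjoint_family_on_def, intro ballI impI)
    fix i j :: int assume "i \<noteq> j"
    then show "I i \<inter> I j = {}"
      using dyad_le[of i j] dyad_le[of j i] by (cases "i < j") (auto simp: I_def)
  qed
  have "(\<Sum>j\<in>F. ennreal (min 1 (d / dyad j) * enn2real (om (dyad j)))) \<le> (\<Sum>j\<in>F. 4 * (\<integral>\<^sup>+\<rho>. V \<rho> * indicator (I j) \<rho> \<partial>lborel))"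
    by (intro sum_mono low)
  also have "\<dots> = 4 * (\<integral>\<^sup>+\<rho>. (\<Sum>j\<in>F. V \<rho> * indicator (I j) \<rho>) \<partial>lborel)"
    by (subst nn_integral_sum) (auto simp: sum_distrib_left)
  also have "\<dots> \<le> 4 * (\<integral>\<^sup>+\<rho>. V \<rho> \<partial>lborel)"
  proof (intro mult_left_mono nn_integral_mono)
    fix \<rho>
    have "(\<Sum>j\<in>F. V \<rho> * indicator (I j) \<rho>) = V \<rho> * indicator (\<Union> (I ` F)) \<rho>"
      using F disj by (simp add: indicator_UN_disjoint sum_distrib_left)
    then show "(\<Sum>j\<in>F. V \<rho> * indicator (I j) \<rho>) \<le> V \<rho>" by (auto simp: indicator_def)
  qed auto
  also have "(\<integral>\<^sup>+\<rho>. V \<rho> \<partial>lborel) = (\<integral>\<^sup>+\<rho>\<in>{0<..<d}. om \<rho> * ennreal (1 / \<rho>) \<partial>lborel) + ennreal d * (\<integral>\<^sup>+\<rho>\<in>{d<..}. om \<rho> * ennreal (1 / \<rho>\<^sup>2) \<partial>lborel)"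
    unfolding V_def by (subst nn_integral_add) (auto simp: nn_integral_cmult)
  finally show ?thesis .
qed

text \<open>By monotonicity an infinite value would persist on an interval of positive length inside
  (1, \<infinity>) and make the integral infinite. This finiteness is what lets
  \<open>enn2real\<close> be applied to the modulus without losing information.\<close>

lemma modulus_finite:
  fixes om :: "real \<Rightarrow> ennreal"
  assumes mono: "mono om" and "(\<integral>\<^sup>+\<rho>\<in>{1<..}. om \<rho> * ennreal (1 / \<rho>\<^sup>2) \<partial>lborel) < \<infinity>"
  shows "om \<rho> \<noteq> \<infinity>"
proof
  assume inf: "om \<rho> = \<infinity>"
  define r where "r = max 1 \<rho>"
  have "(\<integral>\<^sup>+t. \<infinity> * indicator {r<..<r + 1} t \<partial>lborel) \<le> (\<integral>\<^sup>+t\<in>{1<..}. om t * ennreal (1 / t\<^sup>2) \<partial>lborel)"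
  proof (intro nn_integral_mono)
    fix t
    show "\<infinity> * indicator {r<..<r + 1} t \<le> om t * ennreal (1 / t\<^sup>2) * indicator {1<..} t"
    proof (cases "t \<in> {r<..<r + 1}")
      case True
      then have t: "1 < t" "\<rho> \<le> t" by (auto simp: r_def)
      then have "om t = \<infinity>" using inf mono by (metis monoD top.extremum_uniqueI infinity_ennreal_def)
      then show ?thesis using t True by (simp add: ennreal_top_mult)
    qed simp
  qed
  moreover have "(\<integral>\<^sup>+t. \<infinity> * indicator {r<..<r + 1} t \<partial>lborel) = \<infinity>"
    by (subst nn_integral_cmult_indicator) (auto simp: ennreal_top_mult)
  ultimately show False using assms(2) by simp
qed

lemma knorm_zero [simp]: "knorm \<kappa> 0 = 0"
  by (simp add: knorm_alt)

lemma continuous_on_knorm: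
  assumes "\<And>l. 1 \<le> \<kappa> l"
  shows "continuous_on UNIV (knorm \<kappa>)"
proof -
  have "0 < \<kappa> l" for l using assms[of l] by simp
  then show ?thesis
    unfolding knorm_alt[abs_def] by (intro continuous_intros continuous_on_powr') auto
qed

text \<open>T pairs the indices l and -l - 1, so its partial sums run over the integers from -L to L
  - 1, each once. Convergence is the M-test with the dyadic terms at distance 1 as majorant; the
  estimate for increments holds for all partial sums and passes to the limit.\<close>

lemma dyadic_series:
  fixes G :: "int \<Rightarrow> real^'n::finite \<Rightarrow> complex" and om :: "real \<Rightarrow> ennreal"
  assumes \<kappa>: "\<And>l. 1 \<le> \<kappa> l" and mono: "mono om"
    and i0: "(\<integral>\<^sup>+\<rho>\<in>{0<..<1}. om \<rho> * ennreal (1 / \<rho>) \<partial>lborel) < \<infinity>"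
    and i1: "(\<integral>\<^sup>+\<rho>\<in>{1<..}. om \<rho> * ennreal (1 / \<rho>\<^sup>2) \<partial>lborel) < \<infinity>"
    and C: "0 \<le> C" and G: "\<And>j x y. norm (G j x - G j y) \<le> C * min 1 (knorm \<kappa> (x - y) / dyad j) * enn2real (om (dyad j))"
  defines "T \<equiv> \<lambda>L x. \<Sum>l<L. (G (int l) x - G (int l) 0) + (G (- int l - 1) x - G (- int l - 1) 0)"
  shows "\<And>j. continuous_on UNIV (G j)"
    and "\<exists>g. continuous_on UNIV g \<and> (\<forall>x. (\<lambda>L. T L x) \<longlonglongrightarrow> g x) \<and> (\<exists>K. \<forall>L x. norm (T L x) \<le> K * (1 + norm x) ^ 1) \<and>
      (\<forall>x y. ennreal (norm (g x - g y)) \<le> ennreal (4 * C) *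
        ((\<integral>\<^sup>+\<rho>\<in>{0<..<knorm \<kappa> (x - y)}. om \<rho> * ennreal (1 / \<rho>) \<partial>lborel) +
          ennreal (knorm \<kappa> (x - y)) * (\<integral>\<^sup>+\<rho>\<in>{knorm \<kappa> (x - y)<..}. om \<rho> * ennreal (1 / \<rho>\<^sup>2) \<partial>lborel)))"
proof -
  define W where "W j = enn2real (om (dyad j))" for j
  have W0: "0 \<le> W j" for j by (simp add: W_def)
  have fin: "om \<rho> \<noteq> \<infinity>" for \<rho> by (rule modulus_finite[OF mono i1])
  have Gb: "norm (G j x - G j y) \<le> C * (min 1 (knorm \<kappa> (x - y) / dyad j) * W j)" for j x y
    using G[of j x y] by (simp add: W_def mult.assoc)
  show Gc: "continuous_on UNIV (G j)" for j
    unfolding continuous_on_def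
  proof
    fix x
    have "((\<lambda>y. C * (knorm \<kappa> (y - x) / dyad j * W j)) \<longlongrightarrow> C * (knorm \<kappa> (x - x) / dyad j * W j)) (at x)"
      using continuous_on_knorm[of \<kappa>, OF \<kappa>]
      by (intro tendsto_intros continuous_on_tendsto_compose[of UNIV "knorm \<kappa>"]) auto
    then have lim: "((\<lambda>y. C * (knorm \<kappa> (y - x) / dyad j * W j)) \<longlongrightarrow> 0) (at x)" by simp
    have "((\<lambda>y. G j y - G j x) \<longlongrightarrow> 0) (at x)"
    proof (rule Lim_null_comparison[OF _ lim], intro always_eventually allI)
      fix y
      have "norm (G j y - G j x) \<le> C * (min 1 (knorm \<kappa> (y - x) / dyad j) * W j)" by (rule Gb)
      also have "\<dots> \<le> C * (knorm \<kappa> (y - x) / dyad j * W j)"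
        by (intro mult_left_mono mult_right_mono C W0) auto
      finally show "norm (G j y - G j x) \<le> C * (knorm \<kappa> (y - x) / dyad j * W j)" .
    qed
    then show "(G j \<longlongrightarrow> G j x) (at x within UNIV)" by (simp add: LIM_zero_iff)
  qed
  \<comment> \<open>The dyadic terms for points at distance 1; other distances from the origin cost
    the factor 1 + \<open>knorm \<kappa> x\<close>.\<close>
  define b where "b j = min 1 (1 / dyad j) * W j" for j
  have b0: "0 \<le> b j" for j unfolding b_def using W0[of j] by simp
  define I1 where "I1 = (\<integral>\<^sup>+\<rho>\<in>{0<..<1}. om \<rho> * ennreal (1 / \<rho>) \<partial>lborel) + ennreal 1 * (\<integral>\<^sup>+\<rho>\<in>{1<..}. om \<rho> * ennreal (1 / \<rho>\<^sup>2) \<partial>lborel)"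
  have I1: "I1 < \<infinity>" unfolding I1_def using i0 i1 by (simp add: less_top[symmetric])
  define S where "S = 4 * enn2real I1"
  have bS: "(\<Sum>j\<in>F. b j) \<le> S" if F: "finite F" for F
  proof -
    have "ennreal (\<Sum>j\<in>F. b j) = (\<Sum>j\<in>F. ennreal (b j))" using b0 by (simp add: sum_ennreal)
    also have "\<dots> \<le> 4 * I1" unfolding b_def W_def I1_def by (rule dyadic_sum_le[OF mono fin _ F]) simp
    also have "4 * I1 = ennreal S" unfolding S_def using I1
      by (simp add: ennreal_mult less_top)
    finally show ?thesis by (simp add: S_def)
  qed
  have Gm: "norm (G j x - G j 0) \<le> (C * (1 + knorm \<kappa> x)) * b j" for j x
  proof -
    \<comment> \<open>An instance of min (1, c r) \<le> (1 + c) min (1, r) for c, r \<ge> 0.\<close>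
    have "min 1 (knorm \<kappa> (x - 0) / dyad j) \<le> (1 + knorm \<kappa> x) * min 1 (1 / dyad j)"
    proof (cases "1 / dyad j \<le> 1")
      case True
      have "min 1 (knorm \<kappa> (x - 0) / dyad j) \<le> knorm \<kappa> x * (1 / dyad j)" by simp
      also have "\<dots> \<le> (1 + knorm \<kappa> x) * (1 / dyad j)" by (intro mult_right_mono) auto
      finally show ?thesis unfolding min_absorb2[OF True] .
    next
      case False
      then have e: "min 1 (1 / dyad j) = 1" by (intro min_absorb1) linarith
      show ?thesis unfolding e using knorm_nonneg[of \<kappa> x] min.cobounded1[of 1 "knorm \<kappa> (x - 0) / dyad j"] by (simp only: mult_1_right)
    qed
    then have "C * (min 1 (knorm \<kappa> (x - 0) / dyad j) * W j) \<le> C * (((1 + knorm \<kappa> x) * min 1 (1 / dyad j)) * W j)"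
      by (intro mult_left_mono mult_right_mono C W0)
    then show ?thesis using Gb[of j x 0] by (simp add: b_def mult_ac)
  qed
  define t where "t l x = (G (int l) x - G (int l) 0) + (G (- int l - 1) x - G (- int l - 1) 0)" for l x
  define B where "B l = b (int l) + b (- int l - 1)" for l
  have tB: "norm (t l x) \<le> (C * (1 + knorm \<kappa> x)) * B l" for l x
    unfolding t_def B_def distrib_left[of "C * (1 + knorm \<kappa> x)"] by (rule norm_triangle_le[OF add_mono[OF Gm Gm]])
  define J where "J L = int ` {..<L} \<union> (\<lambda>l. - int l - 1) ` {..<L}" for L :: nat
  have Jf: "finite (J L)" for L by (simp add: J_def)
  have Jsum: "(\<Sum>l<L. F (int l) + F (- int l - 1)) = (\<Sum>j\<in>J L. F j)" for F :: "int \<Rightarrow> 'z::comm_monoid_add" and L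
    unfolding J_def
    by (subst sum.union_disjoint) (auto simp: sum.distrib sum.reindex inj_on_def)
  have BS: "(\<Sum>l<L. B l) \<le> S" for L
    unfolding B_def Jsum[of b] by (rule bS[OF Jf])
  have B0: "0 \<le> B l" for l unfolding B_def using b0 by simp
  have Bsum: "summable B" by (rule summableI_nonneg_bounded[OF B0 BS])
  have Tt: "T L x = (\<Sum>l<L. t l x)" for L x by (simp add: T_def t_def)
  have tsum: "summable (\<lambda>l. t l x)" for x
    by (rule summable_comparison_test'[OF summable_mult[OF Bsum, of "C * (1 + knorm \<kappa> x)"] tB])
  define g where "g x = (\<Sum>l. t l x)" for x
  have Tg: "(\<lambda>L. T L x) \<longlonglongrightarrow> g x" for x unfolding Tt g_def by (rule summable_LIMSEQ[OF tsum])
  have S0: "0 \<le> S" using bS[of "{}"] by simp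
  \<comment> \<open>The majorant grows with x, so uniform convergence is used ball by ball, which is
    enough for continuity.\<close>
  have gc: "continuous_on (ball 0 R) g" for R :: real
  proof -
    have "uniform_limit (ball 0 R) (\<lambda>L x. \<Sum>l<L. t l x) (\<lambda>x. \<Sum>l. t l x) sequentially"
    proof (rule Weierstrass_m_test[where M="\<lambda>l. (C * (1 + real CARD('n) * (1 + R))) * B l"])
      fix l and x :: "real^'n" assume "x \<in> ball 0 R"
      then have xR: "norm x \<le> R" by simp
      have "knorm \<kappa> x \<le> real CARD('n) * (1 + R)"
        by (rule order_trans[OF knorm_le[of \<kappa>, OF \<kappa>]]) (use xR in auto)
      then have "(C * (1 + knorm \<kappa> x)) * B l \<le> (C * (1 + real CARD('n) * (1 + R))) * B l"
        using C B0 by (intro mult_right_mono mult_left_mono) auto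
      then show "norm (t l x) \<le> (C * (1 + real CARD('n) * (1 + R))) * B l" using tB[of l x] by linarith
    qed (intro summable_mult Bsum)
    moreover have "continuous_on (ball 0 R) (\<lambda>x. \<Sum>l<L. t l x)" for L
      unfolding t_def by (intro continuous_intros continuous_on_subset[OF Gc]) auto
    ultimately show ?thesis
      unfolding g_def by (intro uniform_limit_theorem[OF always_eventually]) auto
  qed
  have g_cont: "continuous_on UNIV g"
  proof (rule continuous_at_imp_continuous_on, intro ballI)
    fix x :: "real^'n"
    have "x \<in> ball 0 (norm x + 1)" by simp
    then show "isCont g x" using gc[of "norm x + 1"] by (simp add: continuous_on_eq_continuous_at)
  qed
  have "norm (T L x) \<le> (C * S * (1 + real CARD('n))) * (1 + norm x) ^ 1" for L x
  proof -
    have "norm (T L x) \<le> (\<Sum>l<L. (C * (1 + knorm \<kappa> x)) * B l)" unfolding Tt by (rule order_trans[OF norm_sum sum_mono[OF tB]])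
    also have "\<dots> = (C * (1 + knorm \<kappa> x)) * (\<Sum>l<L. B l)" by (simp add: sum_distrib_left)
    also have "\<dots> \<le> (C * (1 + knorm \<kappa> x)) * S" using C by (intro mult_left_mono BS) auto
    also have "\<dots> \<le> (C * ((1 + real CARD('n)) * (1 + norm x))) * S"
    proof -
      have "1 + knorm \<kappa> x \<le> (1 + real CARD('n)) * (1 + norm x)"
        unfolding distrib_right[of 1] mult_1 by (rule add_mono[OF _ knorm_le[of \<kappa> x, OF \<kappa>]]) simp
      then show ?thesis using C S0 by (intro mult_right_mono mult_left_mono) auto
    qed
    finally show ?thesis by (simp add: mult_ac)
  qed
  then have gr: "\<exists>K. \<forall>L x. norm (T L x) \<le> K * (1 + norm x) ^ 1" by blast
  have est: "ennreal (norm (g x - g y)) \<le> ennreal (4 * C) *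
        ((\<integral>\<^sup>+\<rho>\<in>{0<..<knorm \<kappa> (x - y)}. om \<rho> * ennreal (1 / \<rho>) \<partial>lborel) +
          ennreal (knorm \<kappa> (x - y)) * (\<integral>\<^sup>+\<rho>\<in>{knorm \<kappa> (x - y)<..}. om \<rho> * ennreal (1 / \<rho>\<^sup>2) \<partial>lborel))" for x y
  proof (rule LIMSEQ_le_const2)
    show "(\<lambda>L. ennreal (norm (T L x - T L y))) \<longlonglongrightarrow> ennreal (norm (g x - g y))"
      by (intro tendsto_ennrealI tendsto_norm tendsto_diff Tg)
    let ?R = "(\<integral>\<^sup>+\<rho>\<in>{0<..<knorm \<kappa> (x - y)}. om \<rho> * ennreal (1 / \<rho>) \<partial>lborel) +
          ennreal (knorm \<kappa> (x - y)) * (\<integral>\<^sup>+\<rho>\<in>{knorm \<kappa> (x - y)<..}. om \<rho> * ennreal (1 / \<rho>\<^sup>2) \<partial>lborel)"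
    have "ennreal (norm (T L x - T L y)) \<le> ennreal (4 * C) * ?R" for L
    proof -
      define q where "q j = min 1 (knorm \<kappa> (x - y) / dyad j) * W j" for j
      have q0: "0 \<le> q j" for j unfolding q_def using W0[of j] by simp
      have "T L x - T L y = (\<Sum>l<L. (\<lambda>j. G j x - G j y) (int l) + (\<lambda>j. G j x - G j y) (- int l - 1))"
        unfolding Tt t_def sum_subtractf[symmetric] by (intro sum.cong refl) simp
      also have "\<dots> = (\<Sum>j\<in>J L. G j x - G j y)" by (rule Jsum)
      finally have "norm (T L x - T L y) \<le> (\<Sum>j\<in>J L. C * q j)"
        using Gb by (auto simp: q_def intro!: order_trans[OF norm_sum] sum_mono)
      then have "ennreal (norm (T L x - T L y)) \<le> ennreal (C * (\<Sum>j\<in>J L. q j))"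
        by (intro ennreal_leI) (simp add: sum_distrib_left)
      also have "\<dots> = ennreal C * (\<Sum>j\<in>J L. ennreal (q j))" using C q0 by (simp add: ennreal_mult sum_nonneg sum_ennreal)
      also have "\<dots> \<le> ennreal C * (4 * ?R)"
        unfolding q_def W_def by (intro mult_left_mono dyadic_sum_le[OF mono fin _ Jf]) auto
      also have "\<dots> = ennreal (4 * C) * ?R" using C by (simp add: ennreal_mult mult_ac)
      finally show ?thesis .
    qed
    then show "\<exists>N. \<forall>L\<ge>N. ennreal (norm (T L x - T L y)) \<le> ennreal (4 * C) * ?R" by blast
  qed
  show "\<exists>g. continuous_on UNIV g \<and> (\<forall>x. (\<lambda>L. T L x) \<longlonglongrightarrow> g x) \<and> (\<exists>K. \<forall>L x. norm (T L x) \<le> K * (1 + norm x) ^ 1) \<and>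
      (\<forall>x y. ennreal (norm (g x - g y)) \<le> ennreal (4 * C) *
        ((\<integral>\<^sup>+\<rho>\<in>{0<..<knorm \<kappa> (x - y)}. om \<rho> * ennreal (1 / \<rho>) \<partial>lborel) +
          ennreal (knorm \<kappa> (x - y)) * (\<integral>\<^sup>+\<rho>\<in>{knorm \<kappa> (x - y)<..}. om \<rho> * ennreal (1 / \<rho>\<^sup>2) \<partial>lborel)))"
    using g_cont Tg gr est by blast
qed

section \<open>Recovering the polynomial\<close>

lemma omega_f_mono: "mono (omega_f \<kappa> B f)"
  unfolding omega_f_def by (intro monoI SUP_subset_mono) auto

lemma omega_f_bound:
  assumes "finite B" "\<beta> \<in> B" "knorm \<kappa> (x - y) \<le> \<rho>" "omega_f \<kappa> B f \<rho> \<noteq> \<infinity>"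
  shows "norm (f \<beta> x - f \<beta> y) \<le> enn2real (omega_f \<kappa> B f \<rho>)"
proof -
  have "norm (f \<beta> x - f \<beta> y) \<le> (\<Sum>\<beta>\<in>B. norm (f \<beta> x - f \<beta> y))"
    using member_le_sum[OF assms(2), of "\<lambda>\<beta>. norm (f \<beta> x - f \<beta> y)"] assms(1) by simp
  then have "ennreal (norm (f \<beta> x - f \<beta> y)) \<le> ennreal (\<Sum>\<beta>\<in>B. norm (f \<beta> x - f \<beta> y))" by (rule ennreal_leI)
  also have "\<dots> \<le> omega_f \<kappa> B f \<rho>"
    unfolding omega_f_def using SUP_upper[of "(x, y)" "{(x,y). kdist \<kappa> x y \<le> \<rho>}" "\<lambda>p. ennreal (\<Sum>\<beta>\<in>B. norm (f \<beta> (fst p) - f \<beta> (snd p)))"] assms(3)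
    by (simp add: kdist_knorm)
  also have "\<dots> = ennreal (enn2real (omega_f \<kappa> B f \<rho>))" using assms(4) by (simp add: less_top)
  finally show ?thesis by simp
qed

lemma csupp_mono: "csupp R h \<Longrightarrow> R \<le> R' \<Longrightarrow> csupp R' h"
  by (auto simp: csupp_def)

lemma conv_FT_diff:
  assumes \<phi>: "rapid \<phi>" and h: "smooth_fn h1" "csupp R1 h1" "smooth_fn h2" "csupp R2 h2"
  shows "conv \<phi> (FT (\<lambda>\<xi>. h1 \<xi> - h2 \<xi>)) = (\<lambda>x. conv \<phi> (FT h1) x + (-1) * conv \<phi> (FT h2) x)"
proof -
  have c1: "csupp (max R1 R2) (if b then h1 else h2)" for b using h csupp_mono by (cases b) (auto intro: csupp_mono)
  have c2: "smooth_fn (if b then h1 else h2)" for b using h by auto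
  \<comment> \<open>A difference written as a signed sum over \<open>bool\<close>, so that
    \<open>conv_FT_sum\<close> applies with a common support radius.\<close>
  have "conv \<phi> (FT (\<lambda>\<xi>. \<Sum>b\<in>UNIV. (if b then 1 else -1) * (if b then h1 else h2) \<xi>)) =
     (\<lambda>x. \<Sum>b\<in>UNIV. (if b then 1 else -1) * conv \<phi> (FT (if b then h1 else h2)) x)"
    by (rule conv_FT_sum[OF \<phi> finite c2 c1])
  then show ?thesis by (simp add: UNIV_bool)
qed

lemma distD_add:
  assumes "tempered u" "\<phi> \<in> schwartz" "\<psi> \<in> schwartz"
  shows "distD \<alpha> u (\<lambda>x. \<phi> x + c * \<psi> x) = distD \<alpha> u \<phi> + c * distD \<alpha> u \<psi>"
  using tempered_add[OF assms(1) schwartz_Dm[OF assms(2), of \<alpha>] schwartz_Dm[OF assms(3), of \<alpha>], of c]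
  unfolding distD_def Dm_def Dlist_add[OF assms(2,3)] by (simp add: algebra_simps)

text \<open>The passage from list monomials, in which moments are expressed, to the multi-indices
  required by \<open>poly_fn\<close>.\<close>

lemma rmon_count: "rmon ds y = (\<Prod>i\<in>UNIV. complex_of_real (y$i) ^ count_list ds i)"
proof (induction ds)
  case (Cons j ds)
  have "(\<Prod>i\<in>UNIV. complex_of_real (y$i) ^ count_list (j # ds) i)
     = (\<Prod>i\<in>UNIV. (if i = j then complex_of_real (y$j) else 1) * complex_of_real (y$i) ^ count_list ds i)"
    by (intro prod.cong) auto
  also have "\<dots> = complex_of_real (y$j) * rmon ds y" by (simp add: prod.distrib Cons)
  finally show ?case by simp
qed simp

lemma finite_mindex_less: "finite {\<gamma>::'n::finite mindex. \<forall>i. \<gamma> i < M}"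
proof -
  have "{\<gamma>::'n mindex. \<forall>i. \<gamma> i < M} = PiE UNIV (\<lambda>_. {..<M})" by (auto simp: PiE_def)
  then show ?thesis by (simp add: finite_PiE)
qed

lemma poly_bound:
  fixes c :: "'n::finite mindex \<Rightarrow> complex"
  assumes "finite P"
  shows "continuous_on UNIV (\<lambda>x::real^'n. \<Sum>\<gamma>\<in>P. c \<gamma> * (\<Prod>i\<in>UNIV. complex_of_real (x$i) ^ \<gamma> i))"
    and "\<exists>C N. \<forall>x::real^'n. norm (\<Sum>\<gamma>\<in>P. c \<gamma> * (\<Prod>i\<in>UNIV. complex_of_real (x$i) ^ \<gamma> i)) \<le> C * (1 + norm x) ^ N"
proof -
  show "continuous_on UNIV (\<lambda>x::real^'n. \<Sum>\<gamma>\<in>P. c \<gamma> * (\<Prod>i\<in>UNIV. complex_of_real (x$i) ^ \<gamma> i))"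
    by (intro continuous_intros)
  define N where "N = (\<Sum>\<gamma>\<in>P. mlen \<gamma>)"
  have "norm (c \<gamma> * (\<Prod>i\<in>UNIV. complex_of_real (x$i) ^ \<gamma> i)) \<le> norm (c \<gamma>) * (1 + norm x) ^ N" if "\<gamma> \<in> P" for \<gamma> and x :: "real^'n"
  proof -
    have "norm (\<Prod>i\<in>UNIV. complex_of_real (x$i) ^ \<gamma> i) = (\<Prod>i\<in>UNIV. \<bar>x$i\<bar> ^ \<gamma> i)" by (simp add: prod_norm[symmetric] norm_power)
    also have "\<dots> \<le> (\<Prod>i\<in>UNIV. (1 + norm x) ^ \<gamma> i)"
      using component_le_norm_cart[of x] by (intro prod_mono conjI power_mono) (auto intro: order_trans[OF component_le_norm_cart])
    also have "\<dots> = (1 + norm x) ^ mlen \<gamma>" by (simp add: power_sum mlen_def)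
    also have "\<dots> \<le> (1 + norm x) ^ N"
      unfolding N_def using that assms member_le_sum[of \<gamma> P mlen] by (intro power_increasing) auto
    finally show ?thesis by (simp add: norm_mult mult_left_mono)
  qed
  then have "norm (\<Sum>\<gamma>\<in>P. c \<gamma> * (\<Prod>i\<in>UNIV. complex_of_real (x$i) ^ \<gamma> i)) \<le> (\<Sum>\<gamma>\<in>P. norm (c \<gamma>)) * (1 + norm x) ^ N" for x :: "real^'n"
    unfolding sum_distrib_right by (intro order_trans[OF norm_sum] sum_mono) auto
  then show "\<exists>C N. \<forall>x::real^'n. norm (\<Sum>\<gamma>\<in>P. c \<gamma> * (\<Prod>i\<in>UNIV. complex_of_real (x$i) ^ \<gamma> i)) \<le> C * (1 + norm x) ^ N" by blast
qed

text \<open>\<open>finite_functional_span\<close> is applied with Schwartz functions as vectors and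
  moments as functionals; the coefficients it returns are those of Q.\<close>

lemma representation_from_moments:
  fixes u :: "(real^'n::finite \<Rightarrow> complex) \<Rightarrow> complex"
  assumes u: "tempered u" and g: "continuous_on UNIV g" "\<And>x. norm (g x) \<le> K * (1 + norm x) ^ N"
    and ker: "\<And>\<phi>. \<phi> \<in> schwartz \<Longrightarrow> (\<forall>ds. length ds < M \<longrightarrow> (\<integral>y. rmon ds y * \<phi> y \<partial>lborel) = 0) \<Longrightarrow> distD \<alpha> u \<phi> = (\<integral>x. g x * \<phi> x \<partial>lborel)"
  shows "\<exists>Q. poly_fn Q \<and> continuous_on UNIV (\<lambda>x. g x + Q x) \<and> (\<forall>\<phi>\<in>schwartz. integrable lborel (\<lambda>x. (g x + Q x) * \<phi> x)) \<and>
     (\<forall>\<phi>\<in>schwartz. distD \<alpha> u \<phi> = fun_dist (\<lambda>x. g x + Q x) \<phi>)"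
proof -
  \<comment> \<open>Bounding each exponent separately gives a finite set that contains the counts of
    all lists shorter than M.\<close>
  define P where "P = {\<gamma>::'n mindex. \<forall>i. \<gamma> i < M}"
  have Pf: "finite P" unfolding P_def by (rule finite_mindex_less)
  define mm where "mm \<gamma> x = (\<Prod>i\<in>UNIV. complex_of_real (x$i) ^ \<gamma> i)" for \<gamma> and x :: "real^'n"
  have gi: "integrable lborel (\<lambda>x. g x * \<phi> x)" if "\<phi> \<in> schwartz" for \<phi>
    by (rule rapid_mult_growth[OF schwartz_rapid0[OF that] borel_measurable_continuous_onI[OF g(1)] g(2)])
  have mi: "integrable lborel (\<lambda>x. mm \<gamma> x * \<phi> x)" if \<phi>: "\<phi> \<in> schwartz" for \<gamma> \<phi>
  proof -
    obtain C N where "\<And>x::real^'n. norm (\<Sum>\<gamma>\<in>{\<gamma>}. 1 * (\<Prod>i\<in>UNIV. complex_of_real (x$i) ^ \<gamma> i)) \<le> C * (1 + norm x) ^ N"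
      using poly_bound(2)[of "{\<gamma>}" "\<lambda>_. 1"] by blast
    then have b: "\<And>x. norm (mm \<gamma> x) \<le> C * (1 + norm x) ^ N" by (simp add: mm_def)
    have "continuous_on UNIV (mm \<gamma>)" unfolding mm_def by (intro continuous_intros)
    then show ?thesis by (rule rapid_mult_growth[OF schwartz_rapid0[OF \<phi>] borel_measurable_continuous_onI b])
  qed
  have "\<exists>c. \<forall>\<phi>\<in>schwartz. (distD \<alpha> u \<phi> - (\<integral>x. g x * \<phi> x \<partial>lborel)) = (\<Sum>\<gamma>\<in>P. c \<gamma> * (\<integral>x. mm \<gamma> x * \<phi> x \<partial>lborel))"
  proof (rule finite_functional_span[OF Pf, where lc="\<lambda>\<phi> c \<psi> x. \<phi> x + c * \<psi> x"])
    show "(\<lambda>x. \<phi> x + c * \<psi> x) \<in> schwartz" if "\<phi> \<in> schwartz" "\<psi> \<in> schwartz" for \<phi> c \<psi> using that by (rule schwartz_add)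
    have lin: "(\<integral>x. h x * (\<phi> x + c * \<psi> x) \<partial>lborel) = (\<integral>x. h x * \<phi> x \<partial>lborel) + c * (\<integral>x. h x * \<psi> x \<partial>lborel)"
      if "integrable lborel (\<lambda>x. h x * \<phi> x)" "integrable lborel (\<lambda>x. h x * \<psi> x)" for h \<phi> \<psi> :: "real^'n \<Rightarrow> complex" and c
    proof -
      have "(\<integral>x. h x * (\<phi> x + c * \<psi> x) \<partial>lborel) = (\<integral>x. h x * \<phi> x + c * (h x * \<psi> x) \<partial>lborel)" by (simp add: algebra_simps)
      also have "\<dots> = (\<integral>x. h x * \<phi> x \<partial>lborel) + (\<integral>x. c * (h x * \<psi> x) \<partial>lborel)"
        using that by (intro Bochner_Integration.integral_add integrable_mult_right)
      finally show ?thesis by simp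
    qed
    show "(\<integral>x. mm \<gamma> x * (\<phi> x + c * \<psi> x) \<partial>lborel) = (\<integral>x. mm \<gamma> x * \<phi> x \<partial>lborel) + c * (\<integral>x. mm \<gamma> x * \<psi> x \<partial>lborel)"
      if "\<phi> \<in> schwartz" "\<psi> \<in> schwartz" for \<gamma> \<phi> c \<psi> by (rule lin[OF mi[OF that(1)] mi[OF that(2)]])
    show "distD \<alpha> u (\<lambda>x. \<phi> x + c * \<psi> x) - (\<integral>x. g x * (\<phi> x + c * \<psi> x) \<partial>lborel) =
       distD \<alpha> u \<phi> - (\<integral>x. g x * \<phi> x \<partial>lborel) + c * (distD \<alpha> u \<psi> - (\<integral>x. g x * \<psi> x \<partial>lborel))"
      if "\<phi> \<in> schwartz" "\<psi> \<in> schwartz" for \<phi> c \<psi>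
      unfolding lin[OF gi[OF that(1)] gi[OF that(2)]] distD_add[OF u that] by (simp add: algebra_simps)
    fix \<phi> assume \<phi>: "\<phi> \<in> schwartz" and z: "\<forall>\<gamma>\<in>P. (\<integral>x. mm \<gamma> x * \<phi> x \<partial>lborel) = 0"
    have "(\<integral>y. rmon ds y * \<phi> y \<partial>lborel) = 0" if "length ds < M" for ds
    proof -
      have "count_list ds i < M" for i using count_le_length[of ds i] that by linarith
      then have "count_list ds \<in> P" by (simp add: P_def)
      with z have "(\<integral>x. mm (count_list ds) x * \<phi> x \<partial>lborel) = 0" by blast
      then show ?thesis by (simp add: rmon_count mm_def)
    qed
    then show "distD \<alpha> u \<phi> - (\<integral>x. g x * \<phi> x \<partial>lborel) = 0" using ker[OF \<phi>] by simp
  qed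
  then obtain c where c: "\<forall>\<phi>\<in>schwartz. (distD \<alpha> u \<phi> - (\<integral>x. g x * \<phi> x \<partial>lborel)) = (\<Sum>\<gamma>\<in>P. c \<gamma> * (\<integral>x. mm \<gamma> x * \<phi> x \<partial>lborel))" by (elim exE)
  define Q where "Q x = (\<Sum>\<gamma>\<in>P. c \<gamma> * mm \<gamma> x)" for x
  have Qp: "poly_fn Q" unfolding poly_fn_def Q_def mm_def using Pf by blast
  have Qc: "continuous_on UNIV Q" unfolding Q_def mm_def by (rule poly_bound(1)[OF Pf])
  have Qi: "integrable lborel (\<lambda>x. Q x * \<phi> x)" "(\<integral>x. Q x * \<phi> x \<partial>lborel) = (\<Sum>\<gamma>\<in>P. c \<gamma> * (\<integral>x. mm \<gamma> x * \<phi> x \<partial>lborel))"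
    if \<phi>: "\<phi> \<in> schwartz" for \<phi>
  proof -
    have e: "(\<lambda>x. Q x * \<phi> x) = (\<lambda>x. \<Sum>\<gamma>\<in>P. c \<gamma> * (mm \<gamma> x * \<phi> x))" by (simp add: Q_def sum_distrib_right mult.assoc)
    show "integrable lborel (\<lambda>x. Q x * \<phi> x)" unfolding e by (intro Bochner_Integration.integrable_sum integrable_mult_right mi \<phi>)
    show "(\<integral>x. Q x * \<phi> x \<partial>lborel) = (\<Sum>\<gamma>\<in>P. c \<gamma> * (\<integral>x. mm \<gamma> x * \<phi> x \<partial>lborel))"
      unfolding e by (subst Bochner_Integration.integral_sum) (auto intro: mi[OF \<phi>])
  qed
  have I: "integrable lborel (\<lambda>x. (g x + Q x) * \<phi> x)" if "\<phi> \<in> schwartz" for \<phi>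
    unfolding distrib_right by (intro Bochner_Integration.integrable_add gi Qi that)
  have "distD \<alpha> u \<phi> = fun_dist (\<lambda>x. g x + Q x) \<phi>" if \<phi>: "\<phi> \<in> schwartz" for \<phi>
  proof -
    have "fun_dist (\<lambda>x. g x + Q x) \<phi> = (\<integral>x. g x * \<phi> x \<partial>lborel) + (\<integral>x. Q x * \<phi> x \<partial>lborel)"
      unfolding fun_dist_def distrib_right by (rule Bochner_Integration.integral_add[OF gi[OF \<phi>] Qi(1)[OF \<phi>]])
    also have "\<dots> = distD \<alpha> u \<phi>" unfolding Qi(2)[OF \<phi>] c[rule_format, OF \<phi>, symmetric] by simp
    finally show ?thesis by simp
  qed
  then show ?thesis using Qp Qc I g(1) by (intro exI[of _ Q]) (auto intro!: continuous_intros)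
qed

section \<open>The estimate\<close>

text \<open>The constant is fixed before a, f and u. It is assembled from the uniform kernel decay,
  the numerical factor of \<open>kernel_estimate\<close>, the number of \<beta>, the Fourier
  constant and the 4 of the dyadic comparison.\<close>

lemma schauder_fixed_alpha:
  fixes \<kappa> :: "'n::finite \<Rightarrow> nat"
  assumes \<kappa>: "\<And>l. 1 \<le> \<kappa> l" and fin: "finite A" "finite B"
    and hom: "\<forall>\<alpha>\<in>A. \<forall>\<beta>\<in>B. mdot (madd \<alpha> \<beta>) \<kappa> = m" and lam: "0 < lam"
    and \<alpha>: "\<forall>\<beta>\<in>B. mdot (madd \<alpha> \<beta>) \<kappa> = m"
  shows "\<exists>C\<ge>0. \<forall>a f u. a \<in> adm \<kappa> A B m lam Lam \<longrightarrow>
     (\<forall>\<beta>\<in>B. continuous_on UNIV (f \<beta>) \<and> poly_growth (f \<beta>)) \<longrightarrow> tempered u \<longrightarrow>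
     (\<forall>\<phi>\<in>schwartz. (\<Sum>\<alpha>\<in>A. \<Sum>\<beta>\<in>B. a \<alpha> \<beta> * distD (madd \<alpha> \<beta>) u \<phi>) = (\<Sum>\<beta>\<in>B. distD \<beta> (fun_dist (f \<beta>)) \<phi>)) \<longrightarrow>
     (\<integral>\<^sup>+ \<rho>\<in>{0<..<1}. omega_f \<kappa> B f \<rho> * ennreal (1 / \<rho>) \<partial>lborel) < \<infinity> \<longrightarrow>
     (\<integral>\<^sup>+ \<rho>\<in>{1<..}. omega_f \<kappa> B f \<rho> * ennreal (1 / \<rho>\<^sup>2) \<partial>lborel) < \<infinity> \<longrightarrow>
     (\<exists>g Q. continuous_on UNIV g \<and>
           (\<forall>\<phi>\<in>schwartz. integrable lborel (\<lambda>x. g x * \<phi> x)) \<and>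
           (\<forall>\<phi>\<in>schwartz. distD \<alpha> u \<phi> = fun_dist g \<phi>) \<and> poly_fn Q \<and>
           (\<forall>x y. ennreal (norm ((g x - Q x) - (g y - Q y))) \<le> ennreal C *
                ((\<integral>\<^sup>+ \<rho>\<in>{0<..<kdist \<kappa> x y}. omega_f \<kappa> B f \<rho> * ennreal (1 / \<rho>) \<partial>lborel)
                 + ennreal (kdist \<kappa> x y) * (\<integral>\<^sup>+ \<rho>\<in>{kdist \<kappa> x y<..}. omega_f \<kappa> B f \<rho> * ennreal (1 / \<rho>\<^sup>2) \<partial>lborel))))"
proof -
  define D where "D = Max (range \<kappa>)"
  have D: "\<kappa> l \<le> D" for l unfolding D_def by (rule Max_ge) auto
  obtain c0 where c0: "c0 \<noteq> 0" "\<forall>h R. csupp R h \<longrightarrow> rapid (FT h) \<longrightarrow> (\<integral>x. FT h x \<partial>lborel) = c0 * h (0::real^'n)"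
    using integral_FT[where 'n='n] by blast
  have ceta: "(\<integral>y. FT (eta :: real^'n \<Rightarrow> complex) y \<partial>lborel) = c0"
    using c0(2)[rule_format, OF csupp_eta FT_rapid[OF smooth_fn_eta csupp_eta]] by (simp add: eta_1)
  define Pw where "Pw = 2 * CARD('n) + D"
  define hs where "hs a \<beta> \<xi> = imon (madd \<alpha> \<beta>) \<xi> * Esym \<kappa> A B a \<xi>" for a \<beta> \<xi>
  have "\<forall>\<beta>. \<exists>M. \<forall>a\<in>adm \<kappa> A B m lam Lam. \<forall>y. (1 + norm y) ^ Pw * norm (FT (hs a \<beta>) y) \<le> M \<and>
      (\<forall>i. (1 + norm y) ^ Pw * norm (FT (\<lambda>\<xi>. \<i> * of_real (\<xi>$i) * hs a \<beta> \<xi>) y) \<le> M)"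
    unfolding hs_def using kernel_bounds[OF \<kappa> D fin hom lam, of Lam Pw] by blast
  from choice[OF this] obtain M where M: "\<forall>\<beta>. \<forall>a\<in>adm \<kappa> A B m lam Lam. \<forall>y. (1 + norm y) ^ Pw * norm (FT (hs a \<beta>) y) \<le> M \<beta> \<and>
      (\<forall>i. (1 + norm y) ^ Pw * norm (FT (\<lambda>\<xi>. \<i> * of_real (\<xi>$i) * hs a \<beta> \<xi>) y) \<le> M \<beta>)" by (elim exE)
  define Mt where "Mt = (\<Sum>\<beta>\<in>B. \<bar>M \<beta>\<bar>)"
  have Mt0: "0 \<le> Mt" unfolding Mt_def by (rule sum_nonneg) simp
  have MMt: "M \<beta> \<le> Mt" if "\<beta> \<in> B" for \<beta> unfolding Mt_def using member_le_sum[OF that, of "\<lambda>\<beta>. \<bar>M \<beta>\<bar>"] fin by auto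
  \<comment> \<open>C1 is the numerical factor of \<open>kernel_estimate\<close>; C0 below also sums
    over \<beta> and divides by c0.\<close>
  define C1 where "C1 = (2 + real CARD('n) * (1 + real CARD('n)) ^ (2 * CARD('n) + D)) * (real CARD('n) + 2) ^ D * wint TYPE('n)"
  have C10: "0 \<le> C1" unfolding C1_def by (intro mult_nonneg_nonneg wint_nonneg add_nonneg_nonneg zero_le_power) auto
  define C0 where "C0 = norm (inverse c0) * (real (card B) * (C1 * Mt))"
  have C00: "0 \<le> C0" unfolding C0_def using C10 Mt0 by simp
  show ?thesis
  proof (intro exI[of _ "4 * C0"] conjI allI impI)
    show "0 \<le> 4 * C0" using C00 by simp
    fix a f and u :: "(real^'n \<Rightarrow> complex) \<Rightarrow> complex"
    assume a: "a \<in> adm \<kappa> A B m lam Lam" and f: "\<forall>\<beta>\<in>B. continuous_on UNIV (f \<beta>) \<and> poly_growth (f \<beta>)" and u: "tempered u"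
      and pde: "\<forall>\<phi>\<in>schwartz. (\<Sum>\<alpha>\<in>A. \<Sum>\<beta>\<in>B. a \<alpha> \<beta> * distD (madd \<alpha> \<beta>) u \<phi>) = (\<Sum>\<beta>\<in>B. distD \<beta> (fun_dist (f \<beta>)) \<phi>)"
      and i0: "(\<integral>\<^sup>+ \<rho>\<in>{0<..<1}. omega_f \<kappa> B f \<rho> * ennreal (1 / \<rho>) \<partial>lborel) < \<infinity>"
      and i1: "(\<integral>\<^sup>+ \<rho>\<in>{1<..}. omega_f \<kappa> B f \<rho> * ennreal (1 / \<rho>\<^sup>2) \<partial>lborel) < \<infinity>"
    define om where "om = omega_f \<kappa> B f"
    have om: "mono om" unfolding om_def by (rule omega_f_mono)
    have omfin: "om \<rho> \<noteq> \<infinity>" for \<rho> by (rule modulus_finite[OF om i1[folded om_def]])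
    note cE = csupp_Esym[OF \<kappa> D fin hom lam a]
    have hsc: "csupp (2 * 2 ^ D) (hs a \<beta>)" for \<beta> unfolding hs_def by (intro csupp_mult cE continuous_on_imon)
    have hss: "smooth_fn (hs a \<beta>)" for \<beta> unfolding hs_def by (rule smooth_fn_mult[OF smooth_fn_imon cE(2)])
    have hsr: "rapid (FT (hs a \<beta>))" for \<beta> by (rule FT_rapid[OF hss hsc])
    \<comment> \<open>The multiplier vanishes at the origin together with \<open>Esym\<close>, so
      inversion at the origin gives mean zero.\<close>
    have hs0: "(\<integral>y. FT (hs a \<beta>) y \<partial>lborel) = 0" for \<beta>
      using c0(2)[rule_format, OF hsc hsr] Esym_at_0[of \<kappa> A B a, OF \<kappa>] by (simp add: hs_def)
    define K where "K \<beta> j x = (\<integral>y. f \<beta> (x + dil \<kappa> (dyad j) y) * FT (hs a \<beta>) y \<partial>lborel)" for \<beta> j x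
    have Kest: "norm (K \<beta> j x - K \<beta> j y) \<le> (C1 * Mt) * min 1 (knorm \<kappa> (x - y) / dyad j) * enn2real (om (dyad j))"
      if \<beta>: "\<beta> \<in> B" for \<beta> j x y
    proof -
      obtain Cf N where CN: "\<And>x. norm (f \<beta> x) \<le> Cf * (1 + norm x) ^ N"
        using bspec[OF f \<beta>] unfolding poly_growth_def by (elim conjE exE) auto
      show ?thesis unfolding K_def C1_def
      proof (rule kernel_estimate[OF \<kappa> D dyad_pos _ CN _ hsr hs0])
        show "continuous_on UNIV (f \<beta>)" using f \<beta> by blast
        show "norm (f \<beta> x - f \<beta> y) \<le> enn2real (om (dyad j))" if "knorm \<kappa> (x - y) \<le> dyad j" for x y
          unfolding om_def by (rule omega_f_bound[OF fin(2) \<beta> that omfin[unfolded om_def]])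
        show "has_pd (FT (hs a \<beta>)) i (FT (\<lambda>\<xi>. \<i> * of_real (\<xi>$i) * hs a \<beta> \<xi>))" for i by (rule FT_has_pd[OF hsc])
        show "(1 + norm y) ^ (2 * CARD('n) + D) * norm (FT (hs a \<beta>) y) \<le> Mt" for y
          using M[rule_format, OF a, of y \<beta>] MMt[OF \<beta>] unfolding Pw_def by linarith
        show "(1 + norm y) ^ (2 * CARD('n) + D) * norm (FT (\<lambda>\<xi>. \<i> * of_real (\<xi>$i) * hs a \<beta> \<xi>) y) \<le> Mt" for i y
          using conjunct2[OF M[rule_format, OF a, of y \<beta>], rule_format, of i] MMt[OF \<beta>] unfolding Pw_def by linarith
      qed
    qed
    have Kc: "continuous_on UNIV (K \<beta> j)" if "\<beta> \<in> B" for \<beta> j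
      by (rule dyadic_series(1)[OF \<kappa> om i0[folded om_def] i1[folded om_def] _ Kest[OF that]]) (use C10 Mt0 in simp)
    have Ki: "integrable lborel (\<lambda>x. K \<beta> j x * \<phi> x)" if \<beta>: "\<beta> \<in> B" and \<phi>: "\<phi> \<in> schwartz" for \<beta> j \<phi>
    proof (rule rapid_mult_growth[OF schwartz_rapid0[OF \<phi>] borel_measurable_continuous_onI[OF Kc[OF \<beta>]]])
      fix x
      have "norm (K \<beta> j x) \<le> norm (K \<beta> j x - K \<beta> j 0) + norm (K \<beta> j 0)" using norm_triangle_ineq[of "K \<beta> j x - K \<beta> j 0" "K \<beta> j 0"] by simp
      also have "norm (K \<beta> j x - K \<beta> j 0) \<le> (C1 * Mt) * 1 * enn2real (om (dyad j))"
        by (rule order_trans[OF Kest[OF \<beta>]]) (intro mult_right_mono mult_left_mono mult_nonneg_nonneg C10 Mt0, auto)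
      finally show "norm (K \<beta> j x) \<le> (C1 * Mt * enn2real (om (dyad j)) + norm (K \<beta> j 0)) * (1 + norm x) ^ 0" by simp
    qed
    define sg where "sg \<beta> = (-1::complex) ^ (mlen \<alpha> + mlen \<beta>)" for \<beta> :: "'n mindex"
    \<comment> \<open>Dividing by c0 compensates the mass c0 of the approximate identity built from
      \<open>eta\<close>.\<close>
    define G where "G j x = inverse c0 * (\<Sum>\<beta>\<in>B. sg \<beta> * K \<beta> j x)" for j x
    have Gest: "norm (G j x - G j y) \<le> C0 * min 1 (knorm \<kappa> (x - y) / dyad j) * enn2real (om (dyad j))" for j x y
    proof -
      define mw where "mw = min 1 (knorm \<kappa> (x - y) / dyad j) * enn2real (om (dyad j))"
      have "G j x - G j y = inverse c0 * (\<Sum>\<beta>\<in>B. sg \<beta> * (K \<beta> j x - K \<beta> j y))"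
        by (simp add: G_def right_diff_distrib sum_subtractf)
      then have "norm (G j x - G j y) \<le> norm (inverse c0) * (\<Sum>\<beta>\<in>B. norm (sg \<beta> * (K \<beta> j x - K \<beta> j y)))"
        by (simp only: norm_mult[of "inverse c0"]) (intro mult_left_mono norm_sum norm_ge_zero)
      also have "\<dots> \<le> norm (inverse c0) * (\<Sum>\<beta>\<in>B. (C1 * Mt) * mw)"
      proof (intro mult_left_mono sum_mono)
        fix \<beta> assume "\<beta> \<in> B"
        from Kest[OF this, of j x y] show "norm (sg \<beta> * (K \<beta> j x - K \<beta> j y)) \<le> (C1 * Mt) * mw"
          by (simp add: norm_mult norm_power sg_def mw_def mult.assoc)
      qed simp
      also have "\<dots> = C0 * mw" by (simp add: C0_def mult_ac)
      finally show ?thesis by (simp add: mw_def mult.assoc)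
    qed
    note DS = dyadic_series[OF \<kappa> om i0[folded om_def] i1[folded om_def] C00 Gest]
    define T where "T L x = (\<Sum>l<L. (G (int l) x - G (int l) 0) + (G (- int l - 1) x - G (- int l - 1) 0))" for L x
    obtain g0 where g0: "continuous_on UNIV g0" "\<forall>x. (\<lambda>L. T L x) \<longlonglongrightarrow> g0 x" "\<exists>K. \<forall>L x. norm (T L x) \<le> K * (1 + norm x) ^ 1"
      and g0est: "\<forall>x y. ennreal (norm (g0 x - g0 y)) \<le> ennreal (4 * C0) *
        ((\<integral>\<^sup>+\<rho>\<in>{0<..<knorm \<kappa> (x - y)}. om \<rho> * ennreal (1 / \<rho>) \<partial>lborel) +
          ennreal (knorm \<kappa> (x - y)) * (\<integral>\<^sup>+\<rho>\<in>{knorm \<kappa> (x - y)<..}. om \<rho> * ennreal (1 / \<rho>\<^sup>2) \<partial>lborel))"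
      using DS(2) unfolding T_def by blast
    obtain Kg where Kg: "\<And>L x. norm (T L x) \<le> Kg * (1 + norm x) ^ 1" using g0(3) by blast
    have g0b: "norm (g0 x) \<le> Kg * (1 + norm x) ^ 1" for x
      by (rule LIMSEQ_le_const2[OF tendsto_norm[OF g0(2)[rule_format, of x]]]) (use Kg in blast)
    have Gc: "continuous_on UNIV (G j)" for j by (rule DS(1))
    have Gi: "integrable lborel (\<lambda>x. G j x * \<phi> x)" if \<phi>: "\<phi> \<in> schwartz" for j \<phi>
    proof -
      have "(\<lambda>x. G j x * \<phi> x) = (\<lambda>x. \<Sum>\<beta>\<in>B. (inverse c0 * sg \<beta>) * (K \<beta> j x * \<phi> x))"
        by (simp add: G_def sum_distrib_left sum_distrib_right mult.assoc)
      then show ?thesis using Ki[OF _ \<phi>] by (auto intro!: Bochner_Integration.integrable_sum integrable_mult_right)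
    qed
    have piece: "distD \<alpha> u (conv \<phi> (FT (\<lambda>\<xi>. chi \<kappa> (dil \<kappa> (dyad j) \<xi>)))) = c0 * (\<integral>x. G j x * \<phi> x \<partial>lborel)" if \<phi>: "\<phi> \<in> schwartz" for \<phi> j
    proof -
      have "distD \<alpha> u (conv \<phi> (FT (\<lambda>\<xi>. chi \<kappa> (dil \<kappa> (dyad j) \<xi>)))) = (\<Sum>\<beta>\<in>B. sg \<beta> * (\<integral>x. \<phi> x * K \<beta> j x \<partial>lborel))"
        unfolding sg_def K_def hs_def[abs_def]
        by (rule piece_identity[OF \<kappa> D fin hom lam a u \<alpha> _ _ _ \<phi> dyad_pos]) (use f pde in blast)+
      also have "\<dots> = (\<Sum>\<beta>\<in>B. (\<integral>x. sg \<beta> * (K \<beta> j x * \<phi> x) \<partial>lborel))" by (simp add: mult.commute)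
      also have "\<dots> = (\<integral>x. (\<Sum>\<beta>\<in>B. sg \<beta> * (K \<beta> j x * \<phi> x)) \<partial>lborel)"
        by (rule Bochner_Integration.integral_sum[symmetric]) (intro integrable_mult_right Ki \<phi>)
      also have "\<dots> = (\<integral>x. c0 * (G j x * \<phi> x) \<partial>lborel)"
        using c0(1) by (simp add: G_def sum_distrib_right mult.assoc)
      finally show ?thesis by simp
    qed
    \<comment> \<open>D^\<alpha> u cut off to frequencies up to anisotropic size about 2^j and
      tested with \<phi>. Since \<open>chi\<close> is a difference of dilated copies of
      \<open>eta\<close>, the pieces telescope in E.\<close>
    define E where "E \<phi> j = distD \<alpha> u (conv \<phi> (FT (\<lambda>\<xi>. eta (dil \<kappa> (dyad j) \<xi>))))" for \<phi> j
    have Ediff: "E \<phi> (j + 1) - E \<phi> j = c0 * (\<integral>x. G j x * \<phi> x \<partial>lborel)" if \<phi>: "\<phi> \<in> schwartz" for \<phi> j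
    proof -
      have dd: "dil \<kappa> (1/2) (dil \<kappa> (dyad j) \<xi>) = dil \<kappa> (dyad (j + 1)) \<xi>" for \<xi>
        by (simp add: vec_eq_iff power_mult_distrib[symmetric] power_int_diff mult.assoc[symmetric] power_int_minus power_int_add)
      have ch: "(\<lambda>\<xi>. chi \<kappa> (dil \<kappa> (dyad j) \<xi>)) = (\<lambda>\<xi>. eta (dil \<kappa> (dyad (j + 1)) \<xi>) - eta (dil \<kappa> (dyad j) \<xi>))"
        by (simp add: chi_def dd)
      obtain R1 where R1: "csupp R1 (\<lambda>\<xi>. eta (dil \<kappa> (dyad (j + 1)) \<xi>))" using csupp_dil[OF csupp_eta dyad_pos] by blast
      obtain R2 where R2: "csupp R2 (\<lambda>\<xi>. eta (dil \<kappa> (dyad j) \<xi>))" using csupp_dil[OF csupp_eta dyad_pos] by blast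
      note se = smooth_fn_dil[OF smooth_fn_eta]
      have "c0 * (\<integral>x. G j x * \<phi> x \<partial>lborel) = distD \<alpha> u (\<lambda>x. conv \<phi> (FT (\<lambda>\<xi>. eta (dil \<kappa> (dyad (j + 1)) \<xi>))) x + (-1) * conv \<phi> (FT (\<lambda>\<xi>. eta (dil \<kappa> (dyad j) \<xi>))) x)"
        unfolding piece[OF \<phi>, symmetric] ch conv_FT_diff[OF schwartz_rapid0[OF \<phi>] se R1 se R2] ..
      also have "\<dots> = E \<phi> (j + 1) + (-1) * E \<phi> j"
        unfolding E_def by (intro distD_add u conv_schwartz \<phi> FT_rapid[OF se R1] FT_rapid[OF se R2])
      finally show ?thesis by simp
    qed
    have tele: "E \<phi> (int L) - E \<phi> (- int L) = c0 * (\<integral>x. T L x * \<phi> x \<partial>lborel)" if \<phi>: "\<phi> \<in> schwartz" and \<phi>0: "(\<integral>x. \<phi> x \<partial>lborel) = 0" for \<phi> L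
    proof -
      \<comment> \<open>Mean zero of \<phi> makes the normalisation of the pieces at the origin
        invisible.\<close>
      have G0: "integrable lborel (\<lambda>x. (G j x - G j 0) * \<phi> x)" "(\<integral>x. (G j x - G j 0) * \<phi> x \<partial>lborel) = (\<integral>x. G j x * \<phi> x \<partial>lborel)" for j
        unfolding left_diff_distrib using Gi[OF \<phi>] rapid_integrable[OF schwartz_rapid0[OF \<phi>]] \<phi>0 by auto
      have "E \<phi> (int L) - E \<phi> (- int L) = (\<Sum>l<L. (E \<phi> (int l + 1) - E \<phi> (int l)) + (E \<phi> ((- int l - 1) + 1) - E \<phi> (- int l - 1)))"
      proof (induction L)
        case (Suc L)
        have e: "int (Suc L) = int L + 1" "- (int L + 1) = - int L - 1" by simp_all
        show ?case unfolding sum.lessThan_Suc Suc.IH[symmetric] e by simp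
      qed simp
      also have "\<dots> = (\<Sum>l<L. c0 * (\<integral>x. (G (int l) x - G (int l) 0) * \<phi> x + (G (- int l - 1) x - G (- int l - 1) 0) * \<phi> x \<partial>lborel))"
        unfolding Ediff[OF \<phi>] using G0 by (simp add: distrib_left)
      also have "\<dots> = c0 * (\<integral>x. (\<Sum>l<L. (G (int l) x - G (int l) 0) * \<phi> x + (G (- int l - 1) x - G (- int l - 1) 0) * \<phi> x) \<partial>lborel)"
        unfolding sum_distrib_left[symmetric]
        by (subst Bochner_Integration.integral_sum) (auto intro!: Bochner_Integration.integrable_add G0)
      also have "\<dots> = c0 * (\<integral>x. T L x * \<phi> x \<partial>lborel)" by (simp add: T_def sum_distrib_right distrib_right)
      finally show ?thesis .
    qed
    obtain M0 where M0: "\<forall>\<phi>\<in>schwartz. (\<forall>ds. length ds < M0 \<longrightarrow> (\<integral>y. rmon ds y * \<phi> y \<partial>lborel) = 0) \<longrightarrow>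
       (\<exists>C. \<forall>\<epsilon>. 0 < \<epsilon> \<longrightarrow> \<epsilon> \<le> 1 \<longrightarrow> norm (distD \<alpha> u (conv \<phi> (FT (\<lambda>\<xi>. eta (dil \<kappa> (inverse \<epsilon>) \<xi>))))) \<le> C * \<epsilon>)"
      using distD_vanishing_moments[OF u smooth_fn_eta csupp_eta, of \<kappa> D \<alpha>, OF \<kappa> D] by blast
    have half: "(\<lambda>L. C * (1/2::real) ^ L) \<longlonglongrightarrow> 0" for C by (intro tendsto_mult_right_zero LIMSEQ_power_zero) simp
    have dyL: "dyad (int L) = (1/2) ^ L" "dyad (- int L) = inverse ((1/2) ^ L)" for L
      by (simp_all add: power_int_minus power_one_over inverse_eq_divide)
    \<comment> \<open>Moments below \<open>Suc M0\<close> are taken so that the zeroth one vanishes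
      even when M0 is 0; the telescoping identity relies on it.\<close>
    have main: "distD \<alpha> u \<phi> = (\<integral>x. g0 x * \<phi> x \<partial>lborel)"
      if \<phi>: "\<phi> \<in> schwartz" and mom: "\<forall>ds. length ds < Suc M0 \<longrightarrow> (\<integral>y. rmon ds y * \<phi> y \<partial>lborel) = 0" for \<phi>
    proof -
      have \<phi>0: "(\<integral>x. \<phi> x \<partial>lborel) = 0" using mom[rule_format, of "[]"] by simp
      obtain Ca where Ca: "\<And>s. 0 < s \<Longrightarrow> s \<le> 1 \<Longrightarrow> norm (distD \<alpha> u (conv \<phi> (FT (\<lambda>\<xi>. eta (dil \<kappa> s \<xi>)))) - c0 * distD \<alpha> u \<phi>) \<le> Ca * s"
        using distD_approximate_identity[OF u \<phi> smooth_fn_eta csupp_eta, of \<kappa> \<alpha>, OF \<kappa>] unfolding ceta by blast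
      obtain Cb where Cb: "\<And>\<epsilon>. 0 < \<epsilon> \<Longrightarrow> \<epsilon> \<le> 1 \<Longrightarrow> norm (distD \<alpha> u (conv \<phi> (FT (\<lambda>\<xi>. eta (dil \<kappa> (inverse \<epsilon>) \<xi>))))) \<le> Cb * \<epsilon>"
        using M0 \<phi> mom less_SucI by meson
      have "(\<lambda>L. E \<phi> (int L) - c0 * distD \<alpha> u \<phi>) \<longlonglongrightarrow> 0"
        by (rule Lim_null_comparison[OF _ half[of Ca]]) (auto simp: E_def dyL intro!: always_eventually Ca power_le_one)
      then have l1: "(\<lambda>L. E \<phi> (int L)) \<longlonglongrightarrow> c0 * distD \<alpha> u \<phi>" by (simp add: LIM_zero_iff)
      have l2: "(\<lambda>L. E \<phi> (- int L)) \<longlonglongrightarrow> 0"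
        by (rule Lim_null_comparison[OF _ half[of Cb]]) (auto simp only: E_def dyL intro!: always_eventually Cb power_le_one, auto)
      have wi: "integrable lborel (\<lambda>x. (Kg * (1 + norm x) ^ 1) * norm (\<phi> x))"
      proof -
        have "integrable lborel (\<lambda>x. complex_of_real (Kg * (1 + norm x) ^ 1) * \<phi> x)"
          by (rule rapid_mult_growth[OF schwartz_rapid0[OF \<phi>], where C="\<bar>Kg\<bar>" and N=1]) (auto simp: norm_mult simp del: of_real_add)
        from integrable_norm[OF this] have "integrable lborel (\<lambda>x. \<bar>Kg * (1 + norm x) ^ 1\<bar> * norm (\<phi> x))"
          by (simp only: norm_mult norm_of_real)
        moreover have "0 \<le> Kg" using order_trans[OF norm_ge_zero Kg[of 0 0]] by simp
        ultimately show ?thesis by (simp add: abs_mult)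
      qed
      have l3: "(\<lambda>L. \<integral>x. T L x * \<phi> x \<partial>lborel) \<longlonglongrightarrow> (\<integral>x. g0 x * \<phi> x \<partial>lborel)"
      proof (rule integral_dominated_convergence[where w="\<lambda>x. (Kg * (1 + norm x) ^ 1) * norm (\<phi> x)"])
        have pm: "\<phi> \<in> borel_measurable borel" by (rule rapid_measurable[OF schwartz_rapid0[OF \<phi>]])
        have "continuous_on UNIV (T L)" for L unfolding T_def by (intro continuous_intros Gc)
        then have "T L \<in> borel_measurable borel" for L by (rule borel_measurable_continuous_onI)
        then show "(\<lambda>x. T L x * \<phi> x) \<in> borel_measurable lborel" for L using pm by simp
        show "(\<lambda>x. g0 x * \<phi> x) \<in> borel_measurable lborel" using pm borel_measurable_continuous_onI[OF g0(1)] by simp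
        show "AE x in lborel. (\<lambda>L. T L x * \<phi> x) \<longlonglongrightarrow> g0 x * \<phi> x" using g0(2) by (intro AE_I2 tendsto_intros) auto
        show "AE x in lborel. norm (T L x * \<phi> x) \<le> (Kg * (1 + norm x) ^ 1) * norm (\<phi> x)" for L
          unfolding norm_mult by (intro AE_I2 mult_right_mono Kg) auto
      qed (rule wi)
      have "(\<lambda>L. E \<phi> (int L) - E \<phi> (- int L)) \<longlonglongrightarrow> c0 * (\<integral>x. g0 x * \<phi> x \<partial>lborel)"
        unfolding tele[OF \<phi> \<phi>0] by (intro tendsto_intros l3)
      moreover have "(\<lambda>L. E \<phi> (int L) - E \<phi> (- int L)) \<longlonglongrightarrow> c0 * distD \<alpha> u \<phi> - 0" by (intro tendsto_diff l1 l2)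
      ultimately have "c0 * (\<integral>x. g0 x * \<phi> x \<partial>lborel) = c0 * distD \<alpha> u \<phi> - 0" by (rule LIMSEQ_unique)
      then show ?thesis using c0(1) by simp
    qed
    obtain Q where Q: "poly_fn Q" "continuous_on UNIV (\<lambda>x. g0 x + Q x)" "\<forall>\<phi>\<in>schwartz. integrable lborel (\<lambda>x. (g0 x + Q x) * \<phi> x)"
       "\<forall>\<phi>\<in>schwartz. distD \<alpha> u \<phi> = fun_dist (\<lambda>x. g0 x + Q x) \<phi>"
      using representation_from_moments[OF u g0(1) g0b main] by blast
    show "\<exists>g Q. continuous_on UNIV g \<and>
           (\<forall>\<phi>\<in>schwartz. integrable lborel (\<lambda>x. g x * \<phi> x)) \<and>
           (\<forall>\<phi>\<in>schwartz. distD \<alpha> u \<phi> = fun_dist g \<phi>) \<and> poly_fn Q \<and>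
           (\<forall>x y. ennreal (norm ((g x - Q x) - (g y - Q y))) \<le> ennreal (4 * C0) *
                ((\<integral>\<^sup>+ \<rho>\<in>{0<..<kdist \<kappa> x y}. omega_f \<kappa> B f \<rho> * ennreal (1 / \<rho>) \<partial>lborel)
                 + ennreal (kdist \<kappa> x y) * (\<integral>\<^sup>+ \<rho>\<in>{kdist \<kappa> x y<..}. omega_f \<kappa> B f \<rho> * ennreal (1 / \<rho>\<^sup>2) \<partial>lborel)))"
    proof (rule exI[of _ "\<lambda>x. g0 x + Q x"], rule exI[of _ Q], intro conjI Q)
      show "\<forall>x y. ennreal (norm ((g0 x + Q x - Q x) - (g0 y + Q y - Q y))) \<le> ennreal (4 * C0) *
                ((\<integral>\<^sup>+ \<rho>\<in>{0<..<kdist \<kappa> x y}. omega_f \<kappa> B f \<rho> * ennreal (1 / \<rho>) \<partial>lborel)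
                 + ennreal (kdist \<kappa> x y) * (\<integral>\<^sup>+ \<rho>\<in>{kdist \<kappa> x y<..}. omega_f \<kappa> B f \<rho> * ennreal (1 / \<rho>\<^sup>2) \<partial>lborel))"
        using g0est unfolding om_def kdist_knorm by simp
    qed
  qed
qed

text \<open>Completeness puts every admissible \<alpha> into the finite set A, so the nonnegative
  constants for the single \<alpha> add up to one C that precedes a, f and u.\<close>

theorem theorem2p2:
  fixes \<kappa> :: "'n::finite \<Rightarrow> nat"
    and A B :: "'n mindex set"
    and m :: nat
    and lam Lam :: real
  assumes kappa_pos: "\<forall>l. \<kappa> l \<ge> 1"
    and finA: "finite A" and finB: "finite B"
    and hom: "\<forall>\<alpha>\<in>A. \<forall>\<beta>\<in>B. mdot (madd \<alpha> \<beta>) \<kappa> = m"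
    and compl: "B_complete A B \<kappa> m"
    and lam_pos: "0 < lam" and lam_Lam: "lam < Lam"
  shows "\<exists>C::real. \<forall>(a :: 'n mindex \<Rightarrow> 'n mindex \<Rightarrow> complex)
                      (f :: 'n mindex \<Rightarrow> real^'n \<Rightarrow> complex)
                      (u :: (real^'n \<Rightarrow> complex) \<Rightarrow> complex).
     (\<forall>\<xi>. lam * knorm \<kappa> \<xi> ^ m \<le> norm (symb A B a \<xi>) \<and>
          norm (symb A B a \<xi>) \<le> Lam * knorm \<kappa> \<xi> ^ m) \<and>
     (\<forall>\<beta>\<in>B. continuous_on UNIV (f \<beta>) \<and> poly_growth (f \<beta>)) \<and>
     tempered u \<and>
     (\<forall>\<phi>\<in>schwartz.
        (\<Sum>\<alpha>\<in>A. \<Sum>\<beta>\<in>B. a \<alpha> \<beta> * distD (madd \<alpha> \<beta>) u \<phi>) =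
        (\<Sum>\<beta>\<in>B. distD \<beta> (fun_dist (f \<beta>)) \<phi>)) \<and>
     (\<integral>\<^sup>+ \<rho>\<in>{0<..<1}. omega_f \<kappa> B f \<rho> * ennreal (1 / \<rho>) \<partial>lborel) < \<infinity> \<and>
     (\<integral>\<^sup>+ \<rho>\<in>{1<..}. omega_f \<kappa> B f \<rho> * ennreal (1 / \<rho>\<^sup>2) \<partial>lborel) < \<infinity>
     \<longrightarrow>
     (\<forall>\<alpha>::'n mindex. (\<forall>\<beta>\<in>B. mdot (madd \<alpha> \<beta>) \<kappa> = m) \<longrightarrow>
        (\<exists>g Q. continuous_on UNIV g \<and>
           (\<forall>\<phi>\<in>schwartz. integrable lborel (\<lambda>x. g x * \<phi> x)) \<and>
           (\<forall>\<phi>\<in>schwartz. distD \<alpha> u \<phi> = fun_dist g \<phi>) \<and>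
           poly_fn Q \<and>
           (\<forall>x y. ennreal (norm ((g x - Q x) - (g y - Q y))) \<le>
              ennreal C *
                ((\<integral>\<^sup>+ \<rho>\<in>{0<..<kdist \<kappa> x y}. omega_f \<kappa> B f \<rho> * ennreal (1 / \<rho>) \<partial>lborel)
                 + ennreal (kdist \<kappa> x y) *
                   (\<integral>\<^sup>+ \<rho>\<in>{kdist \<kappa> x y<..}. omega_f \<kappa> B f \<rho> * ennreal (1 / \<rho>\<^sup>2) \<partial>lborel)))))"
proof -
  let ?R = "\<lambda>f x y. (\<integral>\<^sup>+ \<rho>\<in>{0<..<kdist \<kappa> x y}. omega_f \<kappa> B f \<rho> * ennreal (1 / \<rho>) \<partial>lborel)
      + ennreal (kdist \<kappa> x y) * (\<integral>\<^sup>+ \<rho>\<in>{kdist \<kappa> x y<..}. omega_f \<kappa> B f \<rho> * ennreal (1 / \<rho>\<^sup>2) \<partial>lborel)"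
  let ?S = "\<lambda>C \<alpha> a f u. a \<in> adm \<kappa> A B m lam Lam \<longrightarrow>
     (\<forall>\<beta>\<in>B. continuous_on UNIV (f \<beta>) \<and> poly_growth (f \<beta>)) \<longrightarrow> tempered u \<longrightarrow>
     (\<forall>\<phi>\<in>schwartz. (\<Sum>\<alpha>\<in>A. \<Sum>\<beta>\<in>B. a \<alpha> \<beta> * distD (madd \<alpha> \<beta>) u \<phi>) = (\<Sum>\<beta>\<in>B. distD \<beta> (fun_dist (f \<beta>)) \<phi>)) \<longrightarrow>
     (\<integral>\<^sup>+ \<rho>\<in>{0<..<1}. omega_f \<kappa> B f \<rho> * ennreal (1 / \<rho>) \<partial>lborel) < \<infinity> \<longrightarrow>
     (\<integral>\<^sup>+ \<rho>\<in>{1<..}. omega_f \<kappa> B f \<rho> * ennreal (1 / \<rho>\<^sup>2) \<partial>lborel) < \<infinity> \<longrightarrow>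
     (\<exists>g Q. continuous_on UNIV g \<and> (\<forall>\<phi>\<in>schwartz. integrable lborel (\<lambda>x. g x * \<phi> x)) \<and>
           (\<forall>\<phi>\<in>schwartz. distD \<alpha> u \<phi> = fun_dist g \<phi>) \<and> poly_fn Q \<and>
           (\<forall>x y. ennreal (norm ((g x - Q x) - (g y - Q y))) \<le> ennreal C * ?R f x y))"
  have "\<forall>\<alpha>\<in>A. \<exists>C. C \<ge> 0 \<and> (\<forall>a f u. ?S C \<alpha> a f u)"
  proof
    fix \<alpha> assume "\<alpha> \<in> A"
    then have "\<forall>\<beta>\<in>B. mdot (madd \<alpha> \<beta>) \<kappa> = m" using hom by blast
    from schauder_fixed_alpha[of \<kappa>, OF _ finA finB hom lam_pos this, of Lam] kappa_pos
    show "\<exists>C. C \<ge> 0 \<and> (\<forall>a f u. ?S C \<alpha> a f u)" by blast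
  qed
  from bchoice[OF this] obtain Cf where Cf: "\<forall>\<alpha>\<in>A. Cf \<alpha> \<ge> 0 \<and> (\<forall>a f u. ?S (Cf \<alpha>) \<alpha> a f u)" by (elim exE)
  define C where "C = (\<Sum>\<alpha>\<in>A. Cf \<alpha>)"
  have CC: "Cf \<alpha> \<le> C" if "\<alpha> \<in> A" for \<alpha>
    unfolding C_def using Cf finA by (intro member_le_sum[OF that]) auto
  show ?thesis
  proof (intro exI[of _ C] allI impI, elim conjE)
    fix a f and u :: "(real^'n \<Rightarrow> complex) \<Rightarrow> complex" and \<alpha> :: "'n mindex"
    assume el: "\<forall>\<xi>. lam * knorm \<kappa> \<xi> ^ m \<le> norm (symb A B a \<xi>) \<and> norm (symb A B a \<xi>) \<le> Lam * knorm \<kappa> \<xi> ^ m"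
      and f: "\<forall>\<beta>\<in>B. continuous_on UNIV (f \<beta>) \<and> poly_growth (f \<beta>)" and u: "tempered u"
      and pde: "\<forall>\<phi>\<in>schwartz. (\<Sum>\<alpha>\<in>A. \<Sum>\<beta>\<in>B. a \<alpha> \<beta> * distD (madd \<alpha> \<beta>) u \<phi>) = (\<Sum>\<beta>\<in>B. distD \<beta> (fun_dist (f \<beta>)) \<phi>)"
      and i0: "(\<integral>\<^sup>+ \<rho>\<in>{0<..<1}. omega_f \<kappa> B f \<rho> * ennreal (1 / \<rho>) \<partial>lborel) < \<infinity>"
      and i1: "(\<integral>\<^sup>+ \<rho>\<in>{1<..}. omega_f \<kappa> B f \<rho> * ennreal (1 / \<rho>\<^sup>2) \<partial>lborel) < \<infinity>"
      and \<alpha>: "\<forall>\<beta>\<in>B. mdot (madd \<alpha> \<beta>) \<kappa> = m"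
    have \<alpha>A: "\<alpha> \<in> A" using compl \<alpha> by (simp add: B_complete_def)
    have a: "a \<in> adm \<kappa> A B m lam Lam" using el by (simp add: adm_def)
    have "?S (Cf \<alpha>) \<alpha> a f u" using Cf \<alpha>A by blast
    from this[rule_format, OF a] f u pde i0 i1
    obtain g Q where g: "continuous_on UNIV g" "\<forall>\<phi>\<in>schwartz. integrable lborel (\<lambda>x. g x * \<phi> x)"
       "\<forall>\<phi>\<in>schwartz. distD \<alpha> u \<phi> = fun_dist g \<phi>" "poly_fn Q"
       and est: "\<forall>x y. ennreal (norm ((g x - Q x) - (g y - Q y))) \<le> ennreal (Cf \<alpha>) * ?R f x y"
      by blast
    have "\<forall>x y. ennreal (norm ((g x - Q x) - (g y - Q y))) \<le> ennreal C * ?R f x y"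
    proof (intro allI)
      fix x y
      have "ennreal (Cf \<alpha>) * ?R f x y \<le> ennreal C * ?R f x y" by (intro mult_right_mono ennreal_leI CC \<alpha>A) simp
      with est show "ennreal (norm ((g x - Q x) - (g y - Q y))) \<le> ennreal C * ?R f x y" by (meson order_trans)
    qed
    with g show "\<exists>g Q. continuous_on UNIV g \<and> (\<forall>\<phi>\<in>schwartz. integrable lborel (\<lambda>x. g x * \<phi> x)) \<and>
           (\<forall>\<phi>\<in>schwartz. distD \<alpha> u \<phi> = fun_dist g \<phi>) \<and> poly_fn Q \<and>
           (\<forall>x y. ennreal (norm ((g x - Q x) - (g y - Q y))) \<le> ennreal C * ?R f x y)"
      by blast
  qed
qed

end
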